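(* Fix $\kappa_1,\kappa_2,\nu\in(0,1)$ and $\lambda^{(1)},\epsilon^{(1)}>0$, and for $k\ge1$ set $$\lambda^{(k+1)}=\nu\,\lambda^{(k)},\qquad \epsilon^{(k+1)}=\nu^2\,\epsilon^{(k)},\qquad \tau^{(k)}=\kappa_1\,\epsilon^{(k)},\qquad \xi^{(k)}=\kappa_2\,\epsilon^{(k)}.$$ Then, for every $\epsilon>0$, Algorithm FALC run with these parameters computes an $\epsilon$-feasible and $\epsilon$-optimal solution $\bar X\in\mathbb{R}^{m\times n}$ to the problem $$\min_{X\in\mathbb{R}^{m\times n}}\ \mu_1\|\sigma(X)\|_\alpha+\mu_2\|\mathcal{C}(X)-d\|_\beta\quad\text{subject to}\quad \mathcal{A}(X)-b\in\mathcal{Q}$$ in a total of $N_{\rm inner}=\mathcal{O}(1/\epsilon)$ Algorithm APG iterations (as $\epsilon\to0$, the hidden constant being independent of $\epsilon$).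
   Context: Setting: $\alpha,\beta\in\{1,2,\infty\}$; $\mu_1,\mu_2>0$; $\mathcal{A}:\mathbb{R}^{m\times n}\to\mathbb{R}^q$ is a surjective linear map and $\mathcal{C}:\mathbb{R}^{m\times n}\to\mathbb{R}^p$ is a linear map, represented by matrices via $\mathcal{A}(X)=A\,\mathrm{vec}(X)$, $\mathcal{C}(X)=C\,\mathrm{vec}(X)$; $b\in\mathbb{R}^q$, $d\in\mathbb{R}^p$; $\mathcal{Q}\subset\mathbb{R}^q$ is nonempty, closed and convex. $\sigma(X)$ is the vector of singular values of $X$, $\|\cdot\|_\alpha,\|\cdot\|_\beta$ are the vector $\ell_\alpha,\ell_\beta$ norms, and $\Pi_{\mathcal{Q}}$ is the Euclidean projection onto $\mathcal{Q}$. Let $I(\alpha)=\sqrt{\min\{m,n\}}$ if $\alpha=\infty$ and $1$ otherwise; $J(\beta)=\sqrt p$ if $\beta=\infty$ and $1$ otherwise. Let $M=\begin{pmatrix}-I&0&C\\0&-I&A\end{pmatrix}$ and $L=\sigma_{\max}(M)^2$, where $\sigma_{\max}$ is the largest singular value. Algorithm FALC. Input: positive parameters $\{(\lambda^{(k)},\epsilon^{(k)},\tau^{(k)},\xi^{(k)})\}_{k\ge1}$ and $X^{(0)}$ with $\mathcal{A}(X^{(0)})-b\in\mathcal{Q}$. Set $y^{(0)}=\mathcal{A}(X^{(0)})-b$, $s^{(0)}=\mathcal{C}(X^{(0)})-d$, $\eta=\mu_1\|\sigma(X^{(0)})\|_\alpha+\mu_2\|\mathcal{C}(X^{(0)})-d\|_\beta$,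 $\theta_1^{(1)}=0\in\mathbb{R}^q$, $\theta_2^{(1)}=0\in\mathbb{R}^p$. The iterations run over $k=1,2,\dots$. In iteration $k$ let $$p^{(k)}(X,s,y)=\lambda^{(k)}(\mu_1\|\sigma(X)\|_\alpha+\mu_2\|s\|_\beta),$$ $$f^{(k)}(X,s,y)=\tfrac12\|\mathcal{A}(X)-y-b-\lambda^{(k)}\theta_1^{(k)}\|_2^2+\tfrac12\|\mathcal{C}(X)-s-d-\lambda^{(k)}\theta_2^{(k)}\|_2^2,$$ $P^{(k)}=p^{(k)}+f^{(k)}$ (the $k$-th subproblem is $\min\{P^{(k)}(X,s,y): X\in\mathbb{R}^{m\times n}, s\in\mathbb{R}^p, y\in\mathcal{Q}\}$), $\eta_1^{(k)}=\eta+\frac{\lambda^{(k)}}2(\|\theta_1^{(k)}\|_2^2+\|\theta_2^{(k)}\|_2^2)$, $\eta_2^{(k)}=\sigma_{\max}(A)\frac{I(\alpha)}{\mu_1}\eta_1^{(k)}+\|b+\lambda^{(k)}\theta_1^{(k)}\|_2+2\|\mathcal{A}(X^{(0)})-b\|_2$, $\mathcal{S}^{(k)}=\{(X,s,y):\mu_1\|\sigma(X)\|_\alpha\le\eta_1^{(k)},\ \mu_2\|s\|_\beta\le\eta_1^{(k)}\}$, and $$\ell_{\max}^{(k)}=\sqrt{\tfrac{2L}{\epsilon^{(k)}}}\Big[\Big(\tfrac{I(\alpha)}{\mu_1}+\tfrac{J(\beta)}{\mu_2}\Big)\eta_1^{(k)}+\eta_2^{(k)}+\|X^{(k-1)}\|_F+\|s^{(k-1)}\|_2+\|y^{(k-1)}\|_2\Big].$$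 Then $(X^{(k)},s^{(k)},y^{(k)})$ is the output of the following inner routine (Algorithm APG): put $z_1^{(0)}=z_2^{(1)}=(X^{(k-1)},s^{(k-1)},y^{(k-1)})$, $t^{(1)}=1$, $\ell=0$; while neither ITERstop nor GRADstop holds at the current $\ell$ and $z_1^{(\ell)}$, set $\ell\leftarrow\ell+1$, $$z_1^{(\ell)}=\mathrm{argmin}\big\{p^{(k)}(z)+\langle\nabla f^{(k)}(z_2^{(\ell)}),z-z_2^{(\ell)}\rangle+\tfrac L2\|z-z_2^{(\ell)}\|^2:\ z=(X,s,y)\in\mathcal{S}^{(k)},\ y\in\mathcal{Q}\big\},$$ $t^{(\ell+1)}=\big(1+\sqrt{1+4(t^{(\ell)})^2}\big)/2$, $z_2^{(\ell+1)}=z_1^{(\ell)}+\frac{t^{(\ell)}-1}{t^{(\ell+1)}}(z_1^{(\ell)}-z_1^{(\ell-1)})$; return $z_1^{(\ell)}$. Here $\|(X,s,y)\|^2=\|X\|_F^2+\|s\|_2^2+\|y\|_2^2$; ITERstop holds iff $\ell\ge\ell_{\max}^{(k)}$; GRADstop holds at $(X,s,y)$ iff both: there are $G\in\lambda^{(k)}\mu_1\,\partial\|\sigma(\cdot)\|_\alpha(X)+\nabla_Xf^{(k)}(X,s,y)$ and $g\in\lambda^{(k)}\mu_2\,\partial\|\cdot\|_\beta(s)+\nabla_sf^{(k)}(X,s,y)$ with $\sqrt{\|G\|_F^2+\|g\|_2^2}\le\tau^{(k)}$; and $\|y-\Pi_{\mathcal{Q}}(y-\frac1L\nabla_yf^{(k)}(X,s,y))\|_2\le\xi^{(k)}$.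 Finally the multipliers are updated by $\theta_1^{(k+1)}=\theta_1^{(k)}-\frac{\mathcal{A}(X^{(k)})-y^{(k)}-b}{\lambda^{(k)}}$ and $\theta_2^{(k+1)}=\theta_2^{(k)}-\frac{\mathcal{C}(X^{(k)})-s^{(k)}-d}{\lambda^{(k)}}$. Let $P^\ast$ be the optimal value of the problem. $\bar X$ is $\epsilon$-feasible if there is $\bar y\in\mathcal{Q}$ with $\|\mathcal{A}(\bar X)-\bar y-b\|_2\le\epsilon$, and $\epsilon$-optimal if $\big|\mu_1\|\sigma(\bar X)\|_\alpha+\mu_2\|\mathcal{C}(\bar X)-d\|_\beta-P^\ast\big|\le\epsilon$. $N^{(k)}$ is the number of APG iterations (final value of $\ell$) performed in FALC iteration $k$, $N_{\rm FALC}(\epsilon)$ is the number of FALC iterations until an iterate $X^{(k)}$ is $\epsilon$-feasible and $\epsilon$-optimal, and $N_{\rm inner}=\sum_{k=1}^{N_{\rm FALC}(\epsilon)}N^{(k)}$. *)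

theory Defs
  imports "HOL-Analysis.Analysis" "HOL-Library.Landau_Symbols" "HOL-Library.Multiset"
begin

section \<open>Norms, singular values, gradients\<close>

datatype ell = L1 | L2 | Linf

fun ell_norm :: "ell \<Rightarrow> 'i set \<Rightarrow> ('i \<Rightarrow> real) \<Rightarrow> real" where
  "ell_norm L1 I x = (\<Sum>i\<in>I. \<bar>x i\<bar>)"
| "ell_norm L2 I x = sqrt (\<Sum>i\<in>I. (x i)\<^sup>2)"
| "ell_norm Linf I x = Max ((\<lambda>i. \<bar>x i\<bar>) ` I)"

definition vec_norm :: "ell \<Rightarrow> real ^ 'n \<Rightarrow> real" where
  "vec_norm \<alpha> x = ell_norm \<alpha> UNIV (\<lambda>i. x $ i)"

text \<open>The list of the \<open>min m n\<close> singular values in decreasing order, read off from a singular value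
  decomposition \<open>X = \<Sum>i. xs!i u\<^sub>i v\<^sub>i\<^sup>T\<close>.  Existence and uniqueness are proved in
  \<open>has_singular_values_singular_values\<close> and \<open>singular_values_eqI\<close> below.\<close>

definition has_singular_values :: "real ^ 'n ^ 'm \<Rightarrow> real list \<Rightarrow> bool" where
  "has_singular_values X xs \<longleftrightarrow>
     length xs = min CARD('m) CARD('n) \<and> sorted_wrt (\<ge>) xs \<and> (\<forall>x\<in>set xs. 0 \<le> x) \<and>
     (\<exists>(u :: nat \<Rightarrow> real ^ 'm) (v :: nat \<Rightarrow> real ^ 'n).
        (\<forall>i<length xs. \<forall>j<length xs. u i \<bullet> u j = (if i = j then 1 else 0)) \<and>
        (\<forall>i<length xs. \<forall>j<length xs. v i \<bullet> v j = (if i = j then 1 else 0)) \<and>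
        X = (\<chi> a c. \<Sum>i<length xs. xs ! i * u i $ a * v i $ c))"

definition singular_values :: "real ^ 'n ^ 'm \<Rightarrow> real list" where
  "singular_values X = (THE xs. has_singular_values X xs)"

definition sv_norm :: "ell \<Rightarrow> real ^ 'n ^ 'm \<Rightarrow> real" where
  "sv_norm \<alpha> X = ell_norm \<alpha> {..<length (singular_values X)} (\<lambda>i. singular_values X ! i)"

definition sigma_max :: "real ^ 'n ^ 'm \<Rightarrow> real" where
  "sigma_max X = Max (set (singular_values X))"

definition gradient :: "('a::real_inner \<Rightarrow> real) \<Rightarrow> 'a \<Rightarrow> 'a" where
  "gradient f x = (THE g. GDERIV f x :> g)"

lemma gradient_eqI:
  assumes "GDERIV f x :> g"
  shows "gradient f x = g"
  unfolding gradient_def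
proof (rule the_equality, rule assms)
  fix g' assume "GDERIV f x :> g'"
  with assms have "(\<lambda>h. h \<bullet> g') = (\<lambda>h. h \<bullet> g)"
    unfolding gderiv_def by (rule has_derivative_unique[OF _ _, rotated])
  then have "h \<bullet> g' = h \<bullet> g" for h by meson
  then show "g' = g" by (metis vector_eq_ldot vector_eq_rdot)
qed

definition subdifferential :: "('a::real_inner \<Rightarrow> real) \<Rightarrow> 'a \<Rightarrow> 'a set" where
  "subdifferential f x = {g. \<forall>z. f x + g \<bullet> (z - x) \<le> f z}"


subsection \<open>Existence and uniqueness of the singular values\<close>

lemma orthonormal_family_complete:
  fixes v :: "nat \<Rightarrow> 'a::euclidean_space"
  assumes "\<forall>i<k. \<forall>j<k. v i \<bullet> v j = (if i = j then 1 else 0)"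
  shows "J \<subseteq> {..<k} \<Longrightarrow> independent (v ` J)"
    and "inj_on v {..<k}"
    and "\<lbrakk>k = DIM('a); \<And>i. i < k \<Longrightarrow> v i \<bullet> x = 0\<rbrakk> \<Longrightarrow> x = 0"
proof -
  show inj: "inj_on v {..<k}"
    using assms by (intro inj_onI) (metis lessThan_iff zero_neq_one)
  show ind: "independent (v ` J)" if "J \<subseteq> {..<k}" for J
  proof (rule pairwise_orthogonal_independent)
    show "pairwise orthogonal (v ` J)"
      using assms that by (auto simp: pairwise_def orthogonal_def) (metis lessThan_iff subsetD)
    show "0 \<notin> v ` J"
    proof
      assume "0 \<in> v ` J"
      then obtain i where "i \<in> J" "v i = 0" by force
      then show False using assms that by (metis inner_zero_left lessThan_iff subsetD zero_neq_one)
    qed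
  qed
  show "x = 0" if k: "k = DIM('a)" and x: "\<And>i. i < k \<Longrightarrow> v i \<bullet> x = 0"
  proof -
    have "card (v ` {..<k}) = DIM('a)" using inj k by (simp add: card_image)
    then have "span (v ` {..<k}) = UNIV"
      using card_ge_dim_independent[OF _ ind[OF subset_refl], of UNIV] by auto
    then have "orthogonal x x"
      using x by (intro orthogonal_to_span[of x "v ` {..<k}" x]) (auto simp: orthogonal_def inner_commute)
    then show ?thesis by (simp add: orthogonal_def)
  qed
qed

lemma unit_vector_orthogonal_exists:
  fixes v :: "nat \<Rightarrow> 'a::euclidean_space"
  assumes "k < DIM('a)"
  obtains w where "norm w = 1" "\<And>i. i < k \<Longrightarrow> v i \<bullet> w = 0"
proof -
  have "dim (v ` {..<k}) \<le> card (v ` {..<k})" by (intro dim_le_card') auto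
  also have "\<dots> \<le> k" using card_image_le[of "{..<k}" v] by simp
  finally have "dim (v ` {..<k}) < DIM('a)" using assms by simp
  then obtain x where x: "x \<noteq> 0" "\<And>y. y \<in> span (v ` {..<k}) \<Longrightarrow> orthogonal x y"
    using orthogonal_to_subspace_exists by metis
  have "orthogonal x (v i)" if "i < k" for i
    using that by (intro x(2) span_base) auto
  then show ?thesis using x(1)
    by (intro that[of "x /\<^sub>R norm x"]) (auto simp: orthogonal_def inner_commute)
qed

text \<open>The first singular triples of \<open>X\<close>, constructed by successive maximization of \<open>norm (X *v w)\<close>.\<close>

definition partial_svd ::
    "real ^ 'n ^ 'm \<Rightarrow> real list \<Rightarrow> (nat \<Rightarrow> real ^ 'm) \<Rightarrow> (nat \<Rightarrow> real ^ 'n) \<Rightarrow> bool" where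
  "partial_svd X xs u v \<longleftrightarrow>
     sorted_wrt (\<ge>) xs \<and> (\<forall>x\<in>set xs. 0 \<le> x) \<and>
     (\<forall>i<length xs. \<forall>j<length xs. u i \<bullet> u j = (if i = j then 1 else 0)) \<and>
     (\<forall>i<length xs. \<forall>j<length xs. v i \<bullet> v j = (if i = j then 1 else 0)) \<and>
     (\<forall>i<length xs. X *v v i = xs ! i *\<^sub>R u i \<and> u i v* X = xs ! i *\<^sub>R v i) \<and>
     (\<forall>w. (\<forall>i<length xs. v i \<bullet> w = 0) \<longrightarrow> (\<forall>x\<in>set xs. norm (X *v w) \<le> x * norm w))"

lemma quadratic_domination:
  fixes c K :: real
  assumes "\<And>t. 2 * t * c \<le> K * t\<^sup>2" "0 \<le> K"
  shows "c = 0"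
proof (rule ccontr)
  assume "c \<noteq> 0"
  define e where "e = c / (K + 1)"
  have c: "c = e * (K + 1)" using assms(2) by (simp add: e_def)
  with \<open>c \<noteq> 0\<close> have "e \<noteq> 0" by auto
  have "2 * e * c \<le> K * e\<^sup>2" by (rule assms)
  then have "e\<^sup>2 * (K + 2) \<le> 0" by (simp add: c power2_eq_square algebra_simps)
  moreover have "e\<^sup>2 * (K + 2) > 0" using assms(2) \<open>e \<noteq> 0\<close> by simp
  ultimately show False by linarith
qed

lemma partial_svd_extend:
  fixes X :: "real ^ 'n ^ 'm"
  assumes ps: "partial_svd X xs u v" and len: "length xs < min CARD('m) CARD('n)"
  obtains x u' v' where "partial_svd X (xs @ [x]) u' v'"
proof -
  define k where "k = length xs"
  have ou: "\<And>i j. i < k \<Longrightarrow> j < k \<Longrightarrow> u i \<bullet> u j = (if i = j then 1 else 0)"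
    and ov: "\<And>i j. i < k \<Longrightarrow> j < k \<Longrightarrow> v i \<bullet> v j = (if i = j then 1 else 0)"
    and Xv: "\<And>i. i < k \<Longrightarrow> X *v v i = xs ! i *\<^sub>R u i"
    and uX: "\<And>i. i < k \<Longrightarrow> u i v* X = xs ! i *\<^sub>R v i"
    and bd: "\<And>w x. (\<And>i. i < k \<Longrightarrow> v i \<bullet> w = 0) \<Longrightarrow> x \<in> set xs \<Longrightarrow> norm (X *v w) \<le> x * norm w"
    and sorted: "sorted_wrt (\<ge>) xs" "\<forall>x\<in>set xs. 0 \<le> x"
    using ps by (auto simp: partial_svd_def k_def)
  define W where "W = {w. \<forall>i<k. v i \<bullet> w = 0}"
  have W_eq: "W = (\<Inter>i\<in>{..<k}. {w. v i \<bullet> w = 0})" by (auto simp: W_def)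
  have "closed W" unfolding W_eq by (intro closed_INT ballI closed_hyperplane)
  then have "compact (sphere 0 1 \<inter> W)" by (intro compact_Int_closed) auto
  moreover have "sphere 0 1 \<inter> W \<noteq> {}"
  proof -
    have "k < DIM(real ^ 'n)" using len by (simp add: k_def)
    from unit_vector_orthogonal_exists[OF this, of v] obtain w :: "real ^ 'n"
      where "norm w = 1" "\<And>i. i < k \<Longrightarrow> v i \<bullet> w = 0" by blast
    then have "w \<in> sphere 0 1 \<inter> W" by (auto simp: W_def)
    then show ?thesis by blast
  qed
  moreover have "continuous_on (sphere 0 1 \<inter> W) (\<lambda>w. norm (X *v w))"
    by (intro continuous_intros matrix_vector_mult_linear_continuous_on)
  ultimately obtain v0 where v0: "v0 \<in> sphere 0 1 \<inter> W"
    "\<And>w. w \<in> sphere 0 1 \<inter> W \<Longrightarrow> norm (X *v w) \<le> norm (X *v v0)"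
    using continuous_attains_sup by metis
  define s where "s = norm (X *v v0)"
  have "s \<ge> 0" by (simp add: s_def)
  have nv0: "norm v0 = 1" "v0 \<bullet> v0 = 1" and v0W: "\<And>i. i < k \<Longrightarrow> v i \<bullet> v0 = 0"
    using v0(1) by (auto simp: W_def norm_eq_1)
  have W_sub: "x + c *\<^sub>R y \<in> W" "c *\<^sub>R x \<in> W" if "x \<in> W" "y \<in> W" for x y c
    using that by (auto simp: W_def inner_right_distrib)
  have smax: "norm (X *v w) \<le> s * norm w" if "w \<in> W" for w
  proof (cases "w = 0")
    case False
    have "norm (X *v ((1 / norm w) *\<^sub>R w)) \<le> s"
      unfolding s_def using False that W_sub by (intro v0(2)) auto
    then have "norm (X *v w) / norm w \<le> s"
      by (simp only: matrix_vector_mult_scaleR norm_scaleR) (use False in \<open>simp add: divide_simps\<close>)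
    then show ?thesis using False by (simp add: divide_simps mult.commute)
  qed simp
  have orth: "(X *v w) \<bullet> (X *v v0) = 0" if "w \<in> W" "w \<bullet> v0 = 0" for w
  proof (rule quadratic_domination)
    fix t :: real
    have "norm (X *v (v0 + t *\<^sub>R w)) \<le> s * norm (v0 + t *\<^sub>R w)"
      using v0 that by (intro smax W_sub) auto
    then have "(norm (X *v (v0 + t *\<^sub>R w)))\<^sup>2 \<le> s\<^sup>2 * (norm (v0 + t *\<^sub>R w))\<^sup>2"
      using power_mono[of _ _ 2] by (fastforce simp: power_mult_distrib)
    moreover have "(norm (X *v (v0 + t *\<^sub>R w)))\<^sup>2 =
        s\<^sup>2 + 2 * t * ((X *v w) \<bullet> (X *v v0)) + t\<^sup>2 * (norm (X *v w))\<^sup>2"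
      using dot_norm[of "X *v v0" "t *\<^sub>R (X *v w)"]
      by (simp add: s_def matrix_vector_right_distrib matrix_vector_mult_scaleR power_mult_distrib
          inner_commute[of "X *v w" "X *v v0"])
    moreover have "(norm (v0 + t *\<^sub>R w))\<^sup>2 = 1 + t\<^sup>2 * (norm w)\<^sup>2"
      using dot_norm[of v0 "t *\<^sub>R w"] that nv0 by (simp add: power_mult_distrib inner_commute[of w v0])
    ultimately have "2 * t * ((X *v w) \<bullet> (X *v v0)) + t\<^sup>2 * (norm (X *v w))\<^sup>2 \<le> (s\<^sup>2 * (norm w)\<^sup>2) * t\<^sup>2"
      by (simp add: algebra_simps)
    then show "2 * t * ((X *v w) \<bullet> (X *v v0)) \<le> (s\<^sup>2 * (norm w)\<^sup>2) * t\<^sup>2"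
      by (rule order.trans[rotated]) simp
  qed simp
  have "\<exists>u0. norm u0 = 1 \<and> (\<forall>i<k. u i \<bullet> u0 = 0) \<and> X *v v0 = s *\<^sub>R u0 \<and> u0 v* X = s *\<^sub>R v0"
  proof (cases "s = 0")
    case True
    have "k < DIM(real ^ 'm)" using len by (simp add: k_def)
    from unit_vector_orthogonal_exists[OF this, of u] obtain u0 :: "real ^ 'm"
      where u0: "norm u0 = 1" "\<And>i. i < k \<Longrightarrow> u i \<bullet> u0 = 0" by blast
    have "v i \<bullet> (u0 v* X) = 0" if "i < k" for i
      by (subst inner_commute, subst dot_lmul_matrix) (use that Xv u0 in \<open>simp add: inner_commute\<close>)
    then have "u0 v* X \<in> W" by (simp add: W_def)
    from smax[OF this] have "X *v (u0 v* X) = 0" using True by simp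
    then have "(u0 v* X) \<bullet> (u0 v* X) = 0" by (simp only: dot_lmul_matrix) simp
    then have "u0 v* X = 0" by simp
    moreover have "X *v v0 = 0" using True by (simp add: s_def)
    ultimately show ?thesis using u0 True by auto
  next
    case False
    define u0 where "u0 = (1 / s) *\<^sub>R (X *v v0)"
    have Xv0: "X *v v0 = s *\<^sub>R u0" using False by (simp add: u0_def)
    have nu0: "norm u0 = 1" using False \<open>s \<ge> 0\<close> by (simp add: u0_def flip: s_def)
    have uu0: "u i \<bullet> u0 = 0" if "i < k" for i
    proof -
      have "u i \<bullet> (X *v v0) = 0"
        by (subst dot_lmul_matrix[symmetric]) (use that uX v0W in simp)
      then show ?thesis by (simp add: u0_def)
    qed
    define r where "r = u0 v* X - s *\<^sub>R v0"
    have "v i \<bullet> (u0 v* X) = 0" if "i < k" for i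
      by (subst inner_commute, subst dot_lmul_matrix) (use that Xv uu0 in \<open>simp add: inner_commute\<close>)
    then have "r \<in> W" using v0W by (simp add: W_def r_def inner_diff_right)
    moreover have rv0: "r \<bullet> v0 = 0"
      using nv0 nu0 Xv0 by (simp add: r_def inner_diff_left dot_lmul_matrix norm_eq_1)
    ultimately have "(X *v r) \<bullet> (X *v v0) = 0" by (rule orth)
    then have "u0 \<bullet> (X *v r) = 0" by (simp add: u0_def inner_commute)
    then have "(u0 v* X) \<bullet> r = 0" by (simp add: dot_lmul_matrix)
    then have "r \<bullet> r = 0" using rv0 by (simp add: r_def inner_diff_left inner_diff_right inner_commute)
    then have "u0 v* X = s *\<^sub>R v0" by (simp add: r_def)
    then show ?thesis using Xv0 nu0 uu0 by blast
  qed
  then obtain u0 where u0: "norm u0 = 1" "\<And>i. i < k \<Longrightarrow> u i \<bullet> u0 = 0"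
    "X *v v0 = s *\<^sub>R u0" "u0 v* X = s *\<^sub>R v0" by blast
  have u00: "u0 \<bullet> u0 = 1" using u0(1) by (simp add: norm_eq_1)
  have "partial_svd X (xs @ [s]) (u(k := u0)) (v(k := v0))"
    unfolding partial_svd_def
  proof (intro conjI)
    have "s \<le> x" if "x \<in> set xs" for x
      using bd[of v0 x] v0W that nv0 by (simp add: s_def)
    then show "sorted_wrt (\<ge>) (xs @ [s])" using sorted by (simp add: sorted_wrt_append)
    show "\<forall>x\<in>set (xs @ [s]). 0 \<le> x" using sorted \<open>s \<ge> 0\<close> by auto
    show "\<forall>i<length (xs @ [s]). \<forall>j<length (xs @ [s]).
        (u(k := u0)) i \<bullet> (u(k := u0)) j = (if i = j then 1 else 0)"
      using ou u0(2) u00 by (auto simp: less_Suc_eq inner_commute simp flip: k_def)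
    show "\<forall>i<length (xs @ [s]). \<forall>j<length (xs @ [s]).
        (v(k := v0)) i \<bullet> (v(k := v0)) j = (if i = j then 1 else 0)"
      using ov v0W nv0 by (auto simp: less_Suc_eq inner_commute simp flip: k_def)
    show "\<forall>i<length (xs @ [s]). X *v (v(k := v0)) i = (xs @ [s]) ! i *\<^sub>R (u(k := u0)) i \<and>
        (u(k := u0)) i v* X = (xs @ [s]) ! i *\<^sub>R (v(k := v0)) i"
      using Xv uX u0 by (auto simp: less_Suc_eq nth_append simp flip: k_def)
    show "\<forall>w. (\<forall>i<length (xs @ [s]). (v(k := v0)) i \<bullet> w = 0) \<longrightarrow>
        (\<forall>x\<in>set (xs @ [s]). norm (X *v w) \<le> x * norm w)"
    proof (intro allI impI ballI)
      fix w x
      assume w: "\<forall>i<length (xs @ [s]). (v(k := v0)) i \<bullet> w = 0" and x: "x \<in> set (xs @ [s])"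
      have w': "v i \<bullet> w = 0" if "i < k" for i
        using w[rule_format, of i] that by (simp add: k_def)
      then show "norm (X *v w) \<le> x * norm w"
        using x bd[of w x] smax[of w] by (auto simp: W_def)
    qed
  qed
  then show ?thesis by (rule that)
qed

lemma partial_svd_exists:
  fixes X :: "real ^ 'n ^ 'm"
  shows "k \<le> min CARD('m) CARD('n) \<Longrightarrow> \<exists>xs u v. length xs = k \<and> partial_svd X xs u v"
proof (induction k)
  case 0
  show ?case by (auto simp: partial_svd_def)
next
  case (Suc k)
  then obtain xs u v where "length xs = k" "partial_svd X xs u v" by auto
  moreover from this Suc.prems obtain x u' v' where "partial_svd X (xs @ [x]) u' v'"
    using partial_svd_extend[of X xs u v] by auto
  ultimately show ?case by (intro exI[of _ "xs @ [x]"]) auto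
qed

lemma outer_sum_mult:
  fixes u :: "nat \<Rightarrow> real ^ 'm" and v :: "nat \<Rightarrow> real ^ 'n"
  shows "(\<chi> a c. \<Sum>i<k. x i * u i $ a * v i $ c) *v w = (\<Sum>i<k. (x i * (v i \<bullet> w)) *\<^sub>R u i)"
    and "y v* (\<chi> a c. \<Sum>i<k. x i * u i $ a * v i $ c) = (\<Sum>i<k. (x i * (u i \<bullet> y)) *\<^sub>R v i)"
proof -
  show "(\<chi> a c. \<Sum>i<k. x i * u i $ a * v i $ c) *v w = (\<Sum>i<k. (x i * (v i \<bullet> w)) *\<^sub>R u i)"
    unfolding vec_eq_iff matrix_vector_mult_def inner_vec_def
    by (auto simp: sum_distrib_right sum_distrib_left) (subst sum.swap, auto simp: mult_ac intro!: sum.cong)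
  show "y v* (\<chi> a c. \<Sum>i<k. x i * u i $ a * v i $ c) = (\<Sum>i<k. (x i * (u i \<bullet> y)) *\<^sub>R v i)"
    unfolding vec_eq_iff vector_matrix_mult_def inner_vec_def
    by (auto simp: sum_distrib_right sum_distrib_left) (subst sum.swap, auto simp: mult_ac intro!: sum.cong)
qed

lemma singular_values_exist:
  fixes X :: "real ^ 'n ^ 'm"
  shows "\<exists>xs. has_singular_values X xs"
proof -
  define k where "k = min CARD('m) CARD('n)"
  obtain xs u v where len: "length xs = k" and ps: "partial_svd X xs u v"
    using partial_svd_exists[of k X] by (auto simp: k_def)
  have ou: "\<forall>i<k. \<forall>j<k. u i \<bullet> u j = (if i = j then 1 else 0)"
    and ov: "\<forall>i<k. \<forall>j<k. v i \<bullet> v j = (if i = j then 1 else 0)"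
    and Xv: "\<And>i. i < k \<Longrightarrow> X *v v i = xs ! i *\<^sub>R u i"
    and uX: "\<And>i. i < k \<Longrightarrow> u i v* X = xs ! i *\<^sub>R v i"
    using ps len by (auto simp: partial_svd_def)
  have inner_sum_eq: "z j \<bullet> (\<Sum>i<k. c i *\<^sub>R z i) = c j"
    if "\<forall>i<k. \<forall>j<k. z i \<bullet> z j = (if i = j then 1 else 0)" "j < k"
    for z :: "nat \<Rightarrow> 'c::real_inner" and c j
  proof -
    have "z j \<bullet> (\<Sum>i<k. c i *\<^sub>R z i) = (\<Sum>i<k. if i = j then c i else 0)"
      unfolding inner_sum_right using that by (intro sum.cong) auto
    then show ?thesis using that by (simp add: sum.delta)
  qed
  have "X *v w = (\<Sum>i<k. (xs ! i * (v i \<bullet> w)) *\<^sub>R u i)" for w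
  proof (cases "k = CARD('n)")
    case True
    define w' where "w' = w - (\<Sum>i<k. (v i \<bullet> w) *\<^sub>R v i)"
    have "v j \<bullet> w' = 0" if "j < k" for j
      using inner_sum_eq[OF ov that] by (simp add: w'_def inner_diff_right)
    with orthonormal_family_complete(3)[OF ov] True have "w' = 0" by simp
    then have "w = (\<Sum>i<k. (v i \<bullet> w) *\<^sub>R v i)" by (simp add: w'_def)
    then have "X *v w = X *v (\<Sum>i<k. (v i \<bullet> w) *\<^sub>R v i)" by simp
    also have "\<dots> = (\<Sum>i<k. X *v ((v i \<bullet> w) *\<^sub>R v i))"
      by (rule linear_sum) (rule matrix_vector_mul_linear)
    also have "\<dots> = (\<Sum>i<k. (xs ! i * (v i \<bullet> w)) *\<^sub>R u i)"
      by (intro sum.cong) (auto simp: matrix_vector_mult_scaleR Xv)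
    finally show ?thesis .
  next
    case False
    then have k: "k = CARD('m)" by (auto simp: k_def min_def split: if_splits)
    define y where "y = X *v w - (\<Sum>i<k. (xs ! i * (v i \<bullet> w)) *\<^sub>R u i)"
    have "u j \<bullet> y = 0" if "j < k" for j
    proof -
      have "u j \<bullet> (X *v w) = xs ! j * (v j \<bullet> w)"
        by (subst dot_lmul_matrix[symmetric]) (use that uX in simp)
      then show ?thesis using inner_sum_eq[OF ou that] by (simp add: y_def inner_diff_right)
    qed
    with orthonormal_family_complete(3)[OF ou] k have "y = 0" by simp
    then show ?thesis by (simp add: y_def)
  qed
  then have "X = (\<chi> a c. \<Sum>i<k. xs ! i * u i $ a * v i $ c)"
    by (simp add: matrix_eq outer_sum_mult(1))
  then have "has_singular_values X xs"
    using ps len unfolding has_singular_values_def partial_svd_def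
    by (intro conjI exI[of _ u] exI[of _ v]) (simp_all add: k_def)
  then show ?thesis ..
qed

lemma has_singular_values_count:
  fixes X :: "real ^ 'n ^ 'm"
  assumes "has_singular_values X xs" "t > 0"
  shows "count (mset xs) t = dim {w. (X *v w) v* X = t\<^sup>2 *\<^sub>R w}"
proof -
  define k where "k = length xs"
  obtain u v where ou: "\<forall>i<k. \<forall>j<k. u i \<bullet> u j = (if i = j then 1 else 0)"
    and ov: "\<forall>i<k. \<forall>j<k. v i \<bullet> v j = (if i = j then 1 else 0)"
    and X: "X = (\<chi> a c. \<Sum>i<k. xs ! i * u i $ a * v i $ c)"
    and pos: "\<forall>x\<in>set xs. 0 \<le> x"
    using assms(1) unfolding has_singular_values_def k_def by auto
  have inner_sum_eq: "z j \<bullet> (\<Sum>i<k. c i *\<^sub>R z i) = c j"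
    if "\<forall>i<k. \<forall>j<k. z i \<bullet> z j = (if i = j then 1 else 0)" "j < k"
    for z :: "nat \<Rightarrow> 'c::real_inner" and c j
  proof -
    have "z j \<bullet> (\<Sum>i<k. c i *\<^sub>R z i) = (\<Sum>i<k. if i = j then c i else 0)"
      unfolding inner_sum_right using that by (intro sum.cong) auto
    then show ?thesis using that by (simp add: sum.delta)
  qed
  have gram: "(X *v w) v* X = (\<Sum>i<k. ((xs ! i)\<^sup>2 * (v i \<bullet> w)) *\<^sub>R v i)" for w
  proof -
    have "(X *v w) v* X = (\<Sum>i<k. (xs ! i * (u i \<bullet> (X *v w))) *\<^sub>R v i)"
      using outer_sum_mult(2)[where y = "X *v w" and k = k and x = "(!) xs" and u = u and v = v] X by simp
    also have "\<dots> = (\<Sum>i<k. ((xs ! i)\<^sup>2 * (v i \<bullet> w)) *\<^sub>R v i)"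
    proof (intro sum.cong refl)
      fix i assume "i \<in> {..<k}"
      then have "u i \<bullet> (X *v w) = xs ! i * (v i \<bullet> w)"
        using outer_sum_mult(1)[where k = k and x = "(!) xs" and u = u and v = v and w = w]
          inner_sum_eq[OF ou] X by simp
      then show "(xs ! i * (u i \<bullet> (X *v w))) *\<^sub>R v i = ((xs ! i)\<^sup>2 * (v i \<bullet> w)) *\<^sub>R v i"
        by (simp add: power2_eq_square)
    qed
    finally show ?thesis .
  qed
  define J where "J = {i. i < k \<and> xs ! i = t}"
  have Jk: "J \<subseteq> {..<k}" by (auto simp: J_def)
  have "{w. (X *v w) v* X = t\<^sup>2 *\<^sub>R w} = span (v ` J)"
  proof (rule equalityI, rule subsetI)
    fix w assume "w \<in> {w. (X *v w) v* X = t\<^sup>2 *\<^sub>R w}"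
    then have eq: "(\<Sum>i<k. ((xs ! i)\<^sup>2 * (v i \<bullet> w)) *\<^sub>R v i) = t\<^sup>2 *\<^sub>R w" by (simp add: gram)
    have z: "v j \<bullet> w = 0" if "j < k" "j \<notin> J" for j
    proof -
      have "(xs ! j)\<^sup>2 * (v j \<bullet> w) = t\<^sup>2 * (v j \<bullet> w)"
        unfolding inner_sum_eq[OF ov that(1), of "\<lambda>i. (xs ! i)\<^sup>2 * (v i \<bullet> w)", symmetric] eq by simp
      moreover have "(xs ! j)\<^sup>2 \<noteq> t\<^sup>2"
        using that pos assms(2) by (auto simp: J_def power2_eq_iff k_def dest!: nth_mem)
      ultimately show ?thesis by simp
    qed
    have "t\<^sup>2 *\<^sub>R w \<in> span (v ` J)"
      unfolding eq[symmetric]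
    proof (rule span_sum)
      fix i assume "i \<in> {..<k}"
      then show "((xs ! i)\<^sup>2 * (v i \<bullet> w)) *\<^sub>R v i \<in> span (v ` J)"
        using z[of i] by (cases "i \<in> J") (auto intro: span_scale[OF span_base] span_zero)
    qed
    from span_scale[OF this, of "1 / t\<^sup>2"] show "w \<in> span (v ` J)" using assms(2) by simp
  next
    show "span (v ` J) \<subseteq> {w. (X *v w) v* X = t\<^sup>2 *\<^sub>R w}"
    proof (rule span_minimal)
      show "v ` J \<subseteq> {w. (X *v w) v* X = t\<^sup>2 *\<^sub>R w}"
      proof (rule image_subsetI)
        fix j assume "j \<in> J"
        then have j: "j < k" "xs ! j = t" by (auto simp: J_def)
        have "(\<Sum>i<k. ((xs ! i)\<^sup>2 * (v i \<bullet> v j)) *\<^sub>R v i) = (\<Sum>i<k. if i = j then t\<^sup>2 *\<^sub>R v j else 0)"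
          using j ov by (intro sum.cong) auto
        also have "\<dots> = t\<^sup>2 *\<^sub>R v j" using j by simp
        finally show "v j \<in> {w. (X *v w) v* X = t\<^sup>2 *\<^sub>R w}" by (simp add: gram)
      qed
      show "subspace {w. (X *v w) v* X = t\<^sup>2 *\<^sub>R w}"
        by (rule subspaceI; simp only: gram mem_Collect_eq)
          (simp_all add: inner_right_distrib scaleR_add_left scaleR_add_right sum.distrib algebra_simps
            flip: scaleR_sum_right scaleR_scaleR, simp add: scaleR_left_commute)
    qed
  qed
  then have "dim {w. (X *v w) v* X = t\<^sup>2 *\<^sub>R w} = card (v ` J)"
    using dim_span_eq_card_independent[OF orthonormal_family_complete(1)[OF ov Jk]] by simp
  also have "\<dots> = card J"
    using inj_on_subset[OF orthonormal_family_complete(2)[OF ov] Jk] by (rule card_image)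
  also have "\<dots> = count (mset xs) t"
    by (simp add: J_def k_def count_mset count_list_eq_length_filter length_filter_conv_card eq_commute)
  finally show ?thesis by simp
qed

lemma has_singular_values_unique:
  fixes X :: "real ^ 'n ^ 'm"
  assumes xs: "has_singular_values X xs" and ys: "has_singular_values X ys"
  shows "xs = ys"
proof -
  have pos: "count (mset xs) t = count (mset ys) t" if "t > 0" for t
    using assms[THEN has_singular_values_count[OF _ that]] by simp
  have neg: "count (mset zs) t = 0" if "has_singular_values X zs" "t < 0" for t zs
    using that unfolding has_singular_values_def by (auto simp: count_eq_zero_iff)
  have split: "mset zs = filter_mset (\<lambda>x. x \<noteq> 0) (mset zs) + replicate_mset (count (mset zs) 0) 0" for zs :: "real list"
    by (rule multiset_eqI) auto
  have nz: "filter_mset (\<lambda>x. x \<noteq> 0) (mset xs) = filter_mset (\<lambda>x. x \<noteq> 0) (mset ys)"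
  proof (rule multiset_eqI)
    fix t :: real
    show "count (filter_mset (\<lambda>x. x \<noteq> 0) (mset xs)) t = count (filter_mset (\<lambda>x. x \<noteq> 0) (mset ys)) t"
      using pos[of t] neg[OF xs, of t] neg[OF ys, of t]
      by (cases t "0 :: real" rule: linorder_cases) (simp_all del: count_mset_0_iff)
  qed
  have "size (mset xs) = size (mset ys)"
    using xs ys by (simp add: has_singular_values_def)
  then have "count (mset xs) 0 = count (mset ys) 0"
    using nz split[of xs] split[of ys] by (metis add_left_cancel size_replicate_mset size_union)
  with nz split[of xs] split[of ys] have "mset (rev xs) = mset (rev ys)" by simp
  moreover have "sorted (rev xs)" "sorted (rev ys)"
    using xs ys by (auto simp: has_singular_values_def sorted_wrt_rev)
  ultimately show ?thesis by (metis properties_for_sort rev_is_rev_conv)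
qed

lemma singular_values_eqI: "has_singular_values X xs \<Longrightarrow> singular_values X = xs"
  unfolding singular_values_def by (rule the_equality) (auto intro: has_singular_values_unique)

lemma has_singular_values_singular_values: "has_singular_values X (singular_values X)"
  using singular_values_exist singular_values_eqI by metis


section \<open>Matrix representations\<close>

text \<open>The entries of a matrix are indexed by pairs (column, row).\<close>

definition vectorize :: "real ^ 'n ^ 'm \<Rightarrow> real ^ ('n \<times> 'm)" where
  "vectorize X = (\<chi> ji. X $ snd ji $ fst ji)"

definition unvectorize :: "real ^ ('n \<times> 'm) \<Rightarrow> real ^ 'n ^ 'm" where
  "unvectorize x = (\<chi> i j. x $ (j, i))"

definition rep_matrix :: "(real ^ 'n ^ 'm \<Rightarrow> real ^ 'r) \<Rightarrow> real ^ ('n \<times> 'm) ^ 'r" where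
  "rep_matrix T = matrix (\<lambda>x. T (unvectorize x))"

lemma rep_matrix_mult_vectorize:
  fixes T :: "real ^ 'n ^ 'm \<Rightarrow> real ^ 'r"
  assumes "linear T"
  shows "rep_matrix T *v vectorize X = T X"
proof -
  have "linear (unvectorize :: real ^ ('n \<times> 'm) \<Rightarrow> real ^ 'n ^ 'm)"
    by (rule linearI) (auto simp: unvectorize_def vec_eq_iff)
  from linear_compose[OF this assms] have "linear (\<lambda>x. T (unvectorize x))" by (simp add: o_def)
  then have "rep_matrix T *v vectorize X = T (unvectorize (vectorize X))"
    unfolding rep_matrix_def by (metis matrix_vector_mul(2))
  also have "unvectorize (vectorize X) = X"
    by (simp add: unvectorize_def vectorize_def vec_eq_iff)
  finally show ?thesis .
qed

text \<open>The block matrix with rows \<open>(-I, 0, C)\<close> and \<open>(0, -I, A)\<close>.\<close>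

definition block_matrix ::
    "real ^ 'k ^ 'q \<Rightarrow> real ^ 'k ^ 'p \<Rightarrow> real ^ ('p + 'q + 'k) ^ ('p + 'q)" where
  "block_matrix A C = (\<chi> r c.
     case r of
       Inl i \<Rightarrow> (case c of Inl i' \<Rightarrow> (if i = i' then -1 else 0)
                        | Inr (Inl _) \<Rightarrow> 0
                        | Inr (Inr k) \<Rightarrow> C $ i $ k)
     | Inr j \<Rightarrow> (case c of Inl _ \<Rightarrow> 0
                        | Inr (Inl j') \<Rightarrow> (if j = j' then -1 else 0)
                        | Inr (Inr k) \<Rightarrow> A $ j $ k))"


section \<open>Algorithm APG\<close>

text \<open>The state after \<open>l\<close> iterations is \<open>(z\<^sub>1\<^sup>l, z\<^sub>2\<^sup>l\<^sup>+\<^sup>1, t\<^sup>l\<^sup>+\<^sup>1)\<close>.\<close>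

primrec apg_state ::
  "('z::real_inner \<Rightarrow> real) \<Rightarrow> ('z \<Rightarrow> real) \<Rightarrow> 'z set \<Rightarrow> real \<Rightarrow> 'z \<Rightarrow> nat \<Rightarrow> 'z \<times> 'z \<times> real" where
  "apg_state p f S L z0 0 = (z0, z0, 1)"
| "apg_state p f S L z0 (Suc l) =
     (let (z1, z2, t) = apg_state p f S L z0 l;
          z1' = arg_min_on (\<lambda>z. p z + gradient f z2 \<bullet> (z - z2) + L / 2 * (norm (z - z2))\<^sup>2) S;
          t' = (1 + sqrt (1 + 4 * t\<^sup>2)) / 2
      in (z1', z1' + ((t - 1) / t') *\<^sub>R (z1' - z1), t'))"

definition apg_iterate ::
  "('z::real_inner \<Rightarrow> real) \<Rightarrow> ('z \<Rightarrow> real) \<Rightarrow> 'z set \<Rightarrow> real \<Rightarrow> 'z \<Rightarrow> nat \<Rightarrow> 'z" where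
  "apg_iterate p f S L z0 l = fst (apg_state p f S L z0 l)"


section \<open>The composite norm problem\<close>

locale composite_norm_problem =
  fixes \<alpha> \<beta> :: ell
    and \<mu>1 \<mu>2 :: real
    and \<A> :: "real ^ 'n ^ 'm \<Rightarrow> real ^ 'q"
    and \<C> :: "real ^ 'n ^ 'm \<Rightarrow> real ^ 'p"
    and b :: "real ^ 'q"
    and d :: "real ^ 'p"
    and Q :: "(real ^ 'q) set"
begin

definition objective :: "real ^ 'n ^ 'm \<Rightarrow> real" where
  "objective X = \<mu>1 * sv_norm \<alpha> X + \<mu>2 * vec_norm \<beta> (\<C> X - d)"

definition opt_value :: real where
  "opt_value = (INF X\<in>{X. \<A> X - b \<in> Q}. objective X)"

definition eps_feasible :: "real \<Rightarrow> real ^ 'n ^ 'm \<Rightarrow> bool" where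
  "eps_feasible \<epsilon> X \<longleftrightarrow> (\<exists>y\<in>Q. norm (\<A> X - y - b) \<le> \<epsilon>)"

definition eps_optimal :: "real \<Rightarrow> real ^ 'n ^ 'm \<Rightarrow> bool" where
  "eps_optimal \<epsilon> X \<longleftrightarrow> \<bar>objective X - opt_value\<bar> \<le> \<epsilon>"

definition I_const :: real where
  "I_const = (if \<alpha> = Linf then sqrt (real (min CARD('m) CARD('n))) else 1)"

definition J_const :: real where
  "J_const = (if \<beta> = Linf then sqrt (real CARD('p)) else 1)"

definition L_const :: real where
  "L_const = (sigma_max (block_matrix (rep_matrix \<A>) (rep_matrix \<C>)))\<^sup>2"

end


section \<open>Algorithm FALC\<close>

text \<open>The parameter sequences are used at indices \<open>k \<ge> 1\<close> only.  Quantities of the \<open>k\<close>-th subproblem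
  take the current multipliers \<open>\<theta>1\<close>, \<open>\<theta>2\<close> as arguments.  The type of points \<open>(X, s, y)\<close> carries the
  inner product and norm of the product space.\<close>

type_synonym ('n, 'm, 'p, 'q) point = "(real ^ 'n ^ 'm) \<times> (real ^ 'p) \<times> (real ^ 'q)"

locale falc = composite_norm_problem \<alpha> \<beta> \<mu>1 \<mu>2 \<A> \<C> b d Q
  for \<alpha> \<beta> :: ell
    and \<mu>1 \<mu>2 :: real
    and \<A> :: "real ^ 'n ^ 'm \<Rightarrow> real ^ 'q"
    and \<C> :: "real ^ 'n ^ 'm \<Rightarrow> real ^ 'p"
    and b :: "real ^ 'q"
    and d :: "real ^ 'p"
    and Q :: "(real ^ 'q) set" +
  fixes X0 :: "real ^ 'n ^ 'm"
    and lam eps tau xi :: "nat \<Rightarrow> real"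
begin

definition eta :: real where
  "eta = \<mu>1 * sv_norm \<alpha> X0 + \<mu>2 * vec_norm \<beta> (\<C> X0 - d)"

definition p_part :: "nat \<Rightarrow> ('n, 'm, 'p, 'q) point \<Rightarrow> real" where
  "p_part k = (\<lambda>(X, s, y). lam k * (\<mu>1 * sv_norm \<alpha> X + \<mu>2 * vec_norm \<beta> s))"

definition f_part ::
    "nat \<Rightarrow> real ^ 'q \<Rightarrow> real ^ 'p \<Rightarrow> ('n, 'm, 'p, 'q) point \<Rightarrow> real" where
  "f_part k \<theta>1 \<theta>2 = (\<lambda>(X, s, y).
     1 / 2 * (norm (\<A> X - y - b - lam k *\<^sub>R \<theta>1))\<^sup>2 +
     1 / 2 * (norm (\<C> X - s - d - lam k *\<^sub>R \<theta>2))\<^sup>2)"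

definition eta1 :: "nat \<Rightarrow> real ^ 'q \<Rightarrow> real ^ 'p \<Rightarrow> real" where
  "eta1 k \<theta>1 \<theta>2 = eta + lam k / 2 * ((norm \<theta>1)\<^sup>2 + (norm \<theta>2)\<^sup>2)"

definition eta2 :: "nat \<Rightarrow> real ^ 'q \<Rightarrow> real ^ 'p \<Rightarrow> real" where
  "eta2 k \<theta>1 \<theta>2 = sigma_max (rep_matrix \<A>) * (I_const / \<mu>1) * eta1 k \<theta>1 \<theta>2 +
     norm (b + lam k *\<^sub>R \<theta>1) + 2 * norm (\<A> X0 - b)"

text \<open>The set over which the APG steps minimize, i.e. \<open>\<S>\<^sup>k\<close> together with the constraint \<open>y \<in> Q\<close>.\<close>

definition apg_domain ::
    "nat \<Rightarrow> real ^ 'q \<Rightarrow> real ^ 'p \<Rightarrow> ('n, 'm, 'p, 'q) point set" where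
  "apg_domain k \<theta>1 \<theta>2 = {(X, s, y).
     \<mu>1 * sv_norm \<alpha> X \<le> eta1 k \<theta>1 \<theta>2 \<and> \<mu>2 * vec_norm \<beta> s \<le> eta1 k \<theta>1 \<theta>2 \<and> y \<in> Q}"

definition l_max ::
    "nat \<Rightarrow> real ^ 'q \<Rightarrow> real ^ 'p \<Rightarrow> ('n, 'm, 'p, 'q) point \<Rightarrow> real" where
  "l_max k \<theta>1 \<theta>2 = (\<lambda>(X, s, y). sqrt (2 * L_const / eps k) *
     ((I_const / \<mu>1 + J_const / \<mu>2) * eta1 k \<theta>1 \<theta>2 + eta2 k \<theta>1 \<theta>2 + norm X + norm s + norm y))"

definition grad_stop ::
    "nat \<Rightarrow> real ^ 'q \<Rightarrow> real ^ 'p \<Rightarrow> ('n, 'm, 'p, 'q) point \<Rightarrow> bool" where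
  "grad_stop k \<theta>1 \<theta>2 = (\<lambda>(X, s, y).
     let (fX, fs, fy) = gradient (f_part k \<theta>1 \<theta>2) (X, s, y) in
       (\<exists>G \<in> {(lam k * \<mu>1) *\<^sub>R U + fX | U. U \<in> subdifferential (sv_norm \<alpha>) X}.
        \<exists>g \<in> {(lam k * \<mu>2) *\<^sub>R u + fs | u. u \<in> subdifferential (vec_norm \<beta>) s}.
          sqrt ((norm G)\<^sup>2 + (norm g)\<^sup>2) \<le> tau k) \<and>
       norm (y - closest_point Q (y - (1 / L_const) *\<^sub>R fy)) \<le> xi k)"

text \<open>One FALC iteration: the inner iterates started at \<open>z\<close>, the number of inner iterations performed,
  and the output of the inner routine.\<close>

definition inner_iterate ::
    "nat \<Rightarrow> real ^ 'q \<Rightarrow> real ^ 'p \<Rightarrow> ('n, 'm, 'p, 'q) point \<Rightarrow> nat \<Rightarrow>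
     ('n, 'm, 'p, 'q) point" where
  "inner_iterate k \<theta>1 \<theta>2 z =
     apg_iterate (p_part k) (f_part k \<theta>1 \<theta>2) (apg_domain k \<theta>1 \<theta>2) L_const z"

definition inner_count ::
    "nat \<Rightarrow> real ^ 'q \<Rightarrow> real ^ 'p \<Rightarrow> ('n, 'm, 'p, 'q) point \<Rightarrow> nat" where
  "inner_count k \<theta>1 \<theta>2 z = (LEAST l. real l \<ge> l_max k \<theta>1 \<theta>2 z \<or>
     grad_stop k \<theta>1 \<theta>2 (inner_iterate k \<theta>1 \<theta>2 z l))"

lemma inner_routine_terminates:
  "\<exists>l::nat. real l \<ge> l_max k \<theta>1 \<theta>2 z \<or> grad_stop k \<theta>1 \<theta>2 (inner_iterate k \<theta>1 \<theta>2 z l)"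
  using real_arch_simple by blast

definition inner_output ::
    "nat \<Rightarrow> real ^ 'q \<Rightarrow> real ^ 'p \<Rightarrow> ('n, 'm, 'p, 'q) point \<Rightarrow>
     ('n, 'm, 'p, 'q) point" where
  "inner_output k \<theta>1 \<theta>2 z = inner_iterate k \<theta>1 \<theta>2 z (inner_count k \<theta>1 \<theta>2 z)"

text \<open>The state after \<open>k\<close> iterations is \<open>((X\<^sup>k, s\<^sup>k, y\<^sup>k), \<theta>\<^sub>1\<^sup>k\<^sup>+\<^sup>1, \<theta>\<^sub>2\<^sup>k\<^sup>+\<^sup>1)\<close>.\<close>

primrec falc_state ::
    "nat \<Rightarrow> ('n, 'm, 'p, 'q) point \<times> (real ^ 'q) \<times> (real ^ 'p)" where
  "falc_state 0 = ((X0, \<C> X0 - d, \<A> X0 - b), 0, 0)"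
| "falc_state (Suc k) =
     (let (z, \<theta>1, \<theta>2) = falc_state k;
          (X, s, y) = inner_output (Suc k) \<theta>1 \<theta>2 z
      in ((X, s, y),
          \<theta>1 - (1 / lam (Suc k)) *\<^sub>R (\<A> X - y - b),
          \<theta>2 - (1 / lam (Suc k)) *\<^sub>R (\<C> X - s - d)))"

definition X_iter :: "nat \<Rightarrow> real ^ 'n ^ 'm" where
  "X_iter k = fst (fst (falc_state k))"

text \<open>The number of APG iterations performed in FALC iteration \<open>k \<ge> 1\<close>.\<close>

definition N_APG :: "nat \<Rightarrow> nat" where
  "N_APG k = (let (z, \<theta>1, \<theta>2) = falc_state (k - 1) in inner_count k \<theta>1 \<theta>2 z)"

definition N_FALC :: "real \<Rightarrow> nat" where
  "N_FALC \<epsilon> = (LEAST k. k \<ge> 1 \<and> eps_feasible \<epsilon> (X_iter k) \<and> eps_optimal \<epsilon> (X_iter k))"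

definition N_inner :: "real \<Rightarrow> nat" where
  "N_inner \<epsilon> = (\<Sum>k=1..N_FALC \<epsilon>. N_APG k)"

end

end

theory Submission
  imports Defs
begin

text \<open>
  The accelerated method reduces the objective gap like \<open>2 L |z\<^sub>0 - z\<^sup>*|\<^sup>2 / l\<^sup>2\<close>, so reaching \<open>l_max\<close>
  iterations gives an \<open>eps k\<close>-minimizer of the subproblem.  Whether the inner routine stops for this
  reason or by the gradient test, the gradient of the smooth part in \<open>X\<close> and \<open>s\<close> is \<open>O(lam k)\<close> at its
  output, because \<open>eps k\<close> is proportional to \<open>(lam k)\<^sup>2\<close>.  Divided by \<open>lam k\<close> this gradient is a linear
  expression in the new multipliers, and surjectivity of \<open>\<A>\<close> turns this into a uniform bound on them.
  Hence the iterates are bounded and all residuals are \<open>O(lam k)\<close>; so is the error in the objective: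
  from above by comparison with feasible points, from below because a right inverse of \<open>\<A>\<close> moves the
  iterate to a feasible point at distance \<open>O(lam k)\<close>.  Finally, \<open>l_max\<close> is \<open>O(1 / lam k)\<close>, and the
  geometric sum of these counts is dominated by its last term, which is \<open>O(1 / \<epsilon>)\<close>.
\<close>

section \<open>The vector and singular value norms\<close>

text \<open>The multipliers must be bounded before the iterates, because \<open>apg_domain\<close>
  is sized by \<open>eta1\<close>, which contains them. The gradient estimate is therefore built
  from Lipschitz constants of the two norms and the length of a test step, never from the size of
  the iterate. The two exits of the inner routine say different things, one about values and one
  about subgradients. Each is turned into the same pair of facts: a gradient bound of order
  \<open>lam k\<close> and a value gap of order \<open>(lam k)\<^sup>2\<close>. The square is the
  right order because the objective enters the subproblem with the factor \<open>lam k\<close>, so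
  one power is lost on division. The inner routine may also stop after zero steps. Its output is
  then the previous iterate, which need not lie in the current \<open>apg_domain\<close>, so
  statements about the domain carry this alternative. All that is asked of the norms is collected in
  \<open>sublinear_norm\<close>: sublinearity and equivalence with the Euclidean norm.\<close>

locale sublinear_norm =
  fixes N :: "'a::euclidean_space \<Rightarrow> real" and K c :: real
  assumes add: "N (x + y) \<le> N x + N y"
    and scale: "0 \<le> r \<Longrightarrow> N (r *\<^sub>R x) = r * N x"
    and upper: "N x \<le> K * norm x"
    and lower: "norm x \<le> c * N x"
    and c_pos: "0 < c"
begin

lemma nonneg: "0 \<le> N x"
  using order.trans[OF norm_ge_zero lower[of x]] c_pos by (simp add: zero_le_mult_iff)

lemma K_nonneg: "0 \<le> K"
proof -
  obtain i :: 'a where "i \<in> Basis" using nonempty_Basis by blast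
  then show ?thesis using upper[of i] nonneg[of i] by simp
qed

lemma perturb: "N y \<le> N x + K * norm (y - x)"
  using add[of x "y - x"] upper[of "y - x"] by simp

lemma convex: "convex_on UNIV N"
proof (rule convex_onI)
  fix t x y assume "0 < (t::real)" "t < 1"
  then show "N ((1 - t) *\<^sub>R x + t *\<^sub>R y) \<le> (1 - t) * N x + t * N y"
    using add[of "(1 - t) *\<^sub>R x" "t *\<^sub>R y"] scale[of "1 - t" x] scale[of t y] by simp
qed simp

lemma continuous: "continuous_on UNIV N"
proof -
  have "\<bar>N x - N y\<bar> \<le> K * norm (x - y)" for x y
    using perturb[of x y] perturb[of y x] by (simp add: norm_minus_commute)
  then have "K-lipschitz_on UNIV N"
    by (intro lipschitz_onI) (auto simp: dist_real_def dist_norm K_nonneg)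
  then show ?thesis by (rule lipschitz_on_continuous_on)
qed

text \<open>Testing the subgradient inequality at \<open>x + u\<close> gives |u|^2 \<le> N (x + u) -
  N x \<le> K |u|.\<close>

lemma subgradient_bound:
  assumes "u \<in> subdifferential N x"
  shows "norm u \<le> K"
proof -
  have "N x + u \<bullet> (x + u - x) \<le> N (x + u)"
    using assms unfolding subdifferential_def by blast
  then have "norm u * norm u \<le> K * norm u"
    using perturb[of "x + u" x] by (simp add: dot_square_norm power2_eq_square)
  then show ?thesis using K_nonneg by (cases "norm u = 0") (auto simp: mult_le_cancel_right)
qed

end

section \<open>The three vector norms on a finite index set\<close>

lemma ell_norm_nonneg:
  assumes "finite I" "I \<noteq> {}"
  shows "0 \<le> ell_norm \<alpha> I x"
proof (cases \<alpha>)
  case Linf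
  obtain i where "i \<in> I" using assms by blast
  then have "\<bar>x i\<bar> \<le> Max ((\<lambda>i. \<bar>x i\<bar>) ` I)" using assms by (intro Max_ge) auto
  then show ?thesis using Linf by (simp add: order.trans[OF abs_ge_zero])
qed (auto intro: sum_nonneg)

lemma ell_norm_scale:
  assumes "finite I" "I \<noteq> {}" "0 \<le> r"
  shows "ell_norm \<alpha> I (\<lambda>i. r * x i) = r * ell_norm \<alpha> I x"
proof (cases \<alpha>)
  case L1 then show ?thesis using assms by (simp add: abs_mult sum_distrib_left)
next
  case L2 then show ?thesis using assms
    by (simp add: power_mult_distrib real_sqrt_mult flip: sum_distrib_left)
next
  case Linf
  have "Max ((\<lambda>i. \<bar>r * x i\<bar>) ` I) = Max ((*) r ` (\<lambda>i. \<bar>x i\<bar>) ` I)"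
    using assms by (simp add: image_image abs_mult)
  also have "\<dots> = r * Max ((\<lambda>i. \<bar>x i\<bar>) ` I)"
    using assms by (intro mono_Max_commute[symmetric]) (auto simp: mono_def mult_left_mono)
  finally show ?thesis using Linf by simp
qed

lemma component_le_ell2: "finite I \<Longrightarrow> i \<in> I \<Longrightarrow> \<bar>x i\<bar> \<le> ell_norm L2 I x"
  using member_le_L2_set[of I i "\<lambda>i. \<bar>x i\<bar>"] by (simp add: L2_set_def)

lemma ell_norm_le_ell2:
  assumes "finite I" "I \<noteq> {}"
  shows "ell_norm \<alpha> I x \<le> card I * ell_norm L2 I x"
proof -
  have "card I \<ge> 1" using assms by (simp add: Suc_leI card_gt_0_iff)
  then have *: "ell_norm L2 I x \<le> card I * ell_norm L2 I x"
    using mult_right_mono[of 1 "real (card I)" "ell_norm L2 I x"] ell_norm_nonneg[OF assms, of L2 x]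
    by simp
  show ?thesis
  proof (cases \<alpha>)
    case L1
    then show ?thesis using sum_bounded_above[of I "\<lambda>i. \<bar>x i\<bar>" "ell_norm L2 I x"]
        component_le_ell2[OF assms(1)] by simp
  next
    case Linf
    have "Max ((\<lambda>i. \<bar>x i\<bar>) ` I) \<le> ell_norm L2 I x"
      using assms component_le_ell2[OF assms(1)] by (intro Max.boundedI) auto
    then show ?thesis using Linf * by simp
  qed (use * in simp)
qed

text \<open>The factor is exactly the one in \<open>I_const\<close> and \<open>J_const\<close>:
  \<open>l_max\<close> is built from these and has to dominate true distances. The reverse
  comparison enters hidden constants only, so there the crude factor \<open>card I\<close> serves
  all three norms.\<close>

lemma ell2_le_ell_norm:
  assumes "finite I" "I \<noteq> {}"
  shows "ell_norm L2 I x \<le> (if \<alpha> = Linf then sqrt (card I) else 1) * ell_norm \<alpha> I x"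
proof (cases \<alpha>)
  case L1
  then show ?thesis using L2_set_le_sum_abs[of x I] by (simp add: L2_set_def)
next
  case Linf
  let ?M = "Max ((\<lambda>i. \<bar>x i\<bar>) ` I)"
  have M: "\<bar>x i\<bar> \<le> ?M" if "i \<in> I" for i using assms that by (intro Max_ge) auto
  have "0 \<le> ?M" using ell_norm_nonneg[OF assms, of Linf x] by simp
  have "(\<Sum>i\<in>I. (x i)\<^sup>2) \<le> card I * ?M\<^sup>2"
    using M power_mono[OF M, of _ 2] by (intro sum_bounded_above) simp
  then have "sqrt (\<Sum>i\<in>I. (x i)\<^sup>2) \<le> sqrt (card I * ?M\<^sup>2)" by (rule real_sqrt_le_mono)
  then show ?thesis using Linf \<open>0 \<le> ?M\<close> by (simp add: real_sqrt_mult)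
qed simp

lemma vec_norm_L2: "vec_norm L2 x = norm x"
  by (simp add: vec_norm_def norm_vec_def L2_set_def)

lemma vec_norm_add: "vec_norm \<beta> (x + y) \<le> vec_norm \<beta> x + vec_norm \<beta> y"
proof (cases \<beta>)
  case L1
  then show ?thesis by (simp add: vec_norm_def flip: sum.distrib) (intro sum_mono abs_triangle_ineq)
next
  case L2
  then show ?thesis by (simp add: vec_norm_L2 norm_triangle_ineq)
next
  case Linf
  have "\<bar>z $ i\<bar> \<le> Max (range (\<lambda>i. \<bar>z $ i\<bar>))" for z :: "real ^ 'a" and i by (intro Max_ge) auto
  then have "\<bar>(x + y) $ i\<bar> \<le> Max (range (\<lambda>i. \<bar>x $ i\<bar>)) + Max (range (\<lambda>i. \<bar>y $ i\<bar>))" for i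
    using abs_triangle_ineq[of "x $ i" "y $ i"] by (simp only: vector_add_component) (meson add_mono order.trans)
  then have "Max (range (\<lambda>i. \<bar>(x + y) $ i\<bar>)) \<le> Max (range (\<lambda>i. \<bar>x $ i\<bar>)) + Max (range (\<lambda>i. \<bar>y $ i\<bar>))"
    by (intro Max.boundedI) auto
  then show ?thesis by (simp only: Linf vec_norm_def ell_norm.simps)
qed

lemma sublinear_norm_vec_norm:
  "sublinear_norm (vec_norm \<beta> :: real ^ 'p \<Rightarrow> real) CARD('p) (if \<beta> = Linf then sqrt CARD('p) else 1)"
proof
  fix x :: "real ^ 'p" and r :: real
  show "vec_norm \<beta> x \<le> CARD('p) * norm x"
    using ell_norm_le_ell2[of "UNIV :: 'p set" \<beta> "($) x"]
    by (simp add: vec_norm_def norm_vec_def L2_set_def del: ell_norm.simps(1,3))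
  show "norm x \<le> (if \<beta> = Linf then sqrt CARD('p) else 1) * vec_norm \<beta> x"
    using ell2_le_ell_norm[of "UNIV :: 'p set" "($) x" \<beta>]
    by (simp only: vec_norm_L2[symmetric] vec_norm_def) simp
  show "0 \<le> r \<Longrightarrow> vec_norm \<beta> (r *\<^sub>R x) = r * vec_norm \<beta> x"
    using ell_norm_scale[of "UNIV :: 'p set" r \<beta> "($) x"] by (simp add: vec_norm_def)
qed (auto intro: vec_norm_add)

section \<open>Singular value norms through decompositions and duality\<close>

definition orthonormal :: "nat \<Rightarrow> (nat \<Rightarrow> 'a::real_inner) \<Rightarrow> bool" where
  "orthonormal k u \<longleftrightarrow> (\<forall>i<k. \<forall>j<k. u i \<bullet> u j = (if i = j then 1 else 0))"

lemma orthonormal_norm_sum: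
  assumes "orthonormal k u"
  shows "(norm (\<Sum>i<k. c i *\<^sub>R u i))\<^sup>2 = (\<Sum>i<k. (c i)\<^sup>2)"
proof -
  have "(norm (\<Sum>i<k. c i *\<^sub>R u i))\<^sup>2 = (\<Sum>i<k. \<Sum>j<k. c i * (c j * (u i \<bullet> u j)))"
    unfolding power2_norm_eq_inner inner_sum_left inner_sum_right by (simp add: mult_ac inner_commute)
  also have "\<dots> = (\<Sum>i<k. \<Sum>j<k. if i = j then c i * c j else 0)"
    using assms by (intro sum.cong) (auto simp: orthonormal_def)
  also have "\<dots> = (\<Sum>i<k. (c i)\<^sup>2)"
    by (simp add: sum.delta' power2_eq_square)
  finally show ?thesis .
qed

lemma orthonormal_bessel:
  assumes "orthonormal k v"
  shows "(\<Sum>i<k. (v i \<bullet> w)\<^sup>2) \<le> (norm w)\<^sup>2"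
proof -
  let ?s = "\<Sum>i<k. (v i \<bullet> w) *\<^sub>R v i"
  have "w \<bullet> ?s = (\<Sum>i<k. (v i \<bullet> w)\<^sup>2)"
    by (simp add: inner_sum_right power2_eq_square inner_commute)
  then have "(norm (w - ?s))\<^sup>2 = (norm w)\<^sup>2 - (\<Sum>i<k. (v i \<bullet> w)\<^sup>2)"
    using orthonormal_norm_sum[OF assms, of "\<lambda>i. v i \<bullet> w"]
    by (simp add: power2_norm_eq_inner inner_diff_left inner_diff_right inner_commute)
  then show ?thesis using zero_le_power2[of "norm (w - ?s)"] by linarith
qed

definition outer_sum :: "real list \<Rightarrow> (nat \<Rightarrow> real ^ 'm) \<Rightarrow> (nat \<Rightarrow> real ^ 'n) \<Rightarrow> real ^ 'n ^ 'm" where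
  "outer_sum xs u v = (\<chi> a c. \<Sum>i<length xs. xs ! i * u i $ a * v i $ c)"

lemma singular_value_decomposition:
  fixes X :: "real ^ 'n ^ 'm"
  obtains u v where "orthonormal (length (singular_values X)) u"
    "orthonormal (length (singular_values X)) v" "outer_sum (singular_values X) u v = X"
proof -
  have "\<exists>u v. orthonormal (length (singular_values X)) u \<and> orthonormal (length (singular_values X)) v \<and>
      X = outer_sum (singular_values X) u v"
    using has_singular_values_singular_values[of X]
    unfolding has_singular_values_def orthonormal_def outer_sum_def by blast
  then obtain u v where "orthonormal (length (singular_values X)) u"
    "orthonormal (length (singular_values X)) v" "X = outer_sum (singular_values X) u v" by blast
  then show thesis by (intro that[of u v] sym[of X])
qed

lemma length_singular_values:
  "length (singular_values (X :: real ^ 'n ^ 'm)) = min CARD('m) CARD('n)"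
  using has_singular_values_singular_values[of X] by (simp add: has_singular_values_def)

lemma singular_values_nonempty: "{..<length (singular_values X)} \<noteq> {}"
  by (simp add: length_singular_values lessThan_empty_iff)

lemma singular_values_nonneg:
  "i < length (singular_values X) \<Longrightarrow> 0 \<le> singular_values X ! i"
  using has_singular_values_singular_values[of X] by (simp add: has_singular_values_def)

text \<open>The trace pairing with a decomposed matrix sees \<open>Y\<close> only through its
  entries on the singular pairs.\<close>

lemma outer_sum_inner: "outer_sum xs u v \<bullet> Y = (\<Sum>i<length xs. xs ! i * (u i \<bullet> (Y *v v i)))"
proof -
  have "outer_sum xs u v \<bullet> Y = (\<Sum>a\<in>UNIV. \<Sum>c\<in>UNIV. \<Sum>i<length xs. xs ! i * (u i $ a * (Y $ a $ c * v i $ c)))"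
    unfolding outer_sum_def inner_vec_def by (simp add: sum_distrib_left sum_distrib_right mult_ac)
  also have "\<dots> = (\<Sum>a\<in>UNIV. \<Sum>i<length xs. \<Sum>c\<in>UNIV. xs ! i * (u i $ a * (Y $ a $ c * v i $ c)))"
    by (intro sum.cong refl sum.swap)
  also have "\<dots> = (\<Sum>i<length xs. \<Sum>a\<in>UNIV. \<Sum>c\<in>UNIV. xs ! i * (u i $ a * (Y $ a $ c * v i $ c)))"
    by (rule sum.swap)
  also have "\<dots> = (\<Sum>i<length xs. xs ! i * (u i \<bullet> (Y *v v i)))"
    unfolding inner_vec_def matrix_vector_mult_def by (simp add: sum_distrib_left)
  finally show ?thesis .
qed

lemma outer_sum_mult_vec: "outer_sum xs u v *v w = (\<Sum>i<length xs. (xs ! i * (v i \<bullet> w)) *\<^sub>R u i)"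
  unfolding outer_sum_def by (rule outer_sum_mult(1))

text \<open>Half of the duality between nuclear and spectral norm: for a contraction
  \<open>Y\<close>, Cauchy-Schwarz bounds every entry on a singular pair by 1.\<close>

lemma nuclear_norm_dual:
  fixes X Y :: "real ^ 'n ^ 'm"
  assumes "\<And>w. norm (Y *v w) \<le> norm w"
  shows "X \<bullet> Y \<le> sv_norm L1 X"
proof -
  let ?xs = "singular_values X"
  obtain u v where ou: "orthonormal (length ?xs) u" and ov: "orthonormal (length ?xs) v"
    and X: "outer_sum ?xs u v = X" by (rule singular_value_decomposition)
  have "?xs ! i * (u i \<bullet> (Y *v v i)) \<le> \<bar>?xs ! i\<bar>" if "i < length ?xs" for i
  proof -
    have "norm (u i) = 1" "norm (v i) = 1"
      using ou ov that by (auto simp: orthonormal_def norm_eq_1)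
    then have "u i \<bullet> (Y *v v i) \<le> 1"
      using norm_cauchy_schwarz[of "u i" "Y *v v i"] assms[of "v i"] by simp
    then show ?thesis using mult_left_mono[of _ 1, OF _ singular_values_nonneg[OF that]] by fastforce
  qed
  then have "outer_sum ?xs u v \<bullet> Y \<le> sv_norm L1 X"
    unfolding outer_sum_inner sv_norm_def by (auto intro: sum_mono)
  then show ?thesis using X by simp
qed

text \<open>The other half of the duality. The maximizer is the sum of all u_i v_i^T, whose entries
  on the singular pairs are 1 and which is a contraction by Bessel's inequality.\<close>

lemma nuclear_norm_attained:
  fixes X :: "real ^ 'n ^ 'm"
  obtains Y where "\<And>w. norm (Y *v w) \<le> norm w" "X \<bullet> Y = sv_norm L1 X"
proof -
  let ?xs = "singular_values X"
  let ?k = "length ?xs"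
  obtain u v where ou: "orthonormal ?k u" and ov: "orthonormal ?k v"
    and X: "outer_sum ?xs u v = X" by (rule singular_value_decomposition)
  define Y where "Y = outer_sum (replicate ?k 1) u v"
  have Yw: "Y *v w = (\<Sum>i<?k. (v i \<bullet> w) *\<^sub>R u i)" for w
    unfolding Y_def outer_sum_mult_vec by (intro sum.cong) simp_all
  have "(norm (Y *v w))\<^sup>2 \<le> (norm w)\<^sup>2" for w
    unfolding Yw orthonormal_norm_sum[OF ou] by (rule orthonormal_bessel[OF ov])
  then have "norm (Y *v w) \<le> norm w" for w by (rule power2_le_imp_le) simp
  moreover have "u i \<bullet> (Y *v v i) = 1" if "i < ?k" for i
  proof -
    have "Y *v v i = (\<Sum>j<?k. if i = j then u j else 0)"
      unfolding Yw using ov that by (intro sum.cong) (auto simp: orthonormal_def)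
    also have "\<dots> = u i" using that by simp
    finally show ?thesis using ou that by (simp add: orthonormal_def)
  qed
  then have "outer_sum ?xs u v \<bullet> Y = sv_norm L1 X"
    unfolding outer_sum_inner sv_norm_def using singular_values_nonneg[of _ X] by simp
  ultimately show ?thesis by (intro that[of Y]) (simp_all add: X)
qed

text \<open>Pythagoras for the left singular vectors and Bessel for the right ones. With
  \<open>spectral_norm_attained\<close> this identifies the largest singular value as the operator
  norm.\<close>

lemma spectral_norm_mult_le: "norm (X *v w) \<le> sv_norm Linf X * norm w"
proof -
  let ?xs = "singular_values X"
  let ?k = "length ?xs"
  obtain u v where ou: "orthonormal ?k u" and ov: "orthonormal ?k v"
    and X: "outer_sum ?xs u v = X" by (rule singular_value_decomposition)
  have nonneg: "0 \<le> sv_norm Linf X"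
    unfolding sv_norm_def using singular_values_nonempty by (intro ell_norm_nonneg) auto
  have le: "\<bar>?xs ! i\<bar> \<le> sv_norm Linf X" if "i < ?k" for i
    unfolding sv_norm_def using that by simp
  have "(norm (X *v w))\<^sup>2 = (norm (outer_sum ?xs u v *v w))\<^sup>2" by (simp only: X)
  also have "\<dots> = (\<Sum>i<?k. (?xs ! i)\<^sup>2 * (v i \<bullet> w)\<^sup>2)"
    unfolding outer_sum_mult_vec orthonormal_norm_sum[OF ou] by (simp add: power_mult_distrib)
  also have "\<dots> \<le> (\<Sum>i<?k. (sv_norm Linf X)\<^sup>2 * (v i \<bullet> w)\<^sup>2)"
    using le power_mono[OF le, of _ 2] by (intro sum_mono mult_right_mono) auto
  also have "\<dots> \<le> (sv_norm Linf X)\<^sup>2 * (norm w)\<^sup>2"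
    unfolding sum_distrib_left[symmetric] by (intro mult_left_mono orthonormal_bessel ov) simp
  finally have "(norm (X *v w))\<^sup>2 \<le> (sv_norm Linf X * norm w)\<^sup>2"
    by (simp add: power_mult_distrib)
  then show ?thesis by (rule power2_le_imp_le) (simp add: nonneg)
qed

lemma spectral_norm_attained:
  fixes X :: "real ^ 'n ^ 'm"
  obtains w where "norm w = 1" "norm (X *v w) = sv_norm Linf X"
proof -
  let ?xs = "singular_values X"
  let ?k = "length ?xs"
  obtain u v where ou: "orthonormal ?k u" and ov: "orthonormal ?k v"
    and X: "outer_sum ?xs u v = X" by (rule singular_value_decomposition)
  have "sv_norm Linf X \<in> (\<lambda>i. \<bar>?xs ! i\<bar>) ` {..<?k}"
    unfolding sv_norm_def ell_norm.simps using singular_values_nonempty[of X] by (intro Max_in) auto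
  then obtain i where i: "i < ?k" "sv_norm Linf X = \<bar>?xs ! i\<bar>" by auto
  have "outer_sum ?xs u v *v v i = (\<Sum>j<?k. if i = j then ?xs ! j *\<^sub>R u j else 0)"
    unfolding outer_sum_mult_vec using ov i by (intro sum.cong) (auto simp: orthonormal_def)
  also have "\<dots> = ?xs ! i *\<^sub>R u i" using i by simp
  finally have "X *v v i = ?xs ! i *\<^sub>R u i" using X by simp
  moreover have "norm (u i) = 1" "norm (v i) = 1"
    using ou ov i by (auto simp: orthonormal_def norm_eq_1)
  ultimately show ?thesis using i by (intro that[of "v i"]) simp_all
qed

lemma sigma_max_eq: "sigma_max X = sv_norm Linf X"
proof -
  have "set (singular_values X) = (\<lambda>i. \<bar>singular_values X ! i\<bar>) ` {..<length (singular_values X)}"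
    using singular_values_nonneg[of _ X] by (force simp: set_conv_nth)
  then show ?thesis by (simp add: sigma_max_def sv_norm_def)
qed

lemma norm_mult_le_sigma_max: "norm (X *v w) \<le> sigma_max X * norm w"
  unfolding sigma_max_eq by (rule spectral_norm_mult_le)

text \<open>The trace pairing of \<open>X\<close> with itself leaves the squared singular values, so
  this is the Frobenius norm.\<close>

lemma sv_norm_L2:
  fixes X :: "real ^ 'n ^ 'm"
  shows "sv_norm L2 X = norm X"
proof -
  let ?xs = "singular_values X"
  let ?k = "length ?xs"
  obtain u v where ou: "orthonormal ?k u" and ov: "orthonormal ?k v"
    and X: "outer_sum ?xs u v = X" by (rule singular_value_decomposition)
  have "u i \<bullet> (outer_sum ?xs u v *v v i) = ?xs ! i" if "i < ?k" for i
  proof -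
    have "outer_sum ?xs u v *v v i = (\<Sum>j<?k. if i = j then ?xs ! j *\<^sub>R u j else 0)"
      unfolding outer_sum_mult_vec using ov that by (intro sum.cong) (auto simp: orthonormal_def)
    also have "\<dots> = ?xs ! i *\<^sub>R u i" using that by simp
    finally show ?thesis using ou that by (simp add: orthonormal_def)
  qed
  then have "outer_sum ?xs u v \<bullet> outer_sum ?xs u v = (\<Sum>i<?k. (?xs ! i)\<^sup>2)"
    by (subst outer_sum_inner) (simp add: power2_eq_square)
  then have "X \<bullet> X = (\<Sum>i<?k. (?xs ! i)\<^sup>2)" using X by simp
  then show ?thesis by (simp add: sv_norm_def norm_eq_sqrt_inner)
qed

text \<open>Singular values of a sum are not bounded index by index by sums of singular values, so
  each case uses a description without them: a maximum of linear functionals, the Frobenius norm,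
  the operator norm.\<close>

lemma sv_norm_add: "sv_norm \<alpha> (X + Y) \<le> sv_norm \<alpha> X + sv_norm \<alpha> Y"
proof (cases \<alpha>)
  case L1
  obtain Z where "\<And>w. norm (Z *v w) \<le> norm w" "(X + Y) \<bullet> Z = sv_norm L1 (X + Y)"
    by (rule nuclear_norm_attained[of "X + Y"]) blast
  then show ?thesis
    using nuclear_norm_dual[of Z X] nuclear_norm_dual[of Z Y] L1 by (simp add: inner_add_left)
next
  case L2
  then show ?thesis by (simp add: sv_norm_L2 norm_triangle_ineq)
next
  case Linf
  obtain w where "norm w = 1" "norm ((X + Y) *v w) = sv_norm Linf (X + Y)"
    by (rule spectral_norm_attained)
  then show ?thesis
    using norm_triangle_ineq[of "X *v w" "Y *v w"] spectral_norm_mult_le[of X w]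
      spectral_norm_mult_le[of Y w] Linf by (simp add: matrix_vector_mult_add_rdistrib)
qed

text \<open>The same singular vectors decompose the scaled matrix, the order survives a nonnegative
  factor, and uniqueness of the list does the rest.\<close>

lemma singular_values_scale:
  assumes "0 \<le> r"
  shows "singular_values (r *\<^sub>R X) = map ((*) r) (singular_values X)"
proof (rule singular_values_eqI)
  let ?xs = "singular_values X"
  have xs: "has_singular_values X ?xs" by (rule has_singular_values_singular_values)
  obtain u v where ou: "orthonormal (length ?xs) u" and ov: "orthonormal (length ?xs) v"
    and X: "outer_sum ?xs u v = X" by (rule singular_value_decomposition)
  have "r *\<^sub>R outer_sum ?xs u v = (\<chi> a c. \<Sum>i<length (map ((*) r) ?xs). map ((*) r) ?xs ! i * u i $ a * v i $ c)"
    by (simp add: outer_sum_def vec_eq_iff sum_distrib_left mult_ac)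
  note this[unfolded X]
  moreover have "sorted_wrt (\<ge>) (map ((*) r) ?xs)"
    using xs assms unfolding has_singular_values_def sorted_wrt_map
    by (auto intro: sorted_wrt_mono_rel[of _ "(\<ge>)"] mult_left_mono)
  ultimately show "has_singular_values (r *\<^sub>R X) (map ((*) r) ?xs)"
    using xs ou ov assms unfolding has_singular_values_def orthonormal_def
    by (intro conjI exI[of _ u] exI[of _ v]) auto
qed

lemma sublinear_norm_sv_norm:
  "sublinear_norm (sv_norm \<alpha> :: real ^ 'n ^ 'm \<Rightarrow> real) (min CARD('m) CARD('n))
     (if \<alpha> = Linf then sqrt (min CARD('m) CARD('n)) else 1)"
proof
  fix X :: "real ^ 'n ^ 'm" and r :: real
  note I = finite_lessThan singular_values_nonempty[of X]
  show "sv_norm \<alpha> X \<le> (min CARD('m) CARD('n)) * norm X"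
    using ell_norm_le_ell2[OF I, of \<alpha> "(!) (singular_values X)"]
    unfolding sv_norm_L2[symmetric] sv_norm_def by (simp only: card_lessThan length_singular_values)
  show "norm X \<le> (if \<alpha> = Linf then sqrt (min CARD('m) CARD('n)) else 1) * sv_norm \<alpha> X"
    using ell2_le_ell_norm[OF I, of "(!) (singular_values X)" \<alpha>]
    unfolding sv_norm_L2[symmetric] sv_norm_def by (simp only: card_lessThan length_singular_values)
  assume r: "0 \<le> r"
  have "ell_norm \<alpha> {..<length (singular_values X)} (\<lambda>i. map ((*) r) (singular_values X) ! i)
      = ell_norm \<alpha> {..<length (singular_values X)} (\<lambda>i. r * singular_values X ! i)"
    by (cases \<alpha>) auto
  then show "sv_norm \<alpha> (r *\<^sub>R X) = r * sv_norm \<alpha> X"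
    using ell_norm_scale[OF I r] by (simp add: sv_norm_def singular_values_scale[OF r])
qed (auto intro: sv_norm_add)

section \<open>Convergence of Algorithm APG\<close>

text \<open>Lets the description operator \<open>gradient\<close> be evaluated from the convexity
  and smoothness inequalities alone.\<close>

lemma gderiv_quadratic_remainder:
  fixes f :: "'a::real_inner \<Rightarrow> real"
  assumes "\<And>z. \<bar>f z - f w - g \<bullet> (z - w)\<bar> \<le> K * (norm (z - w))\<^sup>2"
  shows "GDERIV f w :> g"
  unfolding gderiv_def has_derivative_at_within
proof (intro conjI)
  show "bounded_linear (\<lambda>h. h \<bullet> g)" by (rule bounded_linear_inner_left)
  have le: "norm ((f z - f w - (z - w) \<bullet> g) /\<^sub>R norm (z - w)) \<le> K * norm (z - w)" for z
  proof (cases "z = w")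
    case False
    have "\<bar>f z - f w - (z - w) \<bullet> g\<bar> \<le> K * norm (z - w) * norm (z - w)"
      using assms[of z] by (simp add: inner_commute power2_eq_square mult.assoc)
    then have "\<bar>f z - f w - (z - w) \<bullet> g\<bar> / norm (z - w) \<le> K * norm (z - w)"
      using False by (simp add: pos_divide_le_eq)
    then show ?thesis by (simp add: divide_inverse_commute abs_mult)
  qed simp
  have "((\<lambda>z. K * norm (z - w)) \<longlongrightarrow> 0) (at w)"
    by (auto intro!: tendsto_eq_intros)
  with le show "((\<lambda>z. (f z - f w - (z - w) \<bullet> g) /\<^sub>R norm (z - w)) \<longlongrightarrow> 0) (at w)"
    by (rule Lim_null_comparison[OF always_eventually[OF allI]])
qed

text \<open>The map \<open>g\<close> is a candidate for the gradient; the two inequalities on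
  \<open>f\<close> pin it down as the true one, see \<open>gradient_f\<close>.\<close>

locale composite_minimization =
  fixes p f :: "'z::euclidean_space \<Rightarrow> real" and g :: "'z \<Rightarrow> 'z" and S :: "'z set" and L :: real
  assumes convex_p: "convex_on UNIV p"
    and continuous_p: "continuous_on UNIV p"
    and nonneg_p: "0 \<le> p z"
    and convex_f: "f w + g w \<bullet> (z - w) \<le> f z"
    and smooth_f: "f z \<le> f w + g w \<bullet> (z - w) + L / 2 * (norm (z - w))\<^sup>2"
    and L_pos: "0 < L"
    and closed_S: "closed S"
    and convex_S: "convex S"
    and S_nonempty: "S \<noteq> {}"
begin

lemma gradient_f: "gradient f w = g w"
proof (intro gradient_eqI gderiv_quadratic_remainder)
  show "\<bar>f z - f w - g w \<bullet> (z - w)\<bar> \<le> L / 2 * (norm (z - w))\<^sup>2" for z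
    using convex_f[of w z] smooth_f[of z w] by simp
qed

section \<open>The proximal step\<close>

definition model :: "'z \<Rightarrow> 'z \<Rightarrow> real" where
  "model w z = p z + g w \<bullet> (z - w) + L / 2 * (norm (z - w))\<^sup>2"

definition prox_step :: "'z \<Rightarrow> 'z" where
  "prox_step w = arg_min_on (model w) S"

text \<open>\<open>arg_min_on\<close> denotes a minimizer only if one exists. Outside a large ball
  the quadratic term beats the linear one and \<open>p\<close> is nonnegative, so a minimum over a
  compact part of \<open>S\<close> is global.\<close>

lemma model_attains_minimum: "\<exists>z\<in>S. \<forall>x\<in>S. model w z \<le> model w x"
proof -
  obtain a where a: "a \<in> S" using S_nonempty by blast
  \<comment> \<open>The summand 1 gives distances above 1, the middle one makes L/2 times the
    distance exceed both absolute terms, and the last one places \<open>a\<close> in the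
    ball.\<close>
  define R where "R = 1 + 2 / L * (norm (g w) + \<bar>model w a\<bar>) + norm (a - w)"
  have R: "1 \<le> R" "norm (a - w) \<le> R"
    using L_pos by (simp_all add: R_def add_nonneg_nonneg)
  have far: "model w a < model w z" if "R < norm (z - w)" for z
  proof -
    let ?r = "norm (z - w)"
    have r: "1 < ?r" using that R by simp
    have "2 / L * (norm (g w) + \<bar>model w a\<bar>) < ?r"
      using that norm_ge_zero[of "a - w"] unfolding R_def by linarith
    then have "norm (g w) + \<bar>model w a\<bar> < L / 2 * ?r"
      using L_pos by (simp add: field_simps)
    then have "(norm (g w) + \<bar>model w a\<bar>) * ?r < L / 2 * ?r * ?r"
      using r by (intro mult_strict_right_mono) auto
    moreover have "\<bar>model w a\<bar> * 1 \<le> \<bar>model w a\<bar> * ?r"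
      using r by (intro mult_left_mono) auto
    moreover have "- (norm (g w) * ?r) \<le> g w \<bullet> (z - w)"
      using Cauchy_Schwarz_ineq2[of "g w" "z - w"] by linarith
    ultimately show ?thesis
      using nonneg_p[of z] unfolding model_def[of w z] by (simp add: power2_eq_square algebra_simps)
  qed
  have "compact (S \<inter> cball w R)" using closed_S by (simp add: closed_Int_compact)
  moreover have "S \<inter> cball w R \<noteq> {}"
    using a R by (auto simp: dist_norm norm_minus_commute)
  moreover have "continuous_on (S \<inter> cball w R) (model w)"
    unfolding model_def by (intro continuous_intros continuous_on_subset[OF continuous_p]) auto
  ultimately obtain z where z: "z \<in> S" "\<And>x. x \<in> S \<inter> cball w R \<Longrightarrow> model w z \<le> model w x"
    using continuous_attains_inf by (metis IntD1)
  have "model w z \<le> model w x" if "x \<in> S" for x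
  proof (cases "x \<in> cball w R")
    case False
    then have "model w a < model w x" by (intro far) (simp add: dist_norm norm_minus_commute)
    moreover have "model w z \<le> model w a"
      using a R by (intro z(2)) (simp add: dist_norm norm_minus_commute)
    ultimately show ?thesis by simp
  qed (use z that in blast)
  then show ?thesis using z(1) by blast
qed

lemma prox_step_in: "prox_step w \<in> S"
  and prox_step_le: "x \<in> S \<Longrightarrow> model w (prox_step w) \<le> model w x"
proof -
  have "\<exists>z. is_arg_min (model w) (\<lambda>x. x \<in> S) z"
    using model_attains_minimum[of w] by (auto simp: is_arg_min_linorder)
  then have "is_arg_min (model w) (\<lambda>x. x \<in> S) (prox_step w)"
    unfolding prox_step_def arg_min_on_def arg_min_def by (rule someI_ex)
  then show "prox_step w \<in> S" "x \<in> S \<Longrightarrow> model w (prox_step w) \<le> model w x"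
    by (auto simp: is_arg_min_linorder)
qed

text \<open>The model is strongly convex, so it grows quadratically away from its minimizer.\<close>

lemma prox_step_growth:
  assumes "x \<in> S"
  shows "model w (prox_step w) + L / 2 * (norm (x - prox_step w))\<^sup>2 \<le> model w x"
proof -
  define z where "z = prox_step w"
  define D where "D = L / 2 * (norm (x - z))\<^sup>2"
  \<comment> \<open>Minimality is tested at the point a fraction \<open>t\<close> of the way to
    \<open>x\<close>. After division by \<open>t\<close>, letting \<open>t\<close> tend to 0 removes
    the factor 1 - t.\<close>
  have "model w z + (1 - t) * D \<le> model w x" if t: "0 < t" "t < 1" for t
  proof -
    let ?y = "(1 - t) *\<^sub>R z + t *\<^sub>R x"
    have "?y \<in> S"
      using t assms prox_step_in[of w] convex_S by (intro convexD) (auto simp: z_def)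
    then have "model w z \<le> model w ?y" unfolding z_def by (rule prox_step_le)
    also have "\<dots> \<le> (1 - t) * model w z + t * model w x - t * (1 - t) * D"
    proof -
      have "p ?y \<le> (1 - t) * p z + t * p x"
        using convex_onD[OF convex_p, of t z x] t by simp
      moreover have y: "?y - w = (1 - t) *\<^sub>R (z - w) + t *\<^sub>R (x - w)"
        by (simp add: algebra_simps)
      moreover have "(norm ((1 - t) *\<^sub>R a + t *\<^sub>R b))\<^sup>2 =
          (1 - t) * (norm a)\<^sup>2 + t * (norm b)\<^sup>2 - t * (1 - t) * (norm (b - a))\<^sup>2" for a b :: 'z
        unfolding power2_norm_eq_inner by (simp add: algebra_simps inner_commute)
      from this[of "z - w" "x - w"] have "(norm (?y - w))\<^sup>2 =
          (1 - t) * (norm (z - w))\<^sup>2 + t * (norm (x - w))\<^sup>2 - t * (1 - t) * (norm (x - z))\<^sup>2"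
        unfolding y by simp
      then have "L / 2 * (norm (?y - w))\<^sup>2 =
          (1 - t) * (L / 2 * (norm (z - w))\<^sup>2) + t * (L / 2 * (norm (x - w))\<^sup>2) - t * (1 - t) * D"
        unfolding D_def by (simp only:) (simp add: algebra_simps diff_divide_distrib)
      moreover have "g w \<bullet> (?y - w) = (1 - t) * (g w \<bullet> (z - w)) + t * (g w \<bullet> (x - w))"
        unfolding y by (simp add: inner_add_right)
      ultimately show ?thesis unfolding model_def by (simp add: algebra_simps)
    qed
    finally have "t * (model w z + (1 - t) * D) \<le> t * model w x" by (simp add: algebra_simps)
    then show ?thesis using t by simp
  qed
  then have "\<forall>\<^sub>F t in at_right 0. model w z + (1 - t) * D \<le> model w x"
    by (intro eventually_at_rightI[of 0 1]) auto
  moreover have "((\<lambda>t. model w z + (1 - t) * D) \<longlongrightarrow> model w z + (1 - 0) * D) (at_right 0)"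
    by (intro tendsto_intros)
  ultimately have "model w z + (1 - 0) * D \<le> model w x"
    by (intro tendsto_upperbound[of "\<lambda>t. model w z + (1 - t) * D" _ "at_right 0"]) auto
  then show ?thesis by (simp add: D_def z_def)
qed

abbreviation F :: "'z \<Rightarrow> real" where "F z \<equiv> p z + f z"

text \<open>Add the quadratic upper bound of \<open>f\<close> at the new point and its tangent bound
  at \<open>x\<close> to the growth of the model; the linear terms in \<open>g w\<close>
  cancel.\<close>

lemma prox_step_descent:
  assumes "x \<in> S"
  shows "F (prox_step w) + L / 2 * (norm (x - prox_step w))\<^sup>2 \<le> F x + L / 2 * (norm (x - w))\<^sup>2"
  using prox_step_growth[OF assms, of w] smooth_f[of "prox_step w" w] convex_f[of w x]
  by (simp add: model_def)

text \<open>For \<open>f\<close>, average the tangent inequalities at the intermediate point, where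
  the weighted displacements sum to zero.\<close>

lemma convex_F: "0 \<le> t \<Longrightarrow> t \<le> 1 \<Longrightarrow> F ((1 - t) *\<^sub>R x + t *\<^sub>R y) \<le> (1 - t) * F x + t * F y"
proof -
  assume t: "0 \<le> t" "t \<le> 1"
  let ?w = "(1 - t) *\<^sub>R x + t *\<^sub>R y"
  have "(1 - t) * (f ?w + g ?w \<bullet> (x - ?w)) + t * (f ?w + g ?w \<bullet> (y - ?w)) \<le> (1 - t) * f x + t * f y"
    using t by (intro add_mono mult_left_mono convex_f) auto
  moreover have "(1 - t) * (g ?w \<bullet> (x - ?w)) + t * (g ?w \<bullet> (y - ?w)) = g ?w \<bullet> ((1 - t) *\<^sub>R (x - ?w) + t *\<^sub>R (y - ?w))"
    by (simp only: inner_add_right inner_scaleR_right)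
  moreover have "(1 - t) *\<^sub>R (x - ?w) + t *\<^sub>R (y - ?w) = 0"
    by (simp add: algebra_simps)
  ultimately have "f ?w \<le> (1 - t) * f x + t * f y" by (simp add: algebra_simps)
  then show ?thesis using convex_onD[OF convex_p, of t x y] t by (simp add: algebra_simps)
qed

section \<open>The accelerated iteration and its rate\<close>

lemma apg_state_Suc:
  assumes "apg_state p f S L z0 l = (z, w, t)"
  shows "apg_state p f S L z0 (Suc l) =
    (let t' = (1 + sqrt (1 + 4 * t\<^sup>2)) / 2
     in (prox_step w, prox_step w + ((t - 1) / t') *\<^sub>R (prox_step w - z), t'))"
proof -
  have "(\<lambda>z. p z + gradient f w \<bullet> (z - w) + L / 2 * (norm (z - w))\<^sup>2) = model w"
    by (simp add: fun_eq_iff model_def gradient_f)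
  then show ?thesis using assms by (simp add: Let_def prox_step_def)
qed

text \<open>The case \<open>l = 0\<close> is excluded because the start is arbitrary and may lie
  outside \<open>S\<close>.\<close>

lemma apg_iterate_in:
  assumes "0 < l"
  shows "apg_iterate p f S L z0 l \<in> S"
proof -
  obtain l' where l: "l = Suc l'" using assms by (cases l) auto
  obtain z w t where "apg_state p f S L z0 l' = (z, w, t)" by (rule prod_cases3)
  from apg_state_Suc[OF this] show ?thesis by (simp add: l apg_iterate_def Let_def prox_step_in)
qed

text \<open>The Lyapunov function of Beck and Teboulle: since \<open>t\<^sub>l\<^sub>+\<^sub>1\<^sup>2 - t\<^sub>l\<^sub>+\<^sub>1 = t\<^sub>l\<^sup>2\<close>, comparing the new
  iterate with the convex combination \<open>(1 - 1/t) z + (1/t) x\<close> makes it nonincreasing.\<close>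

lemma apg_lyapunov:
  assumes x: "x \<in> S"
  shows "\<exists>z w t. apg_state p f S L z0 l = (z, w, t) \<and> (l + 2) / 2 \<le> t \<and> (t = 1 \<or> z \<in> S) \<and>
    (t\<^sup>2 - t) * (F z - F x) + L / 2 * (norm (t *\<^sub>R w - (t - 1) *\<^sub>R z - x))\<^sup>2 \<le> L / 2 * (norm (z0 - x))\<^sup>2"
proof (induction l)
  case 0
  show ?case by simp
next
  case (Suc l)
  then obtain z w t where st: "apg_state p f S L z0 l = (z, w, t)" and t: "(l + 2) / 2 \<le> t"
    and z: "t = 1 \<or> z \<in> S"
    and IH: "(t\<^sup>2 - t) * (F z - F x) + L / 2 * (norm (t *\<^sub>R w - (t - 1) *\<^sub>R z - x))\<^sup>2 \<le> L / 2 * (norm (z0 - x))\<^sup>2"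
    by blast
  define z' t' where "z' = prox_step w" and "t' = (1 + sqrt (1 + 4 * t\<^sup>2)) / 2"
  define w' where "w' = z' + ((t - 1) / t') *\<^sub>R (z' - z)"
  have st': "apg_state p f S L z0 (Suc l) = (z', w', t')"
    unfolding apg_state_Suc[OF st] by (simp add: z'_def t'_def w'_def Let_def)
  have t1: "1 \<le> t" using t by simp
  have "2 * t \<le> sqrt (1 + 4 * t\<^sup>2)" using t1 by (intro real_le_rsqrt) (simp add: power_mult_distrib)
  then have t': "(Suc l + 2) / 2 \<le> t'" using t by (simp add: t'_def)
  then have t'1: "0 < t'" by simp
  have t'2: "t'\<^sup>2 - t' = t\<^sup>2"
    by (simp add: t'_def power2_eq_square field_simps)
  \<comment> \<open>At the first step \<open>t = 1\<close> and \<open>z\<close> may lie outside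
    \<open>S\<close>, but then its weight vanishes and \<open>y = x\<close>. This is why the
    invariant carries the alternative \<open>t = 1\<close>.\<close>
  define y where "y = (1 - 1 / t) *\<^sub>R z + (1 / t) *\<^sub>R x"
  have y: "y \<in> S"
  proof (cases "t = 1")
    case True
    then show ?thesis using x by (simp add: y_def)
  next
    case False
    then show ?thesis using z x t1 convex_S unfolding y_def by (intro convexD) auto
  qed
  have "F z' + L / 2 * (norm (y - z'))\<^sup>2 \<le> F y + L / 2 * (norm (y - w))\<^sup>2"
    unfolding z'_def by (rule prox_step_descent[OF y])
  moreover have "F y \<le> (1 - 1 / t) * F z + 1 / t * F x"
    unfolding y_def using t1 by (intro convex_F) auto
  ultimately have "F z' + L / 2 * (norm (y - z'))\<^sup>2 \<le> (1 - 1 / t) * F z + 1 / t * F x + L / 2 * (norm (y - w))\<^sup>2"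
    by linarith
  then have "t\<^sup>2 * (F z' + L / 2 * (norm (y - z'))\<^sup>2) \<le>
      t\<^sup>2 * ((1 - 1 / t) * F z + 1 / t * F x + L / 2 * (norm (y - w))\<^sup>2)"
    by (intro mult_left_mono) auto
  moreover have "t\<^sup>2 * ((1 - 1 / t) * F z + 1 / t * F x + L / 2 * (norm (y - w))\<^sup>2) =
      (t\<^sup>2 - t) * F z + t * F x + L / 2 * (t\<^sup>2 * (norm (y - w))\<^sup>2)"
    using t1 by (simp add: field_simps power2_eq_square)
  moreover have "t\<^sup>2 * (norm (y - v))\<^sup>2 = (norm (t *\<^sub>R v - (t - 1) *\<^sub>R z - x))\<^sup>2" for v
  proof -
    have "t *\<^sub>R (y - v) = - (t *\<^sub>R v - (t - 1) *\<^sub>R z - x)"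
      using t1 by (simp add: y_def algebra_simps)
    then have "norm (t *\<^sub>R (y - v)) = norm (t *\<^sub>R v - (t - 1) *\<^sub>R z - x)" by (metis norm_minus_cancel)
    then show ?thesis using t1 by (simp add: power_mult_distrib flip: power_mult_distrib)
  qed
  ultimately have "t\<^sup>2 * (F z' - F x) + L / 2 * (norm (t *\<^sub>R z' - (t - 1) *\<^sub>R z - x))\<^sup>2 \<le>
      (t\<^sup>2 - t) * (F z - F x) + L / 2 * (norm (t *\<^sub>R w - (t - 1) *\<^sub>R z - x))\<^sup>2"
    by (simp add: algebra_simps)
  \<comment> \<open>The momentum coefficient is chosen for this identity: the combination measured
    at the next step is the one just bounded.\<close>
  moreover have "t' *\<^sub>R w' - (t' - 1) *\<^sub>R z' = t *\<^sub>R z' - (t - 1) *\<^sub>R z"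
  proof -
    have "t' *\<^sub>R w' = t' *\<^sub>R z' + (t - 1) *\<^sub>R (z' - z)"
      using t'1 by (simp add: w'_def scaleR_add_right)
    then show ?thesis by (simp add: algebra_simps)
  qed
  ultimately have "(t'\<^sup>2 - t') * (F z' - F x) + L / 2 * (norm (t' *\<^sub>R w' - (t' - 1) *\<^sub>R z' - x))\<^sup>2
      \<le> L / 2 * (norm (z0 - x))\<^sup>2"
    using IH t'2 by simp
  moreover have "z' \<in> S" by (simp add: z'_def prox_step_in)
  ultimately show ?case using st' t' by blast
qed

text \<open>The form without division also covers \<open>l = 0\<close> and iterates that are already
  better than \<open>x\<close>.\<close>

theorem apg_rate:
  assumes x: "x \<in> S"
  shows "(real l)\<^sup>2 * (F (apg_iterate p f S L z0 l) - F x) \<le> 2 * L * (norm (z0 - x))\<^sup>2"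
proof -
  obtain z w t where st: "apg_state p f S L z0 l = (z, w, t)" and t: "(l + 2) / 2 \<le> t"
    and le: "(t\<^sup>2 - t) * (F z - F x) + L / 2 * (norm (t *\<^sub>R w - (t - 1) *\<^sub>R z - x))\<^sup>2 \<le> L / 2 * (norm (z0 - x))\<^sup>2"
    using apg_lyapunov[OF x] by blast
  have z: "apg_iterate p f S L z0 l = z" by (simp add: apg_iterate_def st)
  have le': "(t\<^sup>2 - t) * (F z - F x) \<le> L / 2 * (norm (z0 - x))\<^sup>2"
    using le L_pos by (smt (verit) mult_nonneg_nonneg zero_le_power2 divide_nonneg_pos)
  \<comment> \<open>The stored \<open>t\<close> already belongs to step l + 1, so both
    \<open>t\<close> and t - 1 are at least l/2.\<close>
  have "(real l)\<^sup>2 / 4 \<le> t\<^sup>2 - t"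
  proof -
    have "(real l / 2) * (real l / 2) \<le> t * (t - 1)" using t by (intro mult_mono) auto
    then show ?thesis by (simp add: power2_eq_square algebra_simps)
  qed
  show ?thesis
  proof (cases "F z \<le> F x")
    case True
    then have "(real l)\<^sup>2 * (F z - F x) \<le> 0" by (simp add: mult_nonneg_nonpos)
    also have "\<dots> \<le> 2 * L * (norm (z0 - x))\<^sup>2" using L_pos by simp
    finally show ?thesis by (simp add: z)
  next
    case False
    then have "(real l)\<^sup>2 / 4 * (F z - F x) \<le> (t\<^sup>2 - t) * (F z - F x)"
      using \<open>(real l)\<^sup>2 / 4 \<le> t\<^sup>2 - t\<close> by (intro mult_right_mono) auto
    then show ?thesis using le' by (simp add: z)
  qed
qed

end

section \<open>A single FALC iteration\<close>

lemma norm_vec_squared: "(norm (x :: real ^ 'k))\<^sup>2 = (\<Sum>i\<in>UNIV. (x $ i)\<^sup>2)"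
  unfolding power2_norm_eq_inner inner_vec_def by (simp add: power2_eq_square)

lemma sum_UNIV_sum_type:
  fixes f :: "'a::finite + 'b::finite \<Rightarrow> 'c::comm_monoid_add"
  shows "(\<Sum>r\<in>UNIV. f r) = (\<Sum>i\<in>UNIV. f (Inl i)) + (\<Sum>j\<in>UNIV. f (Inr j))"
  unfolding UNIV_Plus_UNIV[symmetric] by (subst sum.Plus) simp_all

lemma norm_vectorize: "norm (vectorize X) = norm X"
proof -
  have "(norm (vectorize X))\<^sup>2 = (\<Sum>p\<in>UNIV \<times> UNIV. case p of (j, i) \<Rightarrow> (X $ i $ j)\<^sup>2)"
    unfolding norm_vec_squared UNIV_Times_UNIV vectorize_def by (intro sum.cong) auto
  also have "\<dots> = (\<Sum>i\<in>UNIV. \<Sum>j\<in>UNIV. (X $ i $ j)\<^sup>2)"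
    unfolding sum.cartesian_product[symmetric] by (rule sum.swap)
  also have "\<dots> = (norm X)\<^sup>2"
    unfolding power2_norm_eq_inner inner_vec_def by (simp add: power2_eq_square)
  finally show ?thesis by simp
qed

lemma norm_linear_le_sigma_max: "linear T \<Longrightarrow> norm (T X) \<le> sigma_max (rep_matrix T) * norm X"
  using norm_mult_le_sigma_max[of "rep_matrix T" "vectorize X"]
  by (simp add: rep_matrix_mult_vectorize norm_vectorize)

lemma sigma_max_nonneg: "0 \<le> sigma_max X"
  using norm_mult_le_sigma_max[of X "axis undefined 1"] by (smt (verit) norm_axis_1 norm_ge_zero mult_cancel_left2)

locale falc_assms = falc \<alpha> \<beta> \<mu>1 \<mu>2 \<A> \<C> b d Q X0 lam eps tau xi
  for \<alpha> \<beta> :: ell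
    and \<mu>1 \<mu>2 :: real
    and \<A> :: "real ^ 'n ^ 'm \<Rightarrow> real ^ 'q"
    and \<C> :: "real ^ 'n ^ 'm \<Rightarrow> real ^ 'p"
    and b :: "real ^ 'q"
    and d :: "real ^ 'p"
    and Q :: "(real ^ 'q) set"
    and X0 :: "real ^ 'n ^ 'm"
    and lam eps tau xi :: "nat \<Rightarrow> real" +
  assumes mu1: "0 < \<mu>1" and mu2: "0 < \<mu>2"
    and linear_A: "linear \<A>" and surj_A: "surj \<A>" and linear_C: "linear \<C>"
    and closed_Q: "closed Q" and convex_Q: "convex Q"
    and X0_feasible: "\<A> X0 - b \<in> Q"
    and lam_pos: "1 \<le> k \<Longrightarrow> 0 < lam k"
    and eps_pos: "1 \<le> k \<Longrightarrow> 0 < eps k"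
begin

definition K1 :: real where "K1 = min CARD('m) CARD('n)"
definition K2 :: real where "K2 = CARD('p)"

sublocale sv: sublinear_norm "sv_norm \<alpha> :: real ^ 'n ^ 'm \<Rightarrow> real" K1 I_const
  unfolding K1_def I_const_def by (rule sublinear_norm_sv_norm)

sublocale vn: sublinear_norm "vec_norm \<beta> :: real ^ 'p \<Rightarrow> real" K2 J_const
  unfolding K2_def J_const_def by (rule sublinear_norm_vec_norm)

definition SA :: real where "SA = sigma_max (rep_matrix \<A>)"
definition SC :: real where "SC = sigma_max (rep_matrix \<C>)"

lemma norm_A_le: "norm (\<A> X) \<le> SA * norm X"
  unfolding SA_def by (rule norm_linear_le_sigma_max[OF linear_A])

lemma norm_C_le: "norm (\<C> X) \<le> SC * norm X"
  unfolding SC_def by (rule norm_linear_le_sigma_max[OF linear_C])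

lemma SA_nonneg: "0 \<le> SA" and SC_nonneg: "0 \<le> SC"
  unfolding SA_def SC_def by (rule sigma_max_nonneg)+

text \<open>The block matrix sends the stacked vector of \<open>s\<close>, \<open>y\<close> and vec
  \<open>X\<close> to the stacked residuals, so the square of its largest singular value bounds this
  quadratic form.\<close>

lemma residual_map_bound:
  "(norm (\<A> X - y))\<^sup>2 + (norm (\<C> X - s))\<^sup>2 \<le> L_const * (norm (X, s, y))\<^sup>2"
proof -
  let ?M = "block_matrix (rep_matrix \<A>) (rep_matrix \<C>)"
  define w :: "real ^ ('p + 'q + ('n \<times> 'm))" where
    "w = (\<chi> c. case c of Inl i \<Rightarrow> s $ i | Inr (Inl j) \<Rightarrow> y $ j | Inr (Inr k) \<Rightarrow> vectorize X $ k)"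
  have "(norm w)\<^sup>2 = (norm s)\<^sup>2 + ((norm y)\<^sup>2 + (norm (vectorize X))\<^sup>2)"
    unfolding norm_vec_squared sum_UNIV_sum_type w_def by simp
  then have w: "(norm w)\<^sup>2 = (norm (X, s, y))\<^sup>2"
    by (simp add: norm_Pair norm_vectorize)
  have delta: "(\<Sum>i'\<in>UNIV. (if i = i' then - 1 else 0) * v $ i') = - v $ i" for v :: "real ^ 'k" and i
  proof -
    have "(\<Sum>i'\<in>UNIV. (if i = i' then - 1 else 0) * v $ i') = (\<Sum>i'\<in>UNIV. if i = i' then - v $ i' else 0)"
      by (intro sum.cong) auto
    then show ?thesis by simp
  qed
  have "?M *v w = (\<chi> r. case r of Inl i \<Rightarrow> (\<C> X - s) $ i | Inr j \<Rightarrow> (\<A> X - y) $ j)"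
  proof -
    have "(\<Sum>k\<in>UNIV. rep_matrix \<C> $ i $ k * vectorize X $ k) = \<C> X $ i" for i
      using rep_matrix_mult_vectorize[OF linear_C, of X] by (simp add: matrix_vector_mult_def vec_eq_iff)
    moreover have "(\<Sum>k\<in>UNIV. rep_matrix \<A> $ j $ k * vectorize X $ k) = \<A> X $ j" for j
      using rep_matrix_mult_vectorize[OF linear_A, of X] by (simp add: matrix_vector_mult_def vec_eq_iff)
    ultimately show ?thesis
      unfolding matrix_vector_mult_def vec_eq_iff sum_UNIV_sum_type block_matrix_def w_def
      by (simp add: delta split: sum.split)
  qed
  then have "(norm (?M *v w))\<^sup>2 = (norm (\<C> X - s))\<^sup>2 + (norm (\<A> X - y))\<^sup>2"
    unfolding norm_vec_squared[of "?M *v w"] by (simp add: sum_UNIV_sum_type norm_vec_squared)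
  moreover have "(norm (?M *v w))\<^sup>2 \<le> (sigma_max ?M * norm w)\<^sup>2"
    by (intro power_mono norm_mult_le_sigma_max) simp
  ultimately show ?thesis by (simp add: L_const_def power_mult_distrib w)
qed

lemma L_pos: "0 < L_const"
proof -
  \<comment> \<open>At X = 0, s = 0 and a unit vector for \<open>y\<close>, both the left side and
    the squared norm on the right are 1.\<close>
  have "(norm (\<A> 0 - axis undefined 1))\<^sup>2 + (norm (\<C> 0 - 0))\<^sup>2
      \<le> L_const * (norm (0 :: real ^ 'n ^ 'm, 0 :: real ^ 'p, axis undefined 1 :: real ^ 'q))\<^sup>2"
    by (rule residual_map_bound)
  then show ?thesis using linear_0[OF linear_A] linear_0[OF linear_C] by (simp add: norm_Pair)
qed

section \<open>The smooth part as a quadratic function\<close>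

definition resA :: "nat \<Rightarrow> real ^ 'q \<Rightarrow> ('n, 'm, 'p, 'q) point \<Rightarrow> real ^ 'q" where
  "resA k \<theta>1 = (\<lambda>(X, s, y). \<A> X - y - b - lam k *\<^sub>R \<theta>1)"

definition resC :: "nat \<Rightarrow> real ^ 'p \<Rightarrow> ('n, 'm, 'p, 'q) point \<Rightarrow> real ^ 'p" where
  "resC k \<theta>2 = (\<lambda>(X, s, y). \<C> X - s - d - lam k *\<^sub>R \<theta>2)"

definition grad ::
    "nat \<Rightarrow> real ^ 'q \<Rightarrow> real ^ 'p \<Rightarrow> ('n, 'm, 'p, 'q) point \<Rightarrow> ('n, 'm, 'p, 'q) point" where
  "grad k \<theta>1 \<theta>2 z = (adjoint \<A> (resA k \<theta>1 z) + adjoint \<C> (resC k \<theta>2 z), - resC k \<theta>2 z, - resA k \<theta>1 z)"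

lemma f_part_eq: "f_part k \<theta>1 \<theta>2 z = 1 / 2 * (norm (resA k \<theta>1 z))\<^sup>2 + 1 / 2 * (norm (resC k \<theta>2 z))\<^sup>2"
  by (cases z) (simp add: f_part_def resA_def resC_def)

text \<open>A quadratic function equals its second order expansion. A nonnegative remainder gives
  convexity, and \<open>residual_map_bound\<close> on the remainder gives smoothness with
  \<open>L_const\<close>.\<close>

lemma f_part_expand:
  "f_part k \<theta>1 \<theta>2 (z + (X, s, y)) = f_part k \<theta>1 \<theta>2 z + grad k \<theta>1 \<theta>2 z \<bullet> (X, s, y)
     + 1 / 2 * ((norm (\<A> X - y))\<^sup>2 + (norm (\<C> X - s))\<^sup>2)"
proof -
  have A: "resA k \<theta>1 (z + (X, s, y)) = resA k \<theta>1 z + (\<A> X - y)"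
    by (cases z) (simp add: resA_def linear_add[OF linear_A])
  have C: "resC k \<theta>2 (z + (X, s, y)) = resC k \<theta>2 z + (\<C> X - s)"
    by (cases z) (simp add: resC_def linear_add[OF linear_C])
  have g: "grad k \<theta>1 \<theta>2 z \<bullet> (X, s, y) = resA k \<theta>1 z \<bullet> (\<A> X - y) + resC k \<theta>2 z \<bullet> (\<C> X - s)"
    by (simp add: grad_def inner_add_left inner_diff_right
        adjoint_works[OF linear_A, of X] adjoint_works[OF linear_C, of X]
        inner_commute[of "adjoint _ _"] inner_commute[of "\<A> X"] inner_commute[of "\<C> X"])
  have sq: "(norm (u + v))\<^sup>2 = (norm u)\<^sup>2 + 2 * (u \<bullet> v) + (norm v)\<^sup>2" for u v :: "real ^ 'k"
    by (simp add: power2_norm_eq_inner inner_add_left inner_add_right inner_commute)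
  show ?thesis unfolding f_part_eq A C g sq by (simp add: algebra_simps)
qed

lemma f_part_convex: "f_part k \<theta>1 \<theta>2 w + grad k \<theta>1 \<theta>2 w \<bullet> (z - w) \<le> f_part k \<theta>1 \<theta>2 z"
  and f_part_smooth: "f_part k \<theta>1 \<theta>2 z \<le>
    f_part k \<theta>1 \<theta>2 w + grad k \<theta>1 \<theta>2 w \<bullet> (z - w) + L_const / 2 * (norm (z - w))\<^sup>2"
proof -
  obtain X s y where h: "z - w = (X, s, y)" by (rule prod_cases3)
  then have "z = w + (X, s, y)" by (metis add_diff_cancel_left' diff_add_cancel add.commute)
  then show "f_part k \<theta>1 \<theta>2 w + grad k \<theta>1 \<theta>2 w \<bullet> (z - w) \<le> f_part k \<theta>1 \<theta>2 z"
    "f_part k \<theta>1 \<theta>2 z \<le> f_part k \<theta>1 \<theta>2 w + grad k \<theta>1 \<theta>2 w \<bullet> (z - w) + L_const / 2 * (norm (z - w))\<^sup>2"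
    using f_part_expand[of k \<theta>1 \<theta>2 w X s y] residual_map_bound[of X y s] by (simp_all add: h)
qed

lemma start_in_domain: "1 \<le> k \<Longrightarrow> (X0, \<C> X0 - d, \<A> X0 - b) \<in> apg_domain k \<theta>1 \<theta>2"
  using mu1 mu2 lam_pos[of k] sv.nonneg[of X0] vn.nonneg[of "\<C> X0 - d"] X0_feasible
  by (simp add: apg_domain_def eta1_def eta_def add_increasing2 add_increasing)

lemma composite_minimization:
  assumes "1 \<le> k"
  shows "composite_minimization (p_part k) (f_part k \<theta>1 \<theta>2) (grad k \<theta>1 \<theta>2) (apg_domain k \<theta>1 \<theta>2) L_const"
proof
  note lam = lam_pos[OF assms]
  let ?N1 = "sv_norm \<alpha> :: real ^ 'n ^ 'm \<Rightarrow> real" and ?N2 = "vec_norm \<beta> :: real ^ 'p \<Rightarrow> real"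
  have p: "p_part k = (\<lambda>z. lam k * (\<mu>1 * ?N1 (fst z) + \<mu>2 * ?N2 (fst (snd z))))"
    by (auto simp: p_part_def)
  have cont: "continuous_on UNIV (\<lambda>z :: ('n, 'm, 'p, 'q) point. ?N1 (fst z))"
    "continuous_on UNIV (\<lambda>z :: ('n, 'm, 'p, 'q) point. ?N2 (fst (snd z)))"
    by (auto intro!: continuous_on_compose2[OF sv.continuous] continuous_on_compose2[OF vn.continuous] continuous_intros)
  show "convex_on UNIV (p_part k)"
  proof (rule convex_onI)
    fix t and x y :: "('n, 'm, 'p, 'q) point" assume t: "0 < (t::real)" "t < 1"
    have "?N1 (fst ((1 - t) *\<^sub>R x + t *\<^sub>R y)) \<le> (1 - t) * ?N1 (fst x) + t * ?N1 (fst y)"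
      "?N2 (fst (snd ((1 - t) *\<^sub>R x + t *\<^sub>R y))) \<le> (1 - t) * ?N2 (fst (snd x)) + t * ?N2 (fst (snd y))"
      using convex_onD[OF sv.convex, of t "fst x" "fst y"]
        convex_onD[OF vn.convex, of t "fst (snd x)" "fst (snd y)"] t by simp_all
    then have "lam k * (\<mu>1 * ?N1 (fst ((1 - t) *\<^sub>R x + t *\<^sub>R y)) + \<mu>2 * ?N2 (fst (snd ((1 - t) *\<^sub>R x + t *\<^sub>R y))))
        \<le> lam k * (\<mu>1 * ((1 - t) * ?N1 (fst x) + t * ?N1 (fst y)) + \<mu>2 * ((1 - t) * ?N2 (fst (snd x)) + t * ?N2 (fst (snd y))))"
      using lam mu1 mu2 by (intro mult_left_mono add_mono) auto
    then show "p_part k ((1 - t) *\<^sub>R x + t *\<^sub>R y) \<le> (1 - t) * p_part k x + t * p_part k y"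
      unfolding p by (simp add: algebra_simps)
  qed simp
  show "continuous_on UNIV (p_part k)" unfolding p by (intro continuous_intros cont)
  show "0 \<le> p_part k z" for z
    unfolding p using lam mu1 mu2 sv.nonneg vn.nonneg by simp
  have D: "apg_domain k \<theta>1 \<theta>2 = {z. \<mu>1 * ?N1 (fst z) \<le> eta1 k \<theta>1 \<theta>2} \<inter>
      {z. \<mu>2 * ?N2 (fst (snd z)) \<le> eta1 k \<theta>1 \<theta>2} \<inter> (\<lambda>z. snd (snd z)) -` Q"
    by (auto simp: apg_domain_def)
  show "closed (apg_domain k \<theta>1 \<theta>2)" unfolding D
    by (intro closed_Int closed_Collect_le continuous_intros cont closed_vimage closed_Q)
  show "convex (apg_domain k \<theta>1 \<theta>2)"
  proof (rule convexI)
    fix x y :: "('n, 'm, 'p, 'q) point" and u v :: real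
    assume xy: "x \<in> apg_domain k \<theta>1 \<theta>2" "y \<in> apg_domain k \<theta>1 \<theta>2" and uv: "0 \<le> u" "0 \<le> v" "u + v = 1"
    have "\<mu>1 * ?N1 (fst (u *\<^sub>R x + v *\<^sub>R y)) \<le> u * (\<mu>1 * ?N1 (fst x)) + v * (\<mu>1 * ?N1 (fst y))"
      using mult_left_mono[OF sv.add[of "u *\<^sub>R fst x" "v *\<^sub>R fst y"], of \<mu>1] mu1 uv
      by (simp add: sv.scale algebra_simps)
    also have "\<dots> \<le> eta1 k \<theta>1 \<theta>2"
      using xy uv by (intro convex_bound_le) (auto simp: D)
    finally have 1: "\<mu>1 * ?N1 (fst (u *\<^sub>R x + v *\<^sub>R y)) \<le> eta1 k \<theta>1 \<theta>2" .
    have "\<mu>2 * ?N2 (fst (snd (u *\<^sub>R x + v *\<^sub>R y))) \<le> u * (\<mu>2 * ?N2 (fst (snd x))) + v * (\<mu>2 * ?N2 (fst (snd y)))"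
      using mult_left_mono[OF vn.add[of "u *\<^sub>R fst (snd x)" "v *\<^sub>R fst (snd y)"], of \<mu>2] mu2 uv
      by (simp add: vn.scale algebra_simps)
    also have "\<dots> \<le> eta1 k \<theta>1 \<theta>2"
      using xy uv by (intro convex_bound_le) (auto simp: D)
    finally have 2: "\<mu>2 * ?N2 (fst (snd (u *\<^sub>R x + v *\<^sub>R y))) \<le> eta1 k \<theta>1 \<theta>2" .
    have "u *\<^sub>R snd (snd x) + v *\<^sub>R snd (snd y) \<in> Q"
      using xy uv by (intro convexD[OF convex_Q]) (auto simp: D)
    with 1 2 show "u *\<^sub>R x + v *\<^sub>R y \<in> apg_domain k \<theta>1 \<theta>2" unfolding D by simp
  qed
  show "apg_domain k \<theta>1 \<theta>2 \<noteq> {}" using start_in_domain[OF assms] by blast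
qed (rule f_part_convex f_part_smooth L_pos)+

section \<open>Near-minimality after \<open>l_max\<close> inner steps\<close>

definition P :: "nat \<Rightarrow> real ^ 'q \<Rightarrow> real ^ 'p \<Rightarrow> ('n, 'm, 'p, 'q) point \<Rightarrow> real" where
  "P k \<theta>1 \<theta>2 z = p_part k z + f_part k \<theta>1 \<theta>2 z"

lemma P_feasible:
  "P k \<theta>1 \<theta>2 (X, \<C> X - d, \<A> X - b) = lam k * objective X + (lam k)\<^sup>2 / 2 * ((norm \<theta>1)\<^sup>2 + (norm \<theta>2)\<^sup>2)"
  by (simp add: P_def p_part_def f_part_def objective_def power_mult_distrib algebra_simps)

text \<open>The origin of \<open>eta1\<close>: a point with norm part above \<open>lam k\<close>
  times this value already costs more than the start.\<close>

lemma P_start: "P k \<theta>1 \<theta>2 (X0, \<C> X0 - d, \<A> X0 - b) = lam k * eta1 k \<theta>1 \<theta>2"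
  unfolding P_feasible by (simp add: eta1_def eta_def objective_def power2_eq_square algebra_simps)

text \<open>For fixed \<open>X\<close> and \<open>s\<close> the best \<open>y\<close> is a
  projection onto \<open>Q\<close>. Projections are nonexpansive and fix the point \<A> X0 - b,
  which bounds the norm of this \<open>y\<close>; for \<open>X\<close> in the domain the bound
  becomes \<open>eta2\<close>.\<close>

lemma projection_improves:
  fixes X :: "real ^ 'n ^ 'm" and k :: nat and \<theta> :: "real ^ 'q"
  assumes y: "y \<in> Q"
  defines "y' \<equiv> closest_point Q (\<A> X - b - lam k *\<^sub>R \<theta>)"
  shows "y' \<in> Q" "P k \<theta> \<phi> (X, s, y') \<le> P k \<theta> \<phi> (X, s, y)"
    "norm y' \<le> SA * norm X + norm (b + lam k *\<^sub>R \<theta>) + 2 * norm (\<A> X0 - b)"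
proof -
  let ?w = "\<A> X - b - lam k *\<^sub>R \<theta>"
  show "y' \<in> Q" unfolding y'_def using y closed_Q by (intro closest_point_in_set) auto
  have "norm (?w - y') \<le> norm (?w - y)"
    using closest_point_le[OF closed_Q y, of ?w] by (simp add: y'_def dist_norm)
  then have "(norm (\<A> X - y' - b - lam k *\<^sub>R \<theta>))\<^sup>2 \<le> (norm (\<A> X - y - b - lam k *\<^sub>R \<theta>))\<^sup>2"
    by (intro power_mono) (simp_all add: algebra_simps)
  then show "P k \<theta> \<phi> (X, s, y') \<le> P k \<theta> \<phi> (X, s, y)"
    by (simp add: P_def p_part_def f_part_def)
  have "dist y' (closest_point Q (\<A> X0 - b)) \<le> dist ?w (\<A> X0 - b)"
    unfolding y'_def using convex_Q closed_Q y by (intro closest_point_lipschitz) auto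
  then have "norm (y' - (\<A> X0 - b)) \<le> norm (?w - (\<A> X0 - b))"
    by (simp add: closest_point_self[OF X0_feasible] dist_norm)
  then have "norm y' \<le> norm ?w + 2 * norm (\<A> X0 - b)"
    using norm_triangle_ineq4[of ?w "\<A> X0 - b"] norm_triangle_sub[of y' "\<A> X0 - b"] by linarith
  moreover have "norm ?w \<le> norm (\<A> X) + norm (b + lam k *\<^sub>R \<theta>)"
    using norm_triangle_ineq4[of "\<A> X" "b + lam k *\<^sub>R \<theta>"] by (simp add: algebra_simps)
  ultimately show "norm y' \<le> SA * norm X + norm (b + lam k *\<^sub>R \<theta>) + 2 * norm (\<A> X0 - b)"
    using norm_A_le[of X] by simp
qed

text \<open>Competitors are not confined to \<open>apg_domain\<close>, so that the gradient test
  step may leave it.\<close>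

definition near_minimizer where
  "near_minimizer k \<theta>1 \<theta>2 z \<longleftrightarrow> (\<forall>X s. \<forall>y\<in>Q. P k \<theta>1 \<theta>2 z \<le> P k \<theta>1 \<theta>2 (X, s, y) + eps k)"

text \<open>The bound \<open>l_max\<close> dominates the distance from the start to the point obtained from any competitor
  by projecting its \<open>y\<close>-component; competitors outside \<open>apg_domain\<close> are worse than the start.\<close>

lemma iterate_near_minimizer:
  assumes k: "1 \<le> k" and l: "l_max k \<theta>1 \<theta>2 z \<le> real l"
  shows "near_minimizer k \<theta>1 \<theta>2 (inner_iterate k \<theta>1 \<theta>2 z l)"
proof -
  interpret composite_minimization "p_part k" "f_part k \<theta>1 \<theta>2" "grad k \<theta>1 \<theta>2" "apg_domain k \<theta>1 \<theta>2" L_const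
    by (rule composite_minimization[OF k])
  let ?e = "eta1 k \<theta>1 \<theta>2" and ?z = "inner_iterate k \<theta>1 \<theta>2 z l"
  obtain Xz sz yz where z: "z = (Xz, sz, yz)" by (rule prod_cases3)
  have in_domain: "P k \<theta>1 \<theta>2 ?z \<le> P k \<theta>1 \<theta>2 (X, s, y) + eps k"
    if X: "\<mu>1 * sv_norm \<alpha> X \<le> ?e" and s: "\<mu>2 * vec_norm \<beta> s \<le> ?e" and y: "y \<in> Q" for X s y
  proof -
    define y' where "y' = closest_point Q (\<A> X - b - lam k *\<^sub>R \<theta>1)"
    note y' = projection_improves[OF y, where X = X and k = k and \<theta> = \<theta>1, folded y'_def]
    have nX: "norm X \<le> I_const / \<mu>1 * ?e"
      using sv.lower[of X] mult_left_mono[OF X, of "I_const / \<mu>1"] sv.c_pos mu1 by simp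
    have ns: "norm s \<le> J_const / \<mu>2 * ?e"
      using vn.lower[of s] mult_left_mono[OF s, of "J_const / \<mu>2"] vn.c_pos mu2 by simp
    have "norm y' \<le> SA * (I_const / \<mu>1 * ?e) + norm (b + lam k *\<^sub>R \<theta>1) + 2 * norm (\<A> X0 - b)"
      using y'(3) mult_left_mono[OF nX SA_nonneg] by linarith
    then have ny: "norm y' \<le> eta2 k \<theta>1 \<theta>2" by (simp add: eta2_def SA_def mult.assoc)
    \<comment> \<open>The bracket in \<open>l_max\<close>. It bounds the distance from the start to
      the competitor by the sum of all the norms involved.\<close>
    define R where "R = (I_const / \<mu>1 + J_const / \<mu>2) * ?e + eta2 k \<theta>1 \<theta>2 + norm Xz + norm sz + norm yz"
    have "norm (z - (X, s, y')) \<le> norm (Xz - X) + (norm (sz - s) + norm (yz - y'))"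
      unfolding z using norm_Pair_le[of "Xz - X" "(sz - s, yz - y')"] norm_Pair_le[of "sz - s" "yz - y'"]
      by simp
    also have "\<dots> \<le> (norm Xz + norm X) + ((norm sz + norm s) + (norm yz + norm y'))"
      by (intro add_mono norm_triangle_ineq4)
    also have "\<dots> \<le> R" using nX ns ny by (simp add: R_def algebra_simps)
    finally have dist: "norm (z - (X, s, y')) \<le> R" .
    have R0: "0 \<le> R" using dist norm_ge_zero order.trans by blast
    have "sqrt (2 * L_const / eps k) * R \<le> real l" using l by (simp add: l_max_def z R_def)
    then have "(sqrt (2 * L_const / eps k) * R)\<^sup>2 \<le> (real l)\<^sup>2"
      using R0 L_pos eps_pos[OF k] by (intro power_mono) auto
    then have "2 * L_const / eps k * R\<^sup>2 \<le> (real l)\<^sup>2"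
      using L_pos eps_pos[OF k] by (simp add: power_mult_distrib)
    then have lR: "2 * L_const * R\<^sup>2 \<le> (real l)\<^sup>2 * eps k"
      using eps_pos[OF k] by (simp add: field_simps)
    have "(X, s, y') \<in> apg_domain k \<theta>1 \<theta>2" using X s y' by (simp add: apg_domain_def)
    from apg_rate[OF this, of l z] have
      rate: "(real l)\<^sup>2 * (P k \<theta>1 \<theta>2 ?z - P k \<theta>1 \<theta>2 (X, s, y')) \<le> 2 * L_const * (norm (z - (X, s, y')))\<^sup>2"
      by (simp add: P_def inner_iterate_def)
    have "P k \<theta>1 \<theta>2 ?z \<le> P k \<theta>1 \<theta>2 (X, s, y') + eps k"
    \<comment> \<open>With no steps the rate is void, but then \<open>l_max\<close> is at most 0,
      hence \<open>R\<close> is 0 and the start is itself the competitor.\<close>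
    proof (cases "l = 0")
      case True
      then have "R\<^sup>2 \<le> 0" using lR L_pos by (simp add: mult_le_0_iff)
      then have "R = 0" by simp
      then have "z = (X, s, y')" using dist by simp
      moreover have "?z = z" using True by (simp add: inner_iterate_def apg_iterate_def)
      ultimately show ?thesis using eps_pos[OF k] by simp
    next
      case False
      have "2 * L_const * (norm (z - (X, s, y')))\<^sup>2 \<le> 2 * L_const * R\<^sup>2"
        using L_pos dist by (intro mult_left_mono power_mono) auto
      then have "(real l)\<^sup>2 * (P k \<theta>1 \<theta>2 ?z - P k \<theta>1 \<theta>2 (X, s, y')) \<le> (real l)\<^sup>2 * eps k"
        using rate lR by linarith
      then show ?thesis using False by (simp add: mult_le_cancel_left)
    qed
    then show ?thesis using y'(2)[of \<theta>2 s] by simp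
  qed
  have "P k \<theta>1 \<theta>2 ?z \<le> P k \<theta>1 \<theta>2 (X, s, y) + eps k" if y: "y \<in> Q" for X s y
  proof (cases "\<mu>1 * sv_norm \<alpha> X \<le> ?e \<and> \<mu>2 * vec_norm \<beta> s \<le> ?e")
    case True
    then show ?thesis using in_domain y by blast
  next
    case False
    have nn: "0 \<le> \<mu>1 * sv_norm \<alpha> X" "0 \<le> \<mu>2 * vec_norm \<beta> s"
      using mu1 mu2 sv.nonneg vn.nonneg by simp_all
    have "lam k * ?e \<le> lam k * (\<mu>1 * sv_norm \<alpha> X + \<mu>2 * vec_norm \<beta> s)"
      using False nn lam_pos[OF k] by (intro mult_left_mono) auto
    also have "\<dots> \<le> P k \<theta>1 \<theta>2 (X, s, y)" by (simp add: P_def p_part_def f_part_def)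
    finally have "P k \<theta>1 \<theta>2 (X0, \<C> X0 - d, \<A> X0 - b) \<le> P k \<theta>1 \<theta>2 (X, s, y)" by (simp add: P_start)
    moreover have "P k \<theta>1 \<theta>2 ?z \<le> P k \<theta>1 \<theta>2 (X0, \<C> X0 - d, \<A> X0 - b) + eps k"
      using start_in_domain[OF k, of \<theta>1 \<theta>2] by (intro in_domain) (auto simp: apg_domain_def)
    ultimately show ?thesis by linarith
  qed
  then show ?thesis by (auto simp: near_minimizer_def)
qed

lemma inner_output_stop:
  assumes "1 \<le> k"
  shows "near_minimizer k \<theta>1 \<theta>2 (inner_output k \<theta>1 \<theta>2 z) \<or> grad_stop k \<theta>1 \<theta>2 (inner_output k \<theta>1 \<theta>2 z)"
proof -
  have "real (inner_count k \<theta>1 \<theta>2 z) \<ge> l_max k \<theta>1 \<theta>2 z \<or>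
      grad_stop k \<theta>1 \<theta>2 (inner_iterate k \<theta>1 \<theta>2 z (inner_count k \<theta>1 \<theta>2 z))"
    unfolding inner_count_def by (rule LeastI_ex) (rule inner_routine_terminates)
  then show ?thesis unfolding inner_output_def using iterate_near_minimizer[OF assms] by blast
qed

text \<open>The second alternative is a stop after zero steps. The start may violate the current
  domain because \<open>eta1\<close> changes with the multipliers.\<close>

lemma inner_output_in:
  assumes "1 \<le> k"
  shows "inner_output k \<theta>1 \<theta>2 z \<in> apg_domain k \<theta>1 \<theta>2 \<or> inner_output k \<theta>1 \<theta>2 z = z"
proof -
  interpret composite_minimization "p_part k" "f_part k \<theta>1 \<theta>2" "grad k \<theta>1 \<theta>2" "apg_domain k \<theta>1 \<theta>2" L_const
    by (rule composite_minimization[OF assms])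
  show ?thesis
    unfolding inner_output_def inner_iterate_def using apg_iterate_in[of _ z]
    by (cases "inner_count k \<theta>1 \<theta>2 z = 0") (auto simp: apg_iterate_def)
qed

lemma inner_count_le:
  assumes "l_max k \<theta>1 \<theta>2 z \<le> M" "0 \<le> M"
  shows "real (inner_count k \<theta>1 \<theta>2 z) \<le> M + 1"
proof -
  have "inner_count k \<theta>1 \<theta>2 z \<le> nat \<lceil>M\<rceil>"
    unfolding inner_count_def
    by (rule Least_le) (meson assms(1) order.trans real_nat_ceiling_ge)
  then have "real (inner_count k \<theta>1 \<theta>2 z) \<le> real (nat \<lceil>M\<rceil>)" by simp
  also have "\<dots> \<le> M + 1" using assms(2) by linarith
  finally show ?thesis .
qed

section \<open>Consequences of the two stopping tests\<close>

lemma grad_stopE: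
  assumes "1 \<le> k" "grad_stop k \<theta>1 \<theta>2 (X, s, y)" "grad k \<theta>1 \<theta>2 (X, s, y) = (fX, fs, fy)"
  obtains U u where "U \<in> subdifferential (sv_norm \<alpha>) X" "u \<in> subdifferential (vec_norm \<beta>) s"
    "norm ((lam k * \<mu>1) *\<^sub>R U + fX) \<le> tau k" "norm ((lam k * \<mu>2) *\<^sub>R u + fs) \<le> tau k"
    "norm (y - closest_point Q (y - (1 / L_const) *\<^sub>R fy)) \<le> xi k"
proof -
  interpret composite_minimization "p_part k" "f_part k \<theta>1 \<theta>2" "grad k \<theta>1 \<theta>2" "apg_domain k \<theta>1 \<theta>2" L_const
    by (rule composite_minimization[OF assms(1)])
  obtain U u where U: "U \<in> subdifferential (sv_norm \<alpha>) X" "u \<in> subdifferential (vec_norm \<beta>) s"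
    and le: "sqrt ((norm ((lam k * \<mu>1) *\<^sub>R U + fX))\<^sup>2 + (norm ((lam k * \<mu>2) *\<^sub>R u + fs))\<^sup>2) \<le> tau k"
    and y: "norm (y - closest_point Q (y - (1 / L_const) *\<^sub>R fy)) \<le> xi k"
    using assms(2) unfolding grad_stop_def by (auto simp: gradient_f assms(3))
  note le1 = order.trans[OF real_sqrt_sum_squares_ge1 le] order.trans[OF real_sqrt_sum_squares_ge2 le]
  show ?thesis using that[OF U _ _ y] le1 by simp
qed

lemma p_part_perturb:
  assumes "1 \<le> k"
  shows "p_part k (z + (X, s, y)) \<le> p_part k z + lam k * (\<mu>1 * K1 * norm X + \<mu>2 * K2 * norm s)"
proof -
  obtain X' s' y' where z: "z = (X', s', y')" by (rule prod_cases3)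
  have "lam k * (\<mu>1 * sv_norm \<alpha> (X' + X) + \<mu>2 * vec_norm \<beta> (s' + s)) \<le>
      lam k * (\<mu>1 * (sv_norm \<alpha> X' + K1 * norm X) + \<mu>2 * (vec_norm \<beta> s' + K2 * norm s))"
    using lam_pos[OF assms] mu1 mu2 sv.perturb[of "X' + X" X'] vn.perturb[of "s' + s" s']
    by (intro mult_left_mono add_mono) auto
  then show ?thesis by (simp add: p_part_def z algebra_simps)
qed

text \<open>At a near-minimizer, a step of length \<open>sqrt (eps k)\<close> against the gradient of the smooth part
  cannot gain more than \<open>eps k\<close>.\<close>

lemma near_minimizer_gradient:
  assumes k: "1 \<le> k" and nm: "near_minimizer k \<theta>1 \<theta>2 (X, s, y)" and y: "y \<in> Q"
    and g: "grad k \<theta>1 \<theta>2 (X, s, y) = (fX, fs, fy)"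
  shows "norm (fX, fs) \<le> lam k * (\<mu>1 * K1 + \<mu>2 * K2) + (L_const / 2 + 1) * sqrt (eps k)"
proof (cases "(fX, fs) = 0")
  case True
  then show ?thesis using lam_pos[OF k] mu1 mu2 sv.K_nonneg vn.K_nonneg L_pos eps_pos[OF k]
    by (simp add: True)
next
  case False
  define r where "r = norm (fX, fs)"
  have r: "0 < r" using False by (simp add: r_def)
  \<comment> \<open>A step of length \<open>t\<close> bounds the gradient by a multiple of
    \<open>lam k\<close> plus \<open>L_const / 2 * t + eps k / t\<close>; this \<open>t\<close>
    gives both terms the order sqrt (eps k).\<close>
  define t where "t = sqrt (eps k)"
  have t: "0 < t" "eps k = t * t" using eps_pos[OF k] by (simp_all add: t_def)
  \<comment> \<open>The component \<open>y\<close> stays fixed, so the moved point remains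
    admissible.\<close>
  let ?h = "(- (t / r) *\<^sub>R fX, - (t / r) *\<^sub>R fs, 0 :: real ^ 'q)"
  have nh: "norm ?h = t"
  proof -
    have "?h = - (t / r) *\<^sub>R (fX, fs, 0)" by simp
    then have "norm ?h = t / r * norm (fX, fs, 0 :: real ^ 'q)"
      using r t by (simp only: norm_scaleR) simp
    also have "norm (fX, fs, 0 :: real ^ 'q) = r" by (simp add: r_def norm_Pair)
    finally show ?thesis using r by simp
  qed
  have "norm (- (t / r) *\<^sub>R fX) \<le> norm ?h" by (rule norm_fst_le)
  moreover have "norm (- (t / r) *\<^sub>R fs) \<le> norm ?h" by (rule order.trans[OF norm_fst_le norm_snd_le])
  ultimately have "\<mu>1 * K1 * norm (- (t / r) *\<^sub>R fX) + \<mu>2 * K2 * norm (- (t / r) *\<^sub>R fs) \<le> \<mu>1 * K1 * t + \<mu>2 * K2 * t"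
    unfolding nh using mu1 mu2 sv.K_nonneg vn.K_nonneg by (intro add_mono mult_left_mono) auto
  then have "lam k * (\<mu>1 * K1 * norm (- (t / r) *\<^sub>R fX) + \<mu>2 * K2 * norm (- (t / r) *\<^sub>R fs))
      \<le> lam k * (\<mu>1 * K1 * t + \<mu>2 * K2 * t)"
    using lam_pos[OF k] by (intro mult_left_mono) auto
  then have p: "p_part k ((X, s, y) + ?h) \<le> p_part k (X, s, y) + lam k * (\<mu>1 * K1 * t + \<mu>2 * K2 * t)"
    using p_part_perturb[OF k, of "(X, s, y)" "- (t / r) *\<^sub>R fX" "- (t / r) *\<^sub>R fs" 0] by linarith
  have "(fX, fs, fy) \<bullet> ?h = - (t / r) * (norm (fX, fs))\<^sup>2"
    by (simp add: power2_norm_eq_inner algebra_simps)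
  then have gh: "(fX, fs, fy) \<bullet> ?h = - t * r"
    using r by (simp add: r_def[symmetric] power2_eq_square)
  have f: "f_part k \<theta>1 \<theta>2 ((X, s, y) + ?h) \<le> f_part k \<theta>1 \<theta>2 (X, s, y) - t * r + L_const / 2 * t\<^sup>2"
    using f_part_smooth[of k \<theta>1 \<theta>2 "(X, s, y) + ?h" "(X, s, y)"] gh nh unfolding add_diff_cancel_left' g by simp
  have "P k \<theta>1 \<theta>2 (X, s, y) \<le> P k \<theta>1 \<theta>2 ((X, s, y) + ?h) + eps k"
    using nm y by (simp add: near_minimizer_def)
  then have "t * r \<le> lam k * (\<mu>1 * K1 * t + \<mu>2 * K2 * t) + L_const / 2 * t\<^sup>2 + eps k"
    using p f unfolding P_def by linarith
  then have "t * r \<le> t * (lam k * (\<mu>1 * K1 + \<mu>2 * K2) + (L_const / 2 + 1) * t)"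
    by (simp add: t(2) power2_eq_square algebra_simps)
  then show ?thesis using t by (simp add: r_def t_def[symmetric])
qed

text \<open>If the gradient test holds, removing the subgradients costs at most \<open>lam k\<close>
  times their Lipschitz bounds; otherwise the estimate for near-minimizers applies. \<open>E\<close>
  adds up both cases.\<close>

lemma gradient_bound:
  assumes k: "1 \<le> k" and "0 \<le> tau k" and y: "y \<in> Q"
    and stop: "near_minimizer k \<theta>1 \<theta>2 (X, s, y) \<or> grad_stop k \<theta>1 \<theta>2 (X, s, y)"
    and g: "grad k \<theta>1 \<theta>2 (X, s, y) = (fX, fs, fy)"
  defines "E \<equiv> lam k * (\<mu>1 * K1 + \<mu>2 * K2) + (L_const / 2 + 1) * sqrt (eps k) + tau k"
  shows "norm fX \<le> E" "norm fs \<le> E"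
proof -
  have nn: "0 \<le> lam k * (\<mu>1 * K1)" "0 \<le> lam k * (\<mu>2 * K2)" "0 \<le> (L_const / 2 + 1) * sqrt (eps k)"
    using lam_pos[OF k] mu1 mu2 sv.K_nonneg vn.K_nonneg L_pos eps_pos[OF k] by simp_all
  have "norm fX \<le> E \<and> norm fs \<le> E"
    using stop
  proof
    assume "near_minimizer k \<theta>1 \<theta>2 (X, s, y)"
    from near_minimizer_gradient[OF k this y g] assms(2) have "norm (fX, fs) \<le> E" by (simp add: E_def)
    then show ?thesis by (meson norm_fst_le norm_snd_le order.trans)
  next
    assume "grad_stop k \<theta>1 \<theta>2 (X, s, y)"
    from grad_stopE[OF k this g] obtain U u where U: "U \<in> subdifferential (sv_norm \<alpha>) X"
      "u \<in> subdifferential (vec_norm \<beta>) s" and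
      le: "norm ((lam k * \<mu>1) *\<^sub>R U + fX) \<le> tau k" "norm ((lam k * \<mu>2) *\<^sub>R u + fs) \<le> tau k"
      by blast
    have "norm ((lam k * \<mu>1) *\<^sub>R U) \<le> lam k * \<mu>1 * K1" "norm ((lam k * \<mu>2) *\<^sub>R u) \<le> lam k * \<mu>2 * K2"
      using sv.subgradient_bound[OF U(1)] vn.subgradient_bound[OF U(2)] lam_pos[OF k] mu1 mu2
      by simp_all
    then show ?thesis
      using norm_triangle_ineq4[of "(lam k * \<mu>1) *\<^sub>R U + fX" "(lam k * \<mu>1) *\<^sub>R U"]
        norm_triangle_ineq4[of "(lam k * \<mu>2) *\<^sub>R u + fs" "(lam k * \<mu>2) *\<^sub>R u"] le nn
      by (simp add: E_def algebra_simps)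
  qed
  then show "norm fX \<le> E" "norm fs \<le> E" by simp_all
qed

text \<open>By convexity the gap is at most minus a subgradient paired with the displacement. In
  \<open>X\<close> and \<open>s\<close> the test bounds the subgradient; in \<open>y\<close> it
  bounds a projection residual, which the variational inequality of the projection converts.\<close>

lemma grad_stop_suboptimality:
  assumes k: "1 \<le> k" and gs: "grad_stop k \<theta>1 \<theta>2 (X, s, y)"
    and g: "grad k \<theta>1 \<theta>2 (X, s, y) = (fX, fs, fy)" and y': "y' \<in> Q"
  shows "P k \<theta>1 \<theta>2 (X, s, y) \<le> P k \<theta>1 \<theta>2 (X', s', y') + tau k * (norm (X' - X) + norm (s' - s))
     + xi k * (norm fy + L_const * (norm (y' - y) + xi k))"
proof -
  from grad_stopE[OF k gs g] obtain U u where U: "U \<in> subdifferential (sv_norm \<alpha>) X"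
    "u \<in> subdifferential (vec_norm \<beta>) s" and
    le: "norm ((lam k * \<mu>1) *\<^sub>R U + fX) \<le> tau k" "norm ((lam k * \<mu>2) *\<^sub>R u + fs) \<le> tau k"
    and r: "norm (y - closest_point Q (y - (1 / L_const) *\<^sub>R fy)) \<le> xi k"
    by blast
  have tau: "- (tau k * norm h) \<le> v \<bullet> h" if "norm v \<le> tau k" for v h :: "'z::real_inner"
    using Cauchy_Schwarz_ineq2[of v h] mult_right_mono[OF that, of "norm h"] by simp
  have "lam k * (\<mu>1 * (sv_norm \<alpha> X + U \<bullet> (X' - X)) + \<mu>2 * (vec_norm \<beta> s + u \<bullet> (s' - s)))
      \<le> lam k * (\<mu>1 * sv_norm \<alpha> X' + \<mu>2 * vec_norm \<beta> s')"
    using U lam_pos[OF k] mu1 mu2 unfolding subdifferential_def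
    by (intro mult_left_mono add_mono) auto
  moreover have "f_part k \<theta>1 \<theta>2 (X, s, y) + (fX \<bullet> (X' - X) + (fs \<bullet> (s' - s) + fy \<bullet> (y' - y)))
      \<le> f_part k \<theta>1 \<theta>2 (X', s', y')"
    using f_part_convex[of k \<theta>1 \<theta>2 "(X, s, y)" "(X', s', y')"] unfolding g by simp
  ultimately have "P k \<theta>1 \<theta>2 (X, s, y) + ((lam k * \<mu>1) *\<^sub>R U + fX) \<bullet> (X' - X) +
      ((lam k * \<mu>2) *\<^sub>R u + fs) \<bullet> (s' - s) + fy \<bullet> (y' - y) \<le> P k \<theta>1 \<theta>2 (X', s', y')"
    unfolding P_def p_part_def by (simp add: inner_add_left algebra_simps)
  moreover have "- (tau k * norm (X' - X)) \<le> ((lam k * \<mu>1) *\<^sub>R U + fX) \<bullet> (X' - X)"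
    "- (tau k * norm (s' - s)) \<le> ((lam k * \<mu>2) *\<^sub>R u + fs) \<bullet> (s' - s)"
    by (intro tau le)+
  moreover have "- (xi k * (norm fy + L_const * (norm (y' - y) + xi k))) \<le> fy \<bullet> (y' - y)"
  proof -
    define yp where "yp = closest_point Q (y - (1 / L_const) *\<^sub>R fy)"
    have r: "norm (y - yp) \<le> xi k" using r by (simp add: yp_def)
    then have xi: "0 \<le> xi k" using norm_ge_zero order.trans by blast
    \<comment> \<open>The obtuse angle criterion at the projected point \<open>yp\<close>. Passing
      from \<open>yp\<close> back to \<open>y\<close> costs at most \<open>xi k\<close> in each
      factor.\<close>
    have "(y - (1 / L_const) *\<^sub>R fy - yp) \<bullet> (y' - yp) \<le> 0"
      unfolding yp_def by (rule closest_point_dot[OF convex_Q closed_Q y'])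
    then have "(y - yp) \<bullet> (y' - yp) \<le> fy \<bullet> (y' - yp) / L_const"
      by (simp add: inner_diff_left diff_divide_distrib algebra_simps)
    then have 1: "L_const * ((y - yp) \<bullet> (y' - yp)) \<le> fy \<bullet> (y' - yp)"
      using L_pos by (simp add: field_simps)
    have "norm (y' - yp) \<le> norm (y' - y) + xi k"
      using norm_triangle_ineq[of "y' - y" "y - yp"] r by simp
    then have "norm (y - yp) * norm (y' - yp) \<le> xi k * (norm (y' - y) + xi k)"
      using r xi by (intro mult_mono) auto
    then have "- (xi k * (norm (y' - y) + xi k)) \<le> (y - yp) \<bullet> (y' - yp)"
      using Cauchy_Schwarz_ineq2[of "y - yp" "y' - yp"] by linarith
    then have "L_const * - (xi k * (norm (y' - y) + xi k)) \<le> L_const * ((y - yp) \<bullet> (y' - yp))"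
      using L_pos by (intro mult_left_mono) auto
    with 1 have 2: "- (xi k * (L_const * (norm (y' - y) + xi k))) \<le> fy \<bullet> (y' - yp)"
      by (simp add: mult.left_commute)
    have "norm fy * norm (yp - y) \<le> norm fy * xi k"
      using r by (intro mult_left_mono) (auto simp: norm_minus_commute)
    then have "- (norm fy * xi k) \<le> fy \<bullet> (yp - y)"
      using Cauchy_Schwarz_ineq2[of fy "yp - y"] by linarith
    moreover have "fy \<bullet> (y' - y) = fy \<bullet> (y' - yp) + fy \<bullet> (yp - y)" by (simp add: inner_diff_right)
    ultimately show ?thesis using 2 by (simp add: algebra_simps)
  qed
  ultimately show ?thesis by (simp add: algebra_simps)
qed

end

section \<open>The outer iteration\<close>

text \<open>The ratio \<open>e0\<close> of \<open>eps k\<close> to \<open>(lam k)\<^sup>2\<close> is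
  constant because both are multiplied by \<nu>^2 in every iteration.\<close>

locale falc_geometric = falc_assms \<alpha> \<beta> \<mu>1 \<mu>2 \<A> \<C> b d Q X0 lam eps tau xi
  for \<alpha> \<beta> :: ell
    and \<mu>1 \<mu>2 :: real
    and \<A> :: "real ^ 'n ^ 'm \<Rightarrow> real ^ 'q"
    and \<C> :: "real ^ 'n ^ 'm \<Rightarrow> real ^ 'p"
    and b :: "real ^ 'q"
    and d :: "real ^ 'p"
    and Q :: "(real ^ 'q) set"
    and X0 :: "real ^ 'n ^ 'm"
    and lam eps tau xi :: "nat \<Rightarrow> real" +
  fixes \<nu> e0 \<kappa>1 \<kappa>2 :: real
  assumes nu: "0 < \<nu>" "\<nu> < 1" and e0: "0 < e0" and kappa: "0 \<le> \<kappa>1" "0 \<le> \<kappa>2"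
    and lam_Suc: "1 \<le> k \<Longrightarrow> lam (Suc k) = \<nu> * lam k"
    and eps_eq: "1 \<le> k \<Longrightarrow> eps k = e0 * (lam k)\<^sup>2"
    and tau_eq: "1 \<le> k \<Longrightarrow> tau k = \<kappa>1 * eps k"
    and xi_eq: "1 \<le> k \<Longrightarrow> xi k = \<kappa>2 * eps k"
begin

section \<open>Iterates and multipliers along the run\<close>

definition z_iter :: "nat \<Rightarrow> ('n, 'm, 'p, 'q) point" where "z_iter k = fst (falc_state k)"
definition s_iter :: "nat \<Rightarrow> real ^ 'p" where "s_iter k = fst (snd (z_iter k))"
definition y_iter :: "nat \<Rightarrow> real ^ 'q" where "y_iter k = snd (snd (z_iter k))"

text \<open>The multipliers computed in iteration \<open>k\<close>, i.e. \<open>\<theta>\<^sub>1\<^sup>k\<^sup>+\<^sup>1\<close> and \<open>\<theta>\<^sub>2\<^sup>k\<^sup>+\<^sup>1\<close>.\<close>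

definition mult1 :: "nat \<Rightarrow> real ^ 'q" where "mult1 k = fst (snd (falc_state k))"
definition mult2 :: "nat \<Rightarrow> real ^ 'p" where "mult2 k = snd (snd (falc_state k))"

lemma z_iter_eq: "z_iter k = (X_iter k, s_iter k, y_iter k)"
  by (simp add: X_iter_def s_iter_def y_iter_def z_iter_def)

lemma iter_0: "X_iter 0 = X0" "s_iter 0 = \<C> X0 - d" "y_iter 0 = \<A> X0 - b" "mult1 0 = 0" "mult2 0 = 0"
  by (simp_all add: X_iter_def s_iter_def y_iter_def z_iter_def mult1_def mult2_def)

lemma falc_state_eq: "falc_state k = (z_iter k, mult1 k, mult2 k)"
  by (simp add: z_iter_def mult1_def mult2_def)

lemma iter_Suc:
  "z_iter (Suc k) = inner_output (Suc k) (mult1 k) (mult2 k) (z_iter k)"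
  "mult1 (Suc k) = mult1 k - (1 / lam (Suc k)) *\<^sub>R (\<A> (X_iter (Suc k)) - y_iter (Suc k) - b)"
  "mult2 (Suc k) = mult2 k - (1 / lam (Suc k)) *\<^sub>R (\<C> (X_iter (Suc k)) - s_iter (Suc k) - d)"
proof -
  obtain X s y where io: "inner_output (Suc k) (mult1 k) (mult2 k) (z_iter k) = (X, s, y)"
    by (rule prod_cases3)
  have st: "falc_state (Suc k) = ((X, s, y), mult1 k - (1 / lam (Suc k)) *\<^sub>R (\<A> X - y - b),
      mult2 k - (1 / lam (Suc k)) *\<^sub>R (\<C> X - s - d))"
    by (simp add: falc_state_eq[of k] io)
  show "z_iter (Suc k) = inner_output (Suc k) (mult1 k) (mult2 k) (z_iter k)"
    unfolding io z_iter_def[of "Suc k"] st by simp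
  show "mult1 (Suc k) = mult1 k - (1 / lam (Suc k)) *\<^sub>R (\<A> (X_iter (Suc k)) - y_iter (Suc k) - b)"
    "mult2 (Suc k) = mult2 k - (1 / lam (Suc k)) *\<^sub>R (\<C> (X_iter (Suc k)) - s_iter (Suc k) - d)"
    unfolding X_iter_def s_iter_def y_iter_def z_iter_def[of "Suc k"] mult1_def[of "Suc k"] mult2_def[of "Suc k"] st
    by simp_all
qed

lemma lam_Suc_pos: "0 < lam (Suc k)"
  by (rule lam_pos) simp

lemma residual_A: "\<A> (X_iter (Suc k)) - y_iter (Suc k) - b = lam (Suc k) *\<^sub>R (mult1 k - mult1 (Suc k))"
  and residual_C: "\<C> (X_iter (Suc k)) - s_iter (Suc k) - d = lam (Suc k) *\<^sub>R (mult2 k - mult2 (Suc k))"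
  using lam_Suc_pos[of k] by (simp_all add: iter_Suc(2,3))

text \<open>The plain residual is \<open>lam\<close> times old minus new multiplier, and the shift
  in the subproblem removes the old one.\<close>

lemma resA_iter: "resA (Suc k) (mult1 k) (z_iter (Suc k)) = - (lam (Suc k) *\<^sub>R mult1 (Suc k))"
  and resC_iter: "resC (Suc k) (mult2 k) (z_iter (Suc k)) = - (lam (Suc k) *\<^sub>R mult2 (Suc k))"
  by (simp_all add: z_iter_eq resA_def resC_def residual_A residual_C scaleR_diff_right)

lemma y_iter_in: "y_iter k \<in> Q"
proof (induction k)
  case 0
  then show ?case by (simp add: iter_0 X0_feasible)
next
  case (Suc k)
  then show ?case
    using inner_output_in[of "Suc k" "mult1 k" "mult2 k" "z_iter k"] iter_Suc(1)[of k]
    by (auto simp: y_iter_def apg_domain_def)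
qed

lemma iter_stop: "near_minimizer (Suc k) (mult1 k) (mult2 k) (z_iter (Suc k)) \<or>
    grad_stop (Suc k) (mult1 k) (mult2 k) (z_iter (Suc k))"
  unfolding iter_Suc(1) by (rule inner_output_stop) simp

lemma lam_le_1: "lam (Suc k) \<le> lam 1"
proof (induction k)
  case (Suc k)
  have "lam (Suc (Suc k)) \<le> 1 * lam (Suc k)"
    unfolding lam_Suc[of "Suc k", simplified] using nu lam_Suc_pos[of k] by (intro mult_right_mono) auto
  then show ?case using Suc by simp
qed simp

lemma lam_power: "lam (Suc k) = lam 1 * \<nu> ^ k"
  by (induction k) (simp_all add: lam_Suc)

lemma lam_1_pos: "0 < lam 1"
  using lam_Suc_pos[of 0] by simp

section \<open>Uniform bounds on multipliers and iterates\<close>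

lemma right_inverse:
  obtains R KR where "\<And>r. \<A> (R r) = r" "\<And>r. norm (R r) \<le> KR * norm r" "0 < KR"
proof -
  obtain R where R: "linear R" "\<A> \<circ> R = id"
    using linear_surjective_right_inverse[OF linear_A surj_A] by blast
  obtain KR where KR: "0 < KR" "\<And>r. norm (R r) \<le> KR * norm r"
    using linear_bounded_pos[OF R(1)] by blast
  have "\<A> (R r) = r" for r using fun_cong[OF R(2), of r] by simp
  then show ?thesis using KR that by blast
qed

text \<open>There is no induction: the bound for the multipliers of iteration \<open>k\<close> comes
  from the stopping test of that iteration alone. The \<open>s\<close>-component of the gradient is
  \<open>lam k\<close> times \<open>mult2 k\<close> and bounds it directly.\<close>

lemma multipliers_bounded:
  obtains B where "0 \<le> B" "\<And>k. norm (mult1 k) \<le> B" "\<And>k. norm (mult2 k) \<le> B"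
proof -
  obtain R KR where R: "\<And>r. \<A> (R r) = r" "\<And>r. norm (R r) \<le> KR * norm r" "0 < KR"
    using right_inverse by blast
  define D where "D = \<mu>1 * K1 + \<mu>2 * K2 + (L_const / 2 + 1) * sqrt e0 + \<kappa>1 * e0 * lam 1"
  have D: "0 \<le> D" unfolding D_def
    using mu1 mu2 sv.K_nonneg vn.K_nonneg L_pos e0 kappa lam_1_pos by simp
  define B where "B = D + KR * D * (1 + SC)"
  have B: "0 \<le> B" "D \<le> B" "KR * D * (1 + SC) \<le> B" using D R(3) SC_nonneg by (simp_all add: B_def)
  have "norm (mult1 k) \<le> B \<and> norm (mult2 k) \<le> B" for k
  proof (cases k)
    case 0
    then show ?thesis using B by (simp add: iter_0)
  next
    case (Suc j)
    let ?l = "lam k" and ?G = "adjoint \<A> (mult1 k) + adjoint \<C> (mult2 k)"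
    have l: "0 < ?l" "1 \<le> k" "?l \<le> lam 1" using lam_Suc_pos[of j] lam_le_1[of j] by (simp_all add: Suc)
    have g: "grad k (mult1 j) (mult2 j) (X_iter k, s_iter k, y_iter k) =
        (- (?l *\<^sub>R ?G), ?l *\<^sub>R mult2 k, ?l *\<^sub>R mult1 k)"
      unfolding z_iter_eq[symmetric] grad_def Suc resA_iter resC_iter
      by (simp add: linear_neg[OF adjoint_linear] linear_cmul[OF adjoint_linear] linear_A linear_C scaleR_add_right)
    have "sqrt (eps k) = sqrt e0 * ?l" using l by (simp add: eps_eq real_sqrt_mult)
    moreover have "tau k \<le> ?l * (\<kappa>1 * e0 * lam 1)"
    proof -
      have "\<kappa>1 * e0 * ?l * ?l \<le> \<kappa>1 * e0 * ?l * lam 1"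
        using l kappa e0 by (intro mult_left_mono) auto
      then show ?thesis unfolding tau_eq[OF l(2)] eps_eq[OF l(2)] by (simp add: power2_eq_square mult_ac)
    qed
    ultimately have E: "?l * (\<mu>1 * K1 + \<mu>2 * K2) + (L_const / 2 + 1) * sqrt (eps k) + tau k \<le> ?l * D"
      by (simp add: D_def algebra_simps)
    have "0 \<le> tau k" using kappa l eps_pos[OF l(2)] by (simp add: tau_eq)
    from gradient_bound[OF l(2) this y_iter_in _ g] iter_stop[of j] E
    have "norm (- (?l *\<^sub>R ?G)) \<le> ?l * D" "norm (?l *\<^sub>R mult2 k) \<le> ?l * D"
      unfolding z_iter_eq Suc by (meson order.trans)+
    then have G: "norm ?G \<le> D" and m2: "norm (mult2 k) \<le> D" using l by simp_all
    \<comment> \<open>Isolates \<open>mult1 k\<close> from \<open>?G\<close>: pairing with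
      \<open>R (mult1 k)\<close> turns the adjoint of \<A> into the squared norm, and the bound on
      \<open>mult2 k\<close> controls the other term.\<close>
    have "(norm (mult1 k))\<^sup>2 = mult1 k \<bullet> \<A> (R (mult1 k))" by (simp add: R power2_norm_eq_inner)
    also have "\<dots> = ?G \<bullet> R (mult1 k) - mult2 k \<bullet> \<C> (R (mult1 k))"
      using adjoint_works[OF linear_A, of "R (mult1 k)" "mult1 k"]
        adjoint_works[OF linear_C, of "R (mult1 k)" "mult2 k"]
      by (simp add: inner_add_left inner_add_right inner_commute)
    also have "\<dots> \<le> norm ?G * norm (R (mult1 k)) + norm (mult2 k) * norm (\<C> (R (mult1 k)))"
      using Cauchy_Schwarz_ineq2[of ?G "R (mult1 k)"] Cauchy_Schwarz_ineq2[of "mult2 k" "\<C> (R (mult1 k))"]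
      by linarith
    also have "\<dots> \<le> D * norm (R (mult1 k)) + D * (SC * norm (R (mult1 k)))"
      using G m2 D norm_C_le by (intro add_mono mult_mono) auto
    also have "\<dots> = D * (1 + SC) * norm (R (mult1 k))" by (simp add: algebra_simps)
    also have "\<dots> \<le> D * (1 + SC) * (KR * norm (mult1 k))"
      using R(2) D SC_nonneg by (intro mult_left_mono) auto
    finally have "norm (mult1 k) * norm (mult1 k) \<le> (KR * D * (1 + SC)) * norm (mult1 k)"
      by (simp add: power2_eq_square mult_ac)
    then have "norm (mult1 k) \<le> KR * D * (1 + SC)"
      using R(3) D SC_nonneg by (cases "mult1 k = 0") (simp_all add: mult_le_cancel_right)
    then show ?thesis using m2 B by linarith
  qed
  then show ?thesis using that B by blast
qed

lemma eta_nonneg: "0 \<le> eta"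
  using mu1 mu2 sv.nonneg vn.nonneg by (simp add: eta_def)

lemma eta1_le:
  assumes "norm \<theta>1 \<le> B" "norm \<theta>2 \<le> B"
  shows "eta1 (Suc k) \<theta>1 \<theta>2 \<le> eta + lam 1 * B\<^sup>2"
proof -
  have "(norm \<theta>1)\<^sup>2 \<le> B\<^sup>2" "(norm \<theta>2)\<^sup>2 \<le> B\<^sup>2" using assms by (auto intro: power_mono)
  then have "lam (Suc k) / 2 * ((norm \<theta>1)\<^sup>2 + (norm \<theta>2)\<^sup>2) \<le> lam 1 / 2 * (B\<^sup>2 + B\<^sup>2)"
    using lam_le_1[of k] lam_Suc_pos[of k] by (intro mult_mono add_mono) auto
  then show ?thesis by (simp add: eta1_def)
qed

text \<open>Bounded multipliers bound every \<open>eta1\<close>. Induction is needed because after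
  zero inner steps the bound is inherited from the previous iterate.\<close>

lemma iterates_bounded:
  obtains M where "0 \<le> M" "\<And>k. norm (X_iter k) \<le> M" "\<And>k. norm (s_iter k) \<le> M" "\<And>k. norm (y_iter k) \<le> M"
proof -
  obtain B where B: "0 \<le> B" "\<And>k. norm (mult1 k) \<le> B" "\<And>k. norm (mult2 k) \<le> B"
    using multipliers_bounded by blast
  define H where "H = eta + lam 1 * B\<^sup>2"
  have H: "eta \<le> H" "0 \<le> H" using lam_1_pos eta_nonneg by (simp_all add: H_def)
  have inv: "\<mu>1 * sv_norm \<alpha> (X_iter k) \<le> H \<and> \<mu>2 * vec_norm \<beta> (s_iter k) \<le> H" for k
  proof (induction k)
    case 0
    have "0 \<le> \<mu>1 * sv_norm \<alpha> X0" "0 \<le> \<mu>2 * vec_norm \<beta> (\<C> X0 - d)"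
      using mu1 mu2 sv.nonneg vn.nonneg by simp_all
    then show ?case using H by (simp add: iter_0 eta_def)
  next
    case (Suc k)
    have "z_iter (Suc k) \<in> apg_domain (Suc k) (mult1 k) (mult2 k) \<or> z_iter (Suc k) = z_iter k"
      unfolding iter_Suc(1) by (rule inner_output_in) simp
    then show ?case
      using eta1_le[OF B(2,3), of k k k] Suc by (auto simp: z_iter_eq apg_domain_def H_def)
  qed
  define M where "M = I_const / \<mu>1 * H + J_const / \<mu>2 * H + SA * (I_const / \<mu>1 * H) + norm b + 2 * lam 1 * B"
  have nn: "0 \<le> I_const / \<mu>1 * H" "0 \<le> J_const / \<mu>2 * H" "0 \<le> SA * (I_const / \<mu>1 * H)" "0 \<le> 2 * lam 1 * B"
    using sv.c_pos vn.c_pos mu1 mu2 H SA_nonneg B lam_1_pos by simp_all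
  have X: "norm (X_iter k) \<le> I_const / \<mu>1 * H" for k
    using sv.lower[of "X_iter k"] mult_left_mono[OF conjunct1[OF inv[of k]], of "I_const / \<mu>1"]
      sv.c_pos mu1 by simp
  have s: "norm (s_iter k) \<le> J_const / \<mu>2 * H" for k
    using vn.lower[of "s_iter k"] mult_left_mono[OF conjunct2[OF inv[of k]], of "J_const / \<mu>2"]
      vn.c_pos mu2 by simp
  \<comment> \<open>\<open>apg_domain\<close> restricts \<open>y\<close> only through
    \<open>Q\<close>, which may be unbounded; its size is read off from the residual
    instead.\<close>
  have y: "norm (y_iter k) \<le> SA * (I_const / \<mu>1 * H) + norm b + 2 * lam 1 * B" for k
  proof -
    have AX: "norm (\<A> (X_iter k)) \<le> SA * (I_const / \<mu>1 * H)"
      using norm_A_le[of "X_iter k"] mult_left_mono[OF X[of k] SA_nonneg] by linarith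
    have "norm (\<A> (X_iter k) - b - y_iter k) \<le> 2 * lam 1 * B"
    proof (cases k)
      case 0
      then show ?thesis using nn by (simp add: iter_0)
    next
      case (Suc j)
      have "norm (\<A> (X_iter k) - y_iter k - b) = lam k * norm (mult1 j - mult1 k)"
        using lam_Suc_pos[of j] by (simp add: Suc residual_A)
      also have "\<dots> \<le> lam 1 * (B + B)"
        using lam_le_1[of j] lam_Suc_pos[of j] norm_triangle_ineq4[of "mult1 j" "mult1 k"] B(2)[of j] B(2)[of k]
        by (intro mult_mono) (auto simp: Suc)
      finally show ?thesis by (simp add: algebra_simps)
    qed
    then show ?thesis
      using norm_triangle_ineq4[of "\<A> (X_iter k)" b] norm_triangle_sub[of "y_iter k" "\<A> (X_iter k) - b"] AX
      by (simp add: norm_minus_commute)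
  qed
  show ?thesis
  proof (rule that)
    show "0 \<le> M" using nn by (simp add: M_def)
    show "norm (X_iter k) \<le> M" "norm (s_iter k) \<le> M" "norm (y_iter k) \<le> M" for k
      using X[of k] s[of k] y[of k] nn norm_ge_zero[of b] unfolding M_def by linarith+
  qed
qed

text \<open>Competitors with \<open>objective X\<close> at most \<open>eta\<close> lie in a fixed
  ball, so the tolerances of the gradient test, of order \<open>(lam k)\<^sup>2\<close>, meet
  bounded distances. A near-minimizer contributes \<open>eps k\<close> directly.\<close>

lemma suboptimality:
  obtains \<Delta> where "0 \<le> \<Delta>" "\<And>k X. \<A> X - b \<in> Q \<Longrightarrow> objective X \<le> eta \<Longrightarrow>
    P (Suc k) (mult1 k) (mult2 k) (z_iter (Suc k)) \<le>
      P (Suc k) (mult1 k) (mult2 k) (X, \<C> X - d, \<A> X - b) + \<Delta> * (lam (Suc k))\<^sup>2"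
proof -
  obtain B where B: "0 \<le> B" "\<And>k. norm (mult1 k) \<le> B" "\<And>k. norm (mult2 k) \<le> B"
    using multipliers_bounded by blast
  obtain M where M: "0 \<le> M" "\<And>k. norm (X_iter k) \<le> M" "\<And>k. norm (s_iter k) \<le> M" "\<And>k. norm (y_iter k) \<le> M"
    using iterates_bounded by blast
  define m where "m = I_const / \<mu>1 * eta"
  have m: "0 \<le> m" using sv.c_pos mu1 eta_nonneg by (simp add: m_def)
  \<comment> \<open>A common bound for the displacements from an iterate to a competitor in all
    three components.\<close>
  define W where "W = m + SC * m + SA * m + norm d + norm b + M"
  have Wnn: "0 \<le> SC * m" "0 \<le> SA * m" using m SC_nonneg SA_nonneg by simp_all
  have W0: "0 \<le> W" using Wnn m M(1) by (simp add: W_def)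
  define \<Delta> where "\<Delta> = e0 + \<kappa>1 * e0 * (2 * W) + \<kappa>2 * e0 * (lam 1 * B + L_const * (W + \<kappa>2 * e0 * (lam 1)\<^sup>2))"
  have nn: "0 \<le> e0" "0 \<le> \<kappa>1 * e0 * (2 * W)"
      "0 \<le> \<kappa>2 * e0 * (lam 1 * B + L_const * (W + \<kappa>2 * e0 * (lam 1)\<^sup>2))"
    using e0 kappa W0 lam_1_pos B(1) L_pos by simp_all
  have "P (Suc k) (mult1 k) (mult2 k) (z_iter (Suc k)) \<le>
      P (Suc k) (mult1 k) (mult2 k) (X, \<C> X - d, \<A> X - b) + \<Delta> * (lam (Suc k))\<^sup>2"
    if X: "\<A> X - b \<in> Q" "objective X \<le> eta" for k X
  proof -
    let ?l = "lam (Suc k)" and ?z = "z_iter (Suc k)"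
    note l = lam_Suc_pos[of k] lam_le_1[of k]
    have l2: "?l\<^sup>2 \<le> (lam 1)\<^sup>2" using l by (intro power_mono) auto
    show ?thesis using iter_stop[of k]
    proof
      assume "near_minimizer (Suc k) (mult1 k) (mult2 k) ?z"
      then have "P (Suc k) (mult1 k) (mult2 k) ?z \<le>
          P (Suc k) (mult1 k) (mult2 k) (X, \<C> X - d, \<A> X - b) + eps (Suc k)"
        using X by (simp add: near_minimizer_def)
      moreover have "eps (Suc k) \<le> \<Delta> * ?l\<^sup>2"
        unfolding eps_eq[of "Suc k", simplified] using nn by (intro mult_right_mono) (auto simp: \<Delta>_def)
      ultimately show ?thesis by linarith
    next
      assume "grad_stop (Suc k) (mult1 k) (mult2 k) ?z"
      then have gs: "grad_stop (Suc k) (mult1 k) (mult2 k) (X_iter (Suc k), s_iter (Suc k), y_iter (Suc k))"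
        by (simp add: z_iter_eq)
      obtain fX fs where g: "grad (Suc k) (mult1 k) (mult2 k) (X_iter (Suc k), s_iter (Suc k), y_iter (Suc k)) =
          (fX, fs, ?l *\<^sub>R mult1 (Suc k))"
        unfolding z_iter_eq[symmetric] grad_def resA_iter by simp
      have "\<mu>1 * sv_norm \<alpha> X \<le> eta"
        using X(2) mu2 vn.nonneg[of "\<C> X - d"] by (smt (verit) objective_def mult_nonneg_nonneg)
      then have nX: "norm X \<le> m"
        using sv.lower[of X] mult_left_mono[of "\<mu>1 * sv_norm \<alpha> X" eta "I_const / \<mu>1"] sv.c_pos mu1
        by (simp add: m_def)
      have ns: "norm (\<C> X - d) \<le> SC * m + norm d"
        using norm_triangle_ineq4[of "\<C> X" d] norm_C_le[of X] mult_left_mono[OF nX SC_nonneg] by linarith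
      have ny: "norm (\<A> X - b) \<le> SA * m + norm b"
        using norm_triangle_ineq4[of "\<A> X" b] norm_A_le[of X] mult_left_mono[OF nX SA_nonneg] by linarith
      have dX: "norm (X - X_iter (Suc k)) \<le> W" "norm (\<C> X - d - s_iter (Suc k)) \<le> W"
        "norm (\<A> X - b - y_iter (Suc k)) \<le> W"
        using norm_triangle_ineq4[of X "X_iter (Suc k)"] norm_triangle_ineq4[of "\<C> X - d" "s_iter (Suc k)"]
          norm_triangle_ineq4[of "\<A> X - b" "y_iter (Suc k)"] nX ns ny M(2-4)[of "Suc k"] Wnn m
          norm_ge_zero[of b] norm_ge_zero[of d]
        unfolding W_def by linarith+
      have tau: "tau (Suc k) = \<kappa>1 * e0 * ?l\<^sup>2" and xi: "xi (Suc k) = \<kappa>2 * e0 * ?l\<^sup>2"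
        by (simp_all add: tau_eq xi_eq eps_eq)
      have "tau (Suc k) * (norm (X - X_iter (Suc k)) + norm (\<C> X - d - s_iter (Suc k))) \<le>
          \<kappa>1 * e0 * ?l\<^sup>2 * (2 * W)"
        unfolding tau using dX kappa e0 by (intro mult_left_mono) auto
      moreover have "xi (Suc k) * (norm (?l *\<^sub>R mult1 (Suc k)) + L_const * (norm (\<A> X - b - y_iter (Suc k)) + xi (Suc k)))
          \<le> \<kappa>2 * e0 * ?l\<^sup>2 * (lam 1 * B + L_const * (W + \<kappa>2 * e0 * (lam 1)\<^sup>2))"
      proof -
        have "norm (?l *\<^sub>R mult1 (Suc k)) \<le> lam 1 * B"
          using l B(1) B(2)[of "Suc k"] by (simp add: mult_mono)
        moreover have "xi (Suc k) \<le> \<kappa>2 * e0 * (lam 1)\<^sup>2"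
          unfolding xi using l2 kappa e0 by (intro mult_left_mono) auto
        ultimately have "norm (?l *\<^sub>R mult1 (Suc k)) + L_const * (norm (\<A> X - b - y_iter (Suc k)) + xi (Suc k))
            \<le> lam 1 * B + L_const * (W + \<kappa>2 * e0 * (lam 1)\<^sup>2)"
          using dX(3) L_pos by (intro add_mono mult_left_mono) auto
        then show ?thesis unfolding xi using kappa e0 by (intro mult_left_mono) auto
      qed
      moreover have "0 \<le> e0 * ?l\<^sup>2" using e0 by simp
      ultimately show ?thesis
        using grad_stop_suboptimality[OF _ gs g X(1), of X "\<C> X - d"]
        by (simp add: z_iter_eq \<Delta>_def algebra_simps)
    qed
  qed
  moreover have "0 \<le> \<Delta>" using nn by (simp add: \<Delta>_def)
  ultimately show ?thesis using that by blast
qed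

section \<open>Accuracy of the iterates\<close>

lemma objective_nonneg: "0 \<le> objective X"
  using mu1 mu2 sv.nonneg vn.nonneg by (simp add: objective_def)

text \<open>Shifting by a right inverse of \<open>\<A>\<close> turns an iterate into a feasible point; this yields the lower
  bound on its objective value without any duality argument.\<close>

lemma error_bound:
  obtains E where "0 < E" "\<And>k. eps_feasible (E * lam (Suc k)) (X_iter (Suc k))"
    "\<And>k. eps_optimal (E * lam (Suc k)) (X_iter (Suc k))"
proof -
  obtain B where B: "0 \<le> B" "\<And>k. norm (mult1 k) \<le> B" "\<And>k. norm (mult2 k) \<le> B"
    using multipliers_bounded by blast
  obtain R KR where R: "\<And>r. \<A> (R r) = r" "\<And>r. norm (R r) \<le> KR * norm r" "0 < KR"
    using right_inverse by blast
  obtain \<Delta> where D: "0 \<le> \<Delta>" "\<And>k X. \<A> X - b \<in> Q \<Longrightarrow> objective X \<le> eta \<Longrightarrow>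
      P (Suc k) (mult1 k) (mult2 k) (z_iter (Suc k)) \<le>
      P (Suc k) (mult1 k) (mult2 k) (X, \<C> X - d, \<A> X - b) + \<Delta> * (lam (Suc k))\<^sup>2"
    using suboptimality by blast
  \<comment> \<open>In \<open>E1\<close>: the multiplier terms left in the subproblem value at a
    feasible point, the value gap, and the cost of replacing \<open>s\<close> by \<C> X - d.
    \<open>E2\<close> is a Lipschitz constant of the objective times the length of the
    shift.\<close>
  define E1 E2 where "E1 = B\<^sup>2 + \<Delta> + \<mu>2 * K2 * (2 * B)"
    and "E2 = (\<mu>1 * K1 + \<mu>2 * K2 * SC) * (KR * (2 * B))"
  define E where "E = 2 * B + E1 + E2 + 1"
  have nn: "0 \<le> E1" "0 \<le> E2"
    using B(1) D(1) mu1 mu2 sv.K_nonneg vn.K_nonneg SC_nonneg R(3) by (simp_all add: E1_def E2_def)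
  have E: "0 < E" "2 * B \<le> E" "E1 \<le> E" "E2 \<le> E" using nn B(1) by (simp_all add: E_def)
  have main: "eps_feasible (E * lam (Suc k)) (X_iter (Suc k)) \<and> eps_optimal (E * lam (Suc k)) (X_iter (Suc k))" for k
  proof
    let ?l = "lam (Suc k)" and ?X = "X_iter (Suc k)" and ?s = "s_iter (Suc k)" and ?y = "y_iter (Suc k)"
    note l = lam_Suc_pos[of k]
    have rA: "norm (\<A> ?X - ?y - b) \<le> 2 * B * ?l"
      using norm_triangle_ineq4[of "mult1 k" "mult1 (Suc k)"] B(2)[of k] B(2)[of "Suc k"] l
      by (simp add: residual_A mult.commute)
    have rC: "norm (\<C> ?X - ?s - d) \<le> 2 * B * ?l"
      using norm_triangle_ineq4[of "mult2 k" "mult2 (Suc k)"] B(3)[of k] B(3)[of "Suc k"] l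
      by (simp add: residual_C mult.commute)
    have El: "2 * B * ?l \<le> E * ?l" "E1 * ?l \<le> E * ?l" "E2 * ?l \<le> E * ?l"
      using E l by (simp_all add: mult_right_mono)
    show "eps_feasible (E * ?l) ?X"
      using y_iter_in[of "Suc k"] rA El(1) by (auto simp: eps_feasible_def intro!: bexI[of _ ?y])
    have upper_eta: "objective ?X \<le> objective X + E1 * ?l"
      if X: "\<A> X - b \<in> Q" "objective X \<le> eta" for X
    proof -
      have "?l * (\<mu>1 * sv_norm \<alpha> ?X + \<mu>2 * vec_norm \<beta> ?s) \<le> P (Suc k) (mult1 k) (mult2 k) (z_iter (Suc k))"
        by (simp add: P_def z_iter_eq p_part_def f_part_def)
      also have "\<dots> \<le> ?l * objective X + ?l\<^sup>2 / 2 * ((norm (mult1 k))\<^sup>2 + (norm (mult2 k))\<^sup>2) + \<Delta> * ?l\<^sup>2"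
        using D(2)[OF X, of k] by (simp add: P_feasible)
      also have "\<dots> \<le> ?l * objective X + ?l\<^sup>2 / 2 * (B\<^sup>2 + B\<^sup>2) + \<Delta> * ?l\<^sup>2"
        using B D(1) l by (intro add_mono mult_left_mono power_mono) auto
      also have "\<dots> = ?l * (objective X + (B\<^sup>2 + \<Delta>) * ?l)" by (simp add: power2_eq_square algebra_simps)
      finally have 1: "\<mu>1 * sv_norm \<alpha> ?X + \<mu>2 * vec_norm \<beta> ?s \<le> objective X + (B\<^sup>2 + \<Delta>) * ?l"
        using l by simp
      have "vec_norm \<beta> (\<C> ?X - d) \<le> vec_norm \<beta> ?s + K2 * (2 * B * ?l)"
      proof -
        have "K2 * norm (\<C> ?X - d - ?s) \<le> K2 * (2 * B * ?l)"
          using rC vn.K_nonneg by (intro mult_left_mono) (simp_all add: algebra_simps)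
        then show ?thesis using vn.perturb[of "\<C> ?X - d" ?s] by linarith
      qed
      then have "\<mu>2 * vec_norm \<beta> (\<C> ?X - d) \<le> \<mu>2 * (vec_norm \<beta> ?s + K2 * (2 * B * ?l))"
        using mu2 by (intro mult_left_mono) auto
      with 1 show ?thesis by (simp add: objective_def E1_def algebra_simps)
    qed
    \<comment> \<open>A feasible point with objective above \<open>eta\<close> is no better than
      \<open>X0\<close>, whose objective is \<open>eta\<close>.\<close>
    have upper: "objective ?X - E1 * ?l \<le> objective X" if X: "\<A> X - b \<in> Q" for X
    proof (cases "objective X \<le> eta")
      case True
      then show ?thesis using upper_eta[OF X] by simp
    next
      case False
      then show ?thesis using upper_eta[of X0] X0_feasible by (simp add: eta_def objective_def)
    qed
    have 1: "objective ?X - E1 * ?l \<le> opt_value"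
      unfolding opt_value_def using upper X0_feasible by (intro cINF_greatest) auto
    define r where "r = \<A> ?X - ?y - b"
    have Rr: "norm (R r) \<le> KR * (2 * B * ?l)"
      unfolding r_def using order.trans[OF R(2) mult_left_mono[OF rA]] R(3) by simp
    have CRr: "norm (\<C> (R r)) \<le> SC * (KR * (2 * B * ?l))"
      using norm_C_le[of "R r"] mult_left_mono[OF Rr SC_nonneg] by linarith
    have "\<A> (?X - R r) - b = ?y" by (simp add: linear_diff[OF linear_A] R r_def)
    then have "\<A> (?X - R r) - b \<in> Q" using y_iter_in by simp
    moreover have "bdd_below (objective ` {X. \<A> X - b \<in> Q})"
      by (rule bdd_belowI2[of _ 0]) (rule objective_nonneg)
    ultimately have "opt_value \<le> objective (?X - R r)"
      unfolding opt_value_def by (intro cINF_lower) auto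
    also have "\<dots> \<le> objective ?X + E2 * ?l"
    proof -
      have "sv_norm \<alpha> (?X - R r) \<le> sv_norm \<alpha> ?X + K1 * (KR * (2 * B * ?l))"
        using sv.perturb[of "?X - R r" ?X] mult_left_mono[OF Rr sv.K_nonneg] by simp
      moreover have "vec_norm \<beta> (\<C> (?X - R r) - d) \<le> vec_norm \<beta> (\<C> ?X - d) + K2 * (SC * (KR * (2 * B * ?l)))"
        using vn.perturb[of "\<C> (?X - R r) - d" "\<C> ?X - d"] mult_left_mono[OF CRr vn.K_nonneg]
        by (simp add: linear_diff[OF linear_C])
      ultimately have "objective (?X - R r) \<le> \<mu>1 * (sv_norm \<alpha> ?X + K1 * (KR * (2 * B * ?l))) +
          \<mu>2 * (vec_norm \<beta> (\<C> ?X - d) + K2 * (SC * (KR * (2 * B * ?l))))"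
        unfolding objective_def using mu1 mu2 by (intro add_mono mult_left_mono) auto
      then show ?thesis by (simp add: objective_def E2_def algebra_simps)
    qed
    finally show "eps_optimal (E * ?l) ?X"
      using 1 El by (simp add: eps_optimal_def abs_le_iff)
  qed
  show ?thesis using that[OF E(1)] main by blast
qed

section \<open>Counting inner iterations\<close>

lemma N_APG_bound:
  obtains C where "0 < C" "\<And>k. real (N_APG (Suc k)) \<le> C / lam (Suc k)"
proof -
  obtain B where B: "0 \<le> B" "\<And>k. norm (mult1 k) \<le> B" "\<And>k. norm (mult2 k) \<le> B"
    using multipliers_bounded by blast
  obtain M where M: "0 \<le> M" "\<And>k. norm (X_iter k) \<le> M" "\<And>k. norm (s_iter k) \<le> M" "\<And>k. norm (y_iter k) \<le> M"
    using iterates_bounded by blast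
  define H where "H = eta + lam 1 * B\<^sup>2"
  define W where "W = (I_const / \<mu>1 + J_const / \<mu>2) * H +
    (SA * (I_const / \<mu>1) * H + (norm b + lam 1 * B) + 2 * norm (\<A> X0 - b)) + M + M + M"
  have H: "0 \<le> H" using lam_1_pos eta_nonneg by (simp add: H_def)
  have IJ: "0 \<le> I_const / \<mu>1" "0 \<le> J_const / \<mu>2" using sv.c_pos vn.c_pos mu1 mu2 by simp_all
  have W: "0 \<le> W"
    unfolding W_def using H IJ SA_nonneg M(1) B(1) lam_1_pos by (intro add_nonneg_nonneg mult_nonneg_nonneg) auto
  \<comment> \<open>As \<open>eps k\<close> is \<open>e0 * (lam k)\<^sup>2\<close>, the square root
    in \<open>l_max\<close> is a constant over \<open>lam k\<close>, while \<open>W\<close> bounds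
    the bracket.\<close>
  define c where "c = sqrt (2 * L_const / e0) * W"
  have c: "0 \<le> c" using W L_pos e0 by (simp add: c_def)
  have "real (N_APG (Suc k)) \<le> (c + lam 1) / lam (Suc k)" for k
  proof -
    let ?l = "lam (Suc k)"
    note l = lam_Suc_pos[of k] lam_le_1[of k]
    have e1: "eta1 (Suc k) (mult1 k) (mult2 k) \<le> H"
      using eta1_le[OF B(2,3)] by (simp add: H_def)
    have "norm (b + ?l *\<^sub>R mult1 k) \<le> norm b + ?l * norm (mult1 k)"
      using norm_triangle_ineq[of b "?l *\<^sub>R mult1 k"] l by simp
    also have "\<dots> \<le> norm b + lam 1 * B" using l B by (intro add_left_mono mult_mono) auto
    finally have "eta2 (Suc k) (mult1 k) (mult2 k) \<le>
        SA * (I_const / \<mu>1) * H + (norm b + lam 1 * B) + 2 * norm (\<A> X0 - b)"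
      unfolding eta2_def SA_def[symmetric] using e1 mult_nonneg_nonneg[OF SA_nonneg IJ(1)]
      by (intro add_mono mult_left_mono) auto
    then have W': "(I_const / \<mu>1 + J_const / \<mu>2) * eta1 (Suc k) (mult1 k) (mult2 k) + eta2 (Suc k) (mult1 k) (mult2 k)
        + norm (X_iter k) + norm (s_iter k) + norm (y_iter k) \<le> W"
      unfolding W_def using e1 IJ M by (intro add_mono mult_left_mono) auto
    have "l_max (Suc k) (mult1 k) (mult2 k) (z_iter k) \<le> sqrt (2 * L_const / eps (Suc k)) * W"
      unfolding z_iter_eq l_max_def prod.case using W' L_pos eps_pos[of "Suc k"] by (intro mult_left_mono) auto
    also have "\<dots> = c / ?l"
      using l by (simp add: c_def eps_eq real_sqrt_divide real_sqrt_mult)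
    finally have "real (inner_count (Suc k) (mult1 k) (mult2 k) (z_iter k)) \<le> c / ?l + 1"
      using c l by (intro inner_count_le) auto
    \<comment> \<open>The 1 from rounding up is absorbed, since \<open>lam 1 / ?l\<close> is at
      least 1.\<close>
    also have "\<dots> \<le> (c + lam 1) / ?l" using l by (simp add: field_simps)
    finally show ?thesis by (simp add: N_APG_def falc_state_eq)
  qed
  then show ?thesis using that[of "c + lam 1"] c lam_1_pos by simp
qed

text \<open>The terms grow by the factor 1/\<nu>. The bound reproduces itself exactly, since 1/((1 -
  \<nu>) \<lambda>) + 1/(\<nu> \<lambda>) = 1/((1 - \<nu>) \<nu> \<lambda>).\<close>

lemma sum_inverse_lam: "(\<Sum>k=1..Suc n. 1 / lam k) \<le> 1 / ((1 - \<nu>) * lam (Suc n))"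
proof (induction n)
  case 0
  have "(1 - \<nu>) * lam 1 \<le> lam 1" using nu lam_1_pos by (simp add: mult_le_cancel_right1)
  then show ?case using nu lam_1_pos by (simp add: frac_le)
next
  case (Suc n)
  have l: "lam (Suc (Suc n)) = \<nu> * lam (Suc n)" by (rule lam_Suc) simp
  have "(\<Sum>k=1..Suc (Suc n). 1 / lam k) \<le> 1 / ((1 - \<nu>) * lam (Suc n)) + 1 / lam (Suc (Suc n))"
    using Suc by simp
  also have "\<dots> = 1 / ((1 - \<nu>) * lam (Suc (Suc n)))"
    unfolding l using nu lam_Suc_pos[of n] by (simp add: field_simps)
  finally show ?case .
qed

lemma eventually_accurate:
  assumes "0 < E" "0 < \<epsilon>"
  shows "\<exists>k. E * lam (Suc k) \<le> \<epsilon>"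
proof -
  have "(\<lambda>k. E * (lam 1 * \<nu> ^ k)) \<longlonglongrightarrow> 0"
    using nu by (auto intro!: tendsto_eq_intros LIMSEQ_realpow_zero)
  from order_tendstoD(2)[OF this assms(2)] obtain k where "E * (lam 1 * \<nu> ^ k) < \<epsilon>"
    by (auto simp: eventually_sequentially)
  then show ?thesis by (intro exI[of _ k]) (simp add: lam_power[of k])
qed

lemma eps_feasible_mono: "eps_feasible \<delta> X \<Longrightarrow> \<delta> \<le> \<epsilon> \<Longrightarrow> eps_feasible \<epsilon> X"
  unfolding eps_feasible_def by (meson order.trans)

lemma eps_optimal_mono: "eps_optimal \<delta> X \<Longrightarrow> \<delta> \<le> \<epsilon> \<Longrightarrow> eps_optimal \<epsilon> X"
  unfolding eps_optimal_def by simp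

theorem falc_converges:
  assumes "0 < \<epsilon>"
  shows "\<exists>k\<ge>1. eps_feasible \<epsilon> (X_iter k) \<and> eps_optimal \<epsilon> (X_iter k)"
proof -
  obtain E where E: "0 < E" "\<And>k. eps_feasible (E * lam (Suc k)) (X_iter (Suc k))"
    "\<And>k. eps_optimal (E * lam (Suc k)) (X_iter (Suc k))"
    using error_bound by blast
  obtain k where k: "E * lam (Suc k) \<le> \<epsilon>" using eventually_accurate[OF E(1) assms] by blast
  show ?thesis
    using eps_feasible_mono[OF E(2) k] eps_optimal_mono[OF E(3) k] by (intro exI[of _ "Suc k"]) simp
qed

theorem N_inner_bigo: "(\<lambda>\<epsilon>. real (N_inner \<epsilon>)) \<in> O[at_right 0](\<lambda>\<epsilon>. 1 / \<epsilon>)"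
proof -
  obtain E where E: "0 < E" "\<And>k. eps_feasible (E * lam (Suc k)) (X_iter (Suc k))"
    "\<And>k. eps_optimal (E * lam (Suc k)) (X_iter (Suc k))"
    using error_bound by blast
  obtain C where C: "0 < C" "\<And>k. real (N_APG (Suc k)) \<le> C / lam (Suc k)"
    using N_APG_bound by blast
  have "real (N_inner \<epsilon>) \<le> C * E / ((1 - \<nu>) * \<nu>) * (1 / \<epsilon>)" if \<epsilon>: "0 < \<epsilon>" "\<epsilon> < E * lam 1" for \<epsilon>
  proof -
    \<comment> \<open>The first index whose guaranteed accuracy suffices; the run may succeed
      earlier. Failure at the preceding index keeps \<open>lam (Suc K)\<close> above a multiple of
      \<epsilon>.\<close>
    define K where "K = (LEAST k. E * lam (Suc k) \<le> \<epsilon>)"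
    have K: "E * lam (Suc K) \<le> \<epsilon>"
      unfolding K_def by (rule LeastI_ex) (rule eventually_accurate[OF E(1) \<epsilon>(1)])
    \<comment> \<open>Small \<epsilon> excludes success at the first iteration, so a preceding index
      exists.\<close>
    have "K \<noteq> 0" using K \<epsilon>(2) by (metis One_nat_def not_le)
    then obtain j where j: "K = Suc j" using not0_implies_Suc by blast
    have "\<epsilon> < E * lam (Suc j)"
      using not_less_Least[of j "\<lambda>k. E * lam (Suc k) \<le> \<epsilon>"] j by (simp add: K_def)
    then have "\<nu> * \<epsilon> \<le> E * lam (Suc K)"
      using nu unfolding j lam_Suc[of "Suc j", simplified] by (simp add: mult.left_commute)
    then have inv: "1 / lam (Suc K) \<le> E / (\<nu> * \<epsilon>)"
      using nu \<epsilon> lam_Suc_pos[of K] by (simp add: field_simps)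
    have "N_FALC \<epsilon> \<le> Suc K"
      unfolding N_FALC_def using eps_feasible_mono[OF E(2) K] eps_optimal_mono[OF E(3) K]
      by (intro Least_le) simp
    then have "N_inner \<epsilon> \<le> (\<Sum>k=1..Suc K. N_APG k)"
      unfolding N_inner_def by (intro sum_mono2) auto
    then have "real (N_inner \<epsilon>) \<le> (\<Sum>k=1..Suc K. real (N_APG k))"
      by (metis of_nat_le_iff of_nat_sum)
    also have "\<dots> \<le> (\<Sum>k=1..Suc K. C * (1 / lam k))"
    proof (rule sum_mono)
      fix k assume "k \<in> {1..Suc K}"
      then show "real (N_APG k) \<le> C * (1 / lam k)" using C(2)[of "k - 1"] by simp
    qed
    also have "\<dots> = C * (\<Sum>k=1..Suc K. 1 / lam k)" by (simp only: sum_distrib_left)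
    also have "\<dots> \<le> C * (1 / ((1 - \<nu>) * lam (Suc K)))"
      using C(1) sum_inverse_lam by (intro mult_left_mono) auto
    also have "\<dots> = C / (1 - \<nu>) * (1 / lam (Suc K))" by simp
    also have "\<dots> \<le> C / (1 - \<nu>) * (E / (\<nu> * \<epsilon>))"
      using inv C(1) nu by (intro mult_left_mono) auto
    finally show ?thesis by (simp add: mult_ac)
  qed
  then have "\<forall>\<^sub>F \<epsilon> in at_right 0. norm (real (N_inner \<epsilon>)) \<le> C * E / ((1 - \<nu>) * \<nu>) * norm (1 / \<epsilon>)"
    using E(1) lam_1_pos by (intro eventually_at_rightI[of 0 "E * lam 1"]) auto
  then show ?thesis by (rule bigoI)
qed

end

theorem theorem3p7:
  fixes \<alpha> \<beta> :: ell
    and \<mu>1 \<mu>2 :: real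
    and \<A> :: "real ^ 'n ^ 'm \<Rightarrow> real ^ 'q"
    and \<C> :: "real ^ 'n ^ 'm \<Rightarrow> real ^ 'p"
    and b :: "real ^ 'q"
    and d :: "real ^ 'p"
    and Q :: "(real ^ 'q) set"
    and X0 :: "real ^ 'n ^ 'm"
    and lam eps tau xi :: "nat \<Rightarrow> real"
    and \<kappa>1 \<kappa>2 \<nu> :: real
  assumes "\<mu>1 > 0" and "\<mu>2 > 0"
    and "linear \<A>" and "surj \<A>" and "linear \<C>"
    and "Q \<noteq> {}" and "closed Q" and "convex Q"
    and "\<A> X0 - b \<in> Q"
    and "0 < \<kappa>1" and "\<kappa>1 < 1" and "0 < \<kappa>2" and "\<kappa>2 < 1" and "0 < \<nu>" and "\<nu> < 1"
    and "lam 1 > 0" and "eps 1 > 0"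
    and "\<And>k. k \<ge> 1 \<Longrightarrow> lam (Suc k) = \<nu> * lam k"
    and "\<And>k. k \<ge> 1 \<Longrightarrow> eps (Suc k) = \<nu>\<^sup>2 * eps k"
    and "\<And>k. k \<ge> 1 \<Longrightarrow> tau k = \<kappa>1 * eps k"
    and "\<And>k. k \<ge> 1 \<Longrightarrow> xi k = \<kappa>2 * eps k"
  shows "(\<forall>\<epsilon>>0. \<exists>k\<ge>1.
            composite_norm_problem.eps_feasible \<A> b Q \<epsilon>
              (falc.X_iter \<alpha> \<beta> \<mu>1 \<mu>2 \<A> \<C> b d Q X0 lam eps tau xi k) \<and>
            composite_norm_problem.eps_optimal \<alpha> \<beta> \<mu>1 \<mu>2 \<A> \<C> b d Q \<epsilon>
              (falc.X_iter \<alpha> \<beta> \<mu>1 \<mu>2 \<A> \<C> b d Q X0 lam eps tau xi k)) \<and>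
         (\<lambda>\<epsilon>. real (falc.N_inner \<alpha> \<beta> \<mu>1 \<mu>2 \<A> \<C> b d Q X0 lam eps tau xi \<epsilon>))
            \<in> O[at_right 0](\<lambda>\<epsilon>. 1 / \<epsilon>)"
proof -
  have k1: "lam k > 0 \<and> eps k = eps 1 / (lam 1)\<^sup>2 * (lam k)\<^sup>2" if "k \<ge> 1" for k
    using that
  proof (induction k rule: dec_induct)
    case base
    then show ?case using assms(16) by simp
  next
    case (step k)
    then show ?case using assms(14) assms(18)[of k] assms(19)[of k] by (simp add: power_mult_distrib)
  qed
  have e0: "0 < eps 1 / (lam 1)\<^sup>2" using assms(16,17) by simp
  have eps_pos: "0 < eps k" if "k \<ge> 1" for k
    using k1[OF that] e0 by (metis mult_pos_pos zero_less_power)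
  interpret falc_geometric \<alpha> \<beta> \<mu>1 \<mu>2 \<A> \<C> b d Q X0 lam eps tau xi \<nu> "eps 1 / (lam 1)\<^sup>2" \<kappa>1 \<kappa>2
  proof (intro falc_geometric.intro falc_assms.intro falc_geometric_axioms.intro)
    show "0 \<le> \<kappa>1" "0 \<le> \<kappa>2" using assms(10,12) by simp_all
    show "0 < lam k" "eps k = eps 1 / (lam 1)\<^sup>2 * (lam k)\<^sup>2" if "1 \<le> k" for k
      using k1[OF that] by simp_all
  qed (fact assms e0 | erule assms eps_pos)+
  show ?thesis using falc_converges N_inner_bigo by blast
qed

end
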